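(* Let $T>0$, $u_0\in L^2(\mathbb{R}^d)$, and let $q\in L^\infty(\mathbb{R}^d)$ be non-negative. Consider the Cauchy problem $$u_t(t,x)-\Delta u(t,x)-q(x)u(t,x)=0,\quad(t,x)\in(0,T)\times\mathbb{R}^d,\qquad u(0,x)=u_0(x),$$ and let $u$ be its classical solution. Let $(u_\varepsilon)_\varepsilon$ be a very weak solution of this problem. Then, for any regularising families $(q_\varepsilon)_\varepsilon$ and $(u_{0,\varepsilon})_\varepsilon$ of $q$ and $u_0$, the net $(u_\varepsilon)_\varepsilon$ converges in $L^2$ as $\varepsilon\to0$ to the classical solution, i.e. $\Vert u_\varepsilon(t,\cdot)-u(t,\cdot)\Vert_{L^2}\to0$ as $\varepsilon\to0$ for $t\in[0,T]$.
   Context: The classical solution is the unique solution $u\in C([0,T];L^2(\mathbb{R}^d))$ of the Cauchy problem. Regularising families: $q_\varepsilon=q\ast\psi_\varepsilon$, $u_{0,\varepsilon}=u_0\ast\psi_\varepsilon$, where $\psi\in C_0^\infty(\mathbb{R}^d)$, $\psi\ge0$, $\int\psi=1$ (Friedrichs mollifier), $\psi_\varepsilon(x)=\omega(\varepsilon)^{-d}\psi(x/\omega(\varepsilon))$ for $\varepsilon\in(0,1]$, and $\omega(\varepsilon)$ is a positive function with $\omega(\varepsilon)\to0$ as $\varepsilon\to0$. Moderateness: for a Banach space $X$, a net $(f_\varepsilon)_{\varepsilon\in(0,1]}$ in $X$ is $X$-moderate if there exist $N\in\mathbb{N}_0$, $c>0$ with $\Vert f_\varepsilon\Vert_X\le c\,\omega(\varepsilon)^{-N}$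 for all $\varepsilon$. Very weak solution: the net $(u_\varepsilon)_\varepsilon$ is a very weak solution if, for an $L^\infty$-moderate regularisation $(q_\varepsilon)_\varepsilon$ of $q$ and an $L^2$-moderate regularisation $(u_{0,\varepsilon})_\varepsilon$ of $u_0$, $u_\varepsilon$ solves $\partial_t u_\varepsilon-\Delta u_\varepsilon-q_\varepsilon u_\varepsilon=0$ with $u_\varepsilon(0,\cdot)=u_{0,\varepsilon}$ for all $\varepsilon\in(0,1]$, and $(u_\varepsilon)_\varepsilon$ is $C([0,T];L^2(\mathbb{R}^d))$-moderate. *)

theory Defs
  imports "HOL-Analysis.Analysis" "HOL-Probability.Essential_Supremum"
begin

section \<open>Smooth and test functions\<close>

definition partial_deriv :: "'a::euclidean_space \<Rightarrow> ('a \<Rightarrow> real) \<Rightarrow> 'a \<Rightarrow> real" where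
  "partial_deriv i f x = frechet_derivative f (at x) i"

primrec Ck :: "nat \<Rightarrow> ('a::euclidean_space \<Rightarrow> real) \<Rightarrow> bool" where
  "Ck 0 f \<longleftrightarrow> continuous_on UNIV f"
| "Ck (Suc k) f \<longleftrightarrow> f differentiable_on UNIV \<and> (\<forall>i\<in>Basis. Ck k (partial_deriv i f))"

definition smooth :: "('a::euclidean_space \<Rightarrow> real) \<Rightarrow> bool" where
  "smooth f \<longleftrightarrow> (\<forall>k. Ck k f)"

definition supp :: "('a::euclidean_space \<Rightarrow> real) \<Rightarrow> 'a set" where
  "supp f = closure {x. f x \<noteq> 0}"

definition test_functions :: "'a::euclidean_space set \<Rightarrow> ('a \<Rightarrow> real) set" where
  "test_functions \<Omega> = {\<phi>. smooth \<phi> \<and> compact (supp \<phi>) \<and> supp \<phi> \<subseteq> \<Omega>}"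

definition dt :: "(real \<times> 'a::euclidean_space \<Rightarrow> real) \<Rightarrow> real \<times> 'a \<Rightarrow> real" where
  "dt \<phi> = partial_deriv (1, 0) \<phi>"

definition laplace :: "(real \<times> 'a::euclidean_space \<Rightarrow> real) \<Rightarrow> real \<times> 'a \<Rightarrow> real" where
  "laplace \<phi> z = (\<Sum>i\<in>Basis. partial_deriv (0, i) (partial_deriv (0, i) \<phi>) z)"


section \<open>Function spaces\<close>

text \<open>Elements of the spaces are represented by functions; equality in the spaces is equality
  almost everywhere.\<close>

definition L2 :: "('a::euclidean_space \<Rightarrow> complex) set" where
  "L2 = {f. f \<in> borel_measurable lebesgue \<and> integrable lebesgue (\<lambda>x. (norm (f x))\<^sup>2)}"

definition L2_norm :: "('a::euclidean_space \<Rightarrow> complex) \<Rightarrow> real" where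
  "L2_norm f = sqrt (LINT x|lebesgue. (norm (f x))\<^sup>2)"

definition Linf :: "('a::euclidean_space \<Rightarrow> real) set" where
  "Linf = {f. f \<in> borel_measurable lebesgue \<and> esssup lebesgue (\<lambda>x. ereal \<bar>f x\<bar>) < \<infinity>}"

definition Linf_norm :: "('a::euclidean_space \<Rightarrow> real) \<Rightarrow> real" where
  "Linf_norm f = real_of_ereal (esssup lebesgue (\<lambda>x. ereal \<bar>f x\<bar>))"

definition CL2 :: "real \<Rightarrow> (real \<Rightarrow> 'a::euclidean_space \<Rightarrow> complex) set" where
  "CL2 T = {u. (\<forall>t\<in>{0..T}. u t \<in> L2) \<and>
               (\<forall>t\<in>{0..T}. ((\<lambda>s. L2_norm (\<lambda>x. u s x - u t x)) \<longlongrightarrow> 0) (at t within {0..T}))}"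

definition CL2_norm :: "real \<Rightarrow> (real \<Rightarrow> 'a::euclidean_space \<Rightarrow> complex) \<Rightarrow> real" where
  "CL2_norm T u = (SUP t\<in>{0..T}. L2_norm (u t))"


section \<open>The Cauchy problem\<close>

text \<open>Solutions of \<open>u\<^sub>t - \<Delta>u - q u = 0\<close>, \<open>u(0) = u\<^sub>0\<close> in \<open>C([0,T]; L\<^sup>2)\<close>.  Such a \<open>u\<close> need not
  be differentiable, so the equation is understood in the sense of distributions on
  \<open>(0,T) \<times> \<real>\<^sup>d\<close>.  The pairing is an iterated integral: a representative of an element of
  \<open>C([0,T]; L\<^sup>2)\<close> is chosen for each \<open>t\<close> separately and need not be jointly measurable, whereas the
  inner integral does not depend on the choice and is continuous in \<open>t\<close>.\<close>

definition cauchy_solution ::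
  "real \<Rightarrow> ('a::euclidean_space \<Rightarrow> real) \<Rightarrow> ('a \<Rightarrow> complex) \<Rightarrow> (real \<Rightarrow> 'a \<Rightarrow> complex) \<Rightarrow> bool" where
  "cauchy_solution T q u0 u \<longleftrightarrow>
     u \<in> CL2 T \<and>
     (AE x in lebesgue. u 0 x = u0 x) \<and>
     (\<forall>\<phi>\<in>test_functions ({0<..<T} \<times> UNIV).
        (LINT t:{0<..<T}|lebesgue. LINT x|lebesgue.
           (- dt \<phi> (t, x) - laplace \<phi> (t, x) - q x * \<phi> (t, x)) *\<^sub>R u t x) = 0)"


section \<open>Regularisation, moderateness and very weak solutions\<close>

definition friedrichs_mollifier :: "('a::euclidean_space \<Rightarrow> real) \<Rightarrow> bool" where
  "friedrichs_mollifier \<psi> \<longleftrightarrow>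
     \<psi> \<in> test_functions UNIV \<and> (\<forall>x. \<psi> x \<ge> 0) \<and> (LINT x|lebesgue. \<psi> x) = 1"

definition mollifier_scale :: "(real \<Rightarrow> real) \<Rightarrow> bool" where
  "mollifier_scale \<omega> \<longleftrightarrow> (\<forall>\<epsilon>\<in>{0<..1}. \<omega> \<epsilon> > 0) \<and> (\<omega> \<longlongrightarrow> 0) (at_right 0)"

definition mollifier_net :: "('a::euclidean_space \<Rightarrow> real) \<Rightarrow> (real \<Rightarrow> real) \<Rightarrow> real \<Rightarrow> 'a \<Rightarrow> real" where
  "mollifier_net \<psi> \<omega> \<epsilon> x = \<psi> (x /\<^sub>R \<omega> \<epsilon>) / \<omega> \<epsilon> ^ DIM('a)"

definition convolution ::
  "('a::euclidean_space \<Rightarrow> 'b::{banach, second_countable_topology}) \<Rightarrow> ('a \<Rightarrow> real) \<Rightarrow> 'a \<Rightarrow> 'b" where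
  "convolution f g x = (LINT y|lebesgue. g (x - y) *\<^sub>R f y)"

definition regularising_family ::
  "('a::euclidean_space \<Rightarrow> real) \<Rightarrow> (real \<Rightarrow> real) \<Rightarrow>
   ('a \<Rightarrow> 'b::{banach, second_countable_topology}) \<Rightarrow> (real \<Rightarrow> 'a \<Rightarrow> 'b) \<Rightarrow> bool" where
  "regularising_family \<psi> \<omega> f F \<longleftrightarrow>
     (\<forall>\<epsilon>\<in>{0<..1}. F \<epsilon> = convolution f (mollifier_net \<psi> \<omega> \<epsilon>))"

definition moderate :: "(real \<Rightarrow> real) \<Rightarrow> 'f set \<Rightarrow> ('f \<Rightarrow> real) \<Rightarrow> (real \<Rightarrow> 'f) \<Rightarrow> bool" where
  "moderate \<omega> X norm_X F \<longleftrightarrow>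
     (\<forall>\<epsilon>\<in>{0<..1}. F \<epsilon> \<in> X) \<and>
     (\<exists>N::nat. \<exists>c>0. \<forall>\<epsilon>\<in>{0<..1}. norm_X (F \<epsilon>) \<le> c / \<omega> \<epsilon> ^ N)"

definition very_weak_solution ::
  "real \<Rightarrow> ('a::euclidean_space \<Rightarrow> real) \<Rightarrow> (real \<Rightarrow> real) \<Rightarrow>
   ('a \<Rightarrow> real) \<Rightarrow> ('a \<Rightarrow> complex) \<Rightarrow> (real \<Rightarrow> 'a \<Rightarrow> real) \<Rightarrow> (real \<Rightarrow> 'a \<Rightarrow> complex) \<Rightarrow>
   (real \<Rightarrow> real \<Rightarrow> 'a \<Rightarrow> complex) \<Rightarrow> bool" where
  "very_weak_solution T \<psi> \<omega> q u0 q_net u0_net u_net \<longleftrightarrow>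
     regularising_family \<psi> \<omega> q q_net \<and> moderate \<omega> Linf Linf_norm q_net \<and>
     regularising_family \<psi> \<omega> u0 u0_net \<and> moderate \<omega> L2 L2_norm u0_net \<and>
     (\<forall>\<epsilon>\<in>{0<..1}. cauchy_solution T (q_net \<epsilon>) (u0_net \<epsilon>) (u_net \<epsilon>)) \<and>
     moderate \<omega> (CL2 T) (CL2_norm T) u_net"

end

theory Submission
  imports Defs
begin

text \<open>The difference \<open>v = u\<^sub>\<epsilon> - u\<close> solves \<open>v\<^sub>t - \<Delta>v = F\<close> in the sense of distributions, with
  \<open>F = q\<^sub>\<epsilon> u\<^sub>\<epsilon> - q u = q\<^sub>\<epsilon> v + (q\<^sub>\<epsilon> - q) u\<close>.  Testing with products \<open>\<eta>(t) \<rho>(x)\<close>, where \<open>\<eta>\<close> runs through smooth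
  approximations of indicator functions of intervals, gives
  \<open>\<langle>v(t), \<rho>\<rangle> - \<langle>v(0), \<rho>\<rangle> = \<integral>\<^sub>0\<^sup>t \<langle>v, \<Delta>\<rho>\<rangle> + \<langle>F, \<rho>\<rangle> ds\<close>.  For \<open>\<rho> = \<psi>\<^sub>\<delta>(x - \<cdot>)\<close> this is, for each \<open>x\<close>, an ordinary
  differential equation for the mollification \<open>V = v * \<psi>\<^sub>\<delta>\<close>; integrating \<open>\<partial>\<^sub>t |V|\<^sup>2\<close> over \<open>x\<close> and discarding
  \<open>\<integral> V \<Delta>V \<le> 0\<close> yields, as \<open>\<delta> \<rightarrow> 0\<close>, the energy inequality
  \<open>\<parallel>v(t)\<parallel>\<^sup>2 \<le> \<parallel>v(0)\<parallel>\<^sup>2 + \<integral>\<^sub>0\<^sup>t \<parallel>v\<parallel>\<^sup>2 + \<parallel>F\<parallel>\<^sup>2 ds\<close>.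
  Since \<open>q\<^sub>\<epsilon>\<close> is bounded by the norm of \<open>q\<close>, Gronwall's inequality bounds \<open>\<parallel>v(t)\<parallel>\<^sup>2\<close> by a constant times
  \<open>\<parallel>u\<^sub>0\<^sub>,\<^sub>\<epsilon> - u\<^sub>0\<parallel>\<^sup>2 + \<integral>\<^sub>0\<^sup>T \<parallel>(q\<^sub>\<epsilon> - q) u\<parallel>\<^sup>2 ds\<close>, which tends to 0 because mollification converges in \<open>L\<^sup>2\<close>.\<close>

section \<open>The space \<open>L\<^sup>2\<close>\<close>

text \<open>The difference \<open>v\<close> cannot be inserted as a test function, since a curve in
  \<open>C([0,T]; L\<^sup>2)\<close> need not have a derivative in time. Mollifying in space alone
  suffices: for fixed \<open>x\<close> the tested equation makes the increment of
  \<open>V(\<cdot>, x)\<close> an integral of a function continuous in time, and \<open>V\<close> is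
  jointly continuous, so Fubini's theorem applies although representatives of \<open>v\<close> need
  not be jointly measurable. The distributional equation says nothing at \<open>t = 0\<close>;
  initial values come in through continuity in \<open>L\<^sup>2\<close>. In the splitting of
  \<open>F\<close> the coefficient difference has to fall on the fixed solution \<open>u\<close>:
  \<open>q\<^sub>\<epsilon>\<close> need not converge to \<open>q\<close> uniformly, but
  \<open>(q\<^sub>\<epsilon> - q) u(s)\<close> tends to 0 in \<open>L\<^sup>2\<close> for each
  \<open>s\<close>, by density of compactly supported functions and the bound on
  \<open>q\<^sub>\<epsilon>\<close>. That bound is common to all \<open>\<epsilon>\<close>, and so
  is the Gronwall constant.\<close>

lemma sigma_finite_lebesgue: "sigma_finite_measure (lebesgue :: 'a::euclidean_space measure)"
proof
  obtain A :: "'a set set" where A: "countable A" "A \<subseteq> sets lborel" "\<Union>A = space lborel"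
      "\<forall>a\<in>A. emeasure lborel a \<noteq> \<infinity>"
    using sigma_finite_measure.sigma_finite_countable[OF sigma_finite_lborel] by blast
  then show "\<exists>A. countable A \<and> A \<subseteq> sets lebesgue \<and> \<Union>A = space lebesgue \<and>
      (\<forall>a\<in>A. emeasure lebesgue (a::'a set) \<noteq> \<infinity>)"
    by (intro exI[of _ A]) (auto simp: emeasure_completion)
qed

lemma L2_measurable [measurable_dest]: "f \<in> L2 \<Longrightarrow> f \<in> borel_measurable lebesgue"
  and L2_integrable: "f \<in> L2 \<Longrightarrow> integrable lebesgue (\<lambda>x. (norm (f x))\<^sup>2)"
  by (auto simp: L2_def)

lemma L2_norm_nonneg: "0 \<le> L2_norm f"
  by (simp add: L2_norm_def)

lemma L2_norm_power2: "(L2_norm f)\<^sup>2 = (LINT x|lebesgue. (norm (f x))\<^sup>2)"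
  by (simp add: L2_norm_def)

lemma L2_norm_cong_AE:
  assumes "AE x in lebesgue. f x = g x" "f \<in> L2" "g \<in> L2"
  shows "L2_norm f = L2_norm g"
proof -
  note [measurable] = L2_measurable[OF assms(2)] L2_measurable[OF assms(3)]
  have "(LINT x|lebesgue. (norm (f x))\<^sup>2) = (LINT x|lebesgue. (norm (g x))\<^sup>2)"
    using assms(1) by (intro integral_cong_AE) auto
  then show ?thesis by (simp add: L2_norm_def)
qed

lemma norm_add_power2_le: "(norm (a + b))\<^sup>2 \<le> 2 * (norm a)\<^sup>2 + 2 * (norm b)\<^sup>2"
  for a b :: "'b::real_normed_vector"
proof -
  have "(norm (a + b))\<^sup>2 \<le> (norm a + norm b)\<^sup>2"
    by (intro power_mono norm_triangle_ineq) auto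
  also have "\<dots> \<le> 2 * (norm a)\<^sup>2 + 2 * (norm b)\<^sup>2"
    using sum_squares_bound[of "norm a" "norm b"] by (simp add: power2_sum)
  finally show ?thesis .
qed

lemma L2_mult_bounded:
  assumes f: "f \<in> L2" and [measurable]: "m \<in> borel_measurable lebesgue"
    and M: "AE x in lebesgue. \<bar>m x\<bar> \<le> M" "0 \<le> M"
  shows "(\<lambda>x. m x *\<^sub>R f x) \<in> L2" and "L2_norm (\<lambda>x. m x *\<^sub>R f x) \<le> M * L2_norm f"
proof -
  note [measurable] = L2_measurable[OF f]
  have le: "AE x in lebesgue. (norm (m x *\<^sub>R f x))\<^sup>2 \<le> M\<^sup>2 * (norm (f x))\<^sup>2"
    using M(1)
  proof eventually_elim
    case (elim x)
    then have "norm (m x *\<^sub>R f x) \<le> M * norm (f x)" by (simp add: mult_right_mono)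
    then show ?case by (metis norm_ge_zero power_mono power_mult_distrib)
  qed
  have int: "integrable lebesgue (\<lambda>x. (norm (m x *\<^sub>R f x))\<^sup>2)"
    by (rule Bochner_Integration.integrable_bound[of _ "\<lambda>x. M\<^sup>2 * (norm (f x))\<^sup>2"])
       (use le L2_integrable[OF f] in auto)
  then show "(\<lambda>x. m x *\<^sub>R f x) \<in> L2" by (auto simp: L2_def)
  have "(LINT x|lebesgue. (norm (m x *\<^sub>R f x))\<^sup>2) \<le> (LINT x|lebesgue. M\<^sup>2 * (norm (f x))\<^sup>2)"
    using le int L2_integrable[OF f] by (intro integral_mono_AE) auto
  then show "L2_norm (\<lambda>x. m x *\<^sub>R f x) \<le> M * L2_norm f"
    using M(2) real_sqrt_le_mono by (fastforce simp: L2_norm_def real_sqrt_mult)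
qed

lemma L2_scaleR: "f \<in> L2 \<Longrightarrow> (\<lambda>x. c *\<^sub>R f x) \<in> L2"
  using L2_mult_bounded(1)[of f "\<lambda>_. c" "\<bar>c\<bar>"] by simp

lemma L2_norm_minus_commute: "L2_norm (\<lambda>x. f x - g x) = L2_norm (\<lambda>x. g x - f x)"
  by (simp add: L2_norm_def norm_minus_commute)

lemma L2_add: assumes "f \<in> L2" "g \<in> L2" shows "(\<lambda>x. f x + g x) \<in> L2"
proof -
  note [measurable] = L2_measurable[OF assms(1)] L2_measurable[OF assms(2)]
  have "integrable lebesgue (\<lambda>x. (norm (f x + g x))\<^sup>2)"
    by (rule Bochner_Integration.integrable_bound[of _ "\<lambda>x. 2 * (norm (f x))\<^sup>2 + 2 * (norm (g x))\<^sup>2"])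
       (use norm_add_power2_le assms[THEN L2_integrable] in auto)
  then show ?thesis by (simp add: L2_def)
qed

lemma L2_diff: assumes "f \<in> L2" "g \<in> L2" shows "(\<lambda>x. f x - g x) \<in> L2"
  using L2_add[OF assms(1) L2_scaleR[OF assms(2), of "-1"]] by simp

text \<open>Inherited from the inequality for nonnegative extended integrals, applied to |f| and
  |g|. Integrability of the product comes first, from 2|fg| \<le> f^2 + g^2; it makes the extended
  integral of |fg| finite, so that the inequality can be read in the reals.\<close>

lemma Cauchy_Schwarz_integral:
  fixes f g :: "'a \<Rightarrow> real"
  assumes [measurable]: "f \<in> borel_measurable M" "g \<in> borel_measurable M"
    and f: "integrable M (\<lambda>x. (f x)\<^sup>2)" and g: "integrable M (\<lambda>x. (g x)\<^sup>2)"
  shows "integrable M (\<lambda>x. f x * g x)"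
    and "\<bar>LINT x|M. f x * g x\<bar> \<le> sqrt (LINT x|M. (f x)\<^sup>2) * sqrt (LINT x|M. (g x)\<^sup>2)"
proof -
  show int: "integrable M (\<lambda>x. f x * g x)"
  proof (rule Bochner_Integration.integrable_bound[of _ "\<lambda>x. (f x)\<^sup>2 + (g x)\<^sup>2"])
    have "\<bar>f x * g x\<bar> \<le> (f x)\<^sup>2 + (g x)\<^sup>2" for x
    proof -
      have "2 * \<bar>f x * g x\<bar> \<le> (f x)\<^sup>2 + (g x)\<^sup>2"
        using sum_squares_bound[of "\<bar>f x\<bar>" "\<bar>g x\<bar>"] by (simp add: abs_mult mult.assoc)
      then show ?thesis using abs_ge_zero[of "f x * g x"] by linarith
    qed
    then show "AE x in M. norm (f x * g x) \<le> norm ((f x)\<^sup>2 + (g x)\<^sup>2)" by auto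
  qed (use f g in auto)
  have "ennreal ((LINT x|M. \<bar>f x\<bar> * \<bar>g x\<bar>)\<^sup>2) = (\<integral>\<^sup>+x. ennreal \<bar>f x\<bar> * ennreal \<bar>g x\<bar> \<partial>M)\<^sup>2"
  proof -
    have "ennreal (LINT x|M. \<bar>f x\<bar> * \<bar>g x\<bar>) = (\<integral>\<^sup>+x. ennreal (\<bar>f x\<bar> * \<bar>g x\<bar>) \<partial>M)"
      by (rule nn_integral_eq_integral[symmetric])
         (use integrable_abs[OF int] in \<open>auto simp: abs_mult\<close>)
    then show ?thesis by (simp add: ennreal_mult flip: ennreal_power)
  qed
  also have "\<dots> \<le> (\<integral>\<^sup>+x. (ennreal \<bar>f x\<bar>)\<^sup>2 \<partial>M) * (\<integral>\<^sup>+x. (ennreal \<bar>g x\<bar>)\<^sup>2 \<partial>M)"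
    by (rule Cauchy_Schwarz_nn_integral) auto
  also have "\<dots> = ennreal ((LINT x|M. (f x)\<^sup>2) * (LINT x|M. (g x)\<^sup>2))"
    using f g by (simp add: ennreal_power nn_integral_eq_integral ennreal_mult)
  finally have *: "(LINT x|M. \<bar>f x\<bar> * \<bar>g x\<bar>)\<^sup>2 \<le> (LINT x|M. (f x)\<^sup>2) * (LINT x|M. (g x)\<^sup>2)"
    by (subst (asm) ennreal_le_iff) auto
  have "\<bar>LINT x|M. f x * g x\<bar> \<le> (LINT x|M. \<bar>f x\<bar> * \<bar>g x\<bar>)"
    using integral_norm_bound[of M "\<lambda>x. f x * g x"] by (simp add: abs_mult)
  also have "\<dots> \<le> sqrt ((LINT x|M. (f x)\<^sup>2) * (LINT x|M. (g x)\<^sup>2))"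
    using * by (rule real_le_rsqrt)
  finally show "\<bar>LINT x|M. f x * g x\<bar> \<le> sqrt (LINT x|M. (f x)\<^sup>2) * sqrt (LINT x|M. (g x)\<^sup>2)"
    by (simp add: real_sqrt_mult)
qed

lemma L2_norm_mult:
  assumes "f \<in> L2" "g \<in> L2"
  shows "integrable lebesgue (\<lambda>x. norm (f x) * norm (g x))"
    and "(LINT x|lebesgue. norm (f x) * norm (g x)) \<le> L2_norm f * L2_norm g"
proof -
  note [measurable] = L2_measurable[OF assms(1)] L2_measurable[OF assms(2)]
  note * = Cauchy_Schwarz_integral[of "\<lambda>x. norm (f x)" lebesgue "\<lambda>x. norm (g x)"]
  show "integrable lebesgue (\<lambda>x. norm (f x) * norm (g x))"
    by (rule *) (use assms[THEN L2_integrable] in auto)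
  have "\<bar>LINT x|lebesgue. norm (f x) * norm (g x)\<bar> \<le> L2_norm f * L2_norm g"
    unfolding L2_norm_def by (rule *) (use assms[THEN L2_integrable] in auto)
  then show "(LINT x|lebesgue. norm (f x) * norm (g x)) \<le> L2_norm f * L2_norm g" by linarith
qed

text \<open>On complex values \<open>\<bullet>\<close> is the real inner product, so the integral is
  the real part of the Hermitian pairing. That is the quantity which the energy method meets, the
  time derivative of |V|^2 being \<open>2 * (V \<bullet> G)\<close>.\<close>

lemma L2_integrable_inner:
  assumes "f \<in> L2" "g \<in> L2"
  shows "integrable lebesgue (\<lambda>x. f x \<bullet> g x)"
    and "\<bar>LINT x|lebesgue. f x \<bullet> g x\<bar> \<le> L2_norm f * L2_norm g"
proof -
  note [measurable] = L2_measurable[OF assms(1)] L2_measurable[OF assms(2)]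
  show 1: "integrable lebesgue (\<lambda>x. f x \<bullet> g x)"
    by (rule Bochner_Integration.integrable_bound[OF L2_norm_mult(1)[OF assms]])
       (auto simp: Cauchy_Schwarz_ineq2)
  have "\<bar>LINT x|lebesgue. f x \<bullet> g x\<bar> \<le> (LINT x|lebesgue. \<bar>f x \<bullet> g x\<bar>)"
    using integral_norm_bound[of lebesgue "\<lambda>x. f x \<bullet> g x"] by simp
  also have "\<dots> \<le> (LINT x|lebesgue. norm (f x) * norm (g x))"
    using 1 L2_norm_mult(1)[OF assms] by (intro integral_mono) (auto simp: Cauchy_Schwarz_ineq2)
  finally show "\<bar>LINT x|lebesgue. f x \<bullet> g x\<bar> \<le> L2_norm f * L2_norm g"
    using L2_norm_mult(2)[OF assms] by linarith
qed

lemma L2_norm_triangle: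
  assumes "f \<in> L2" "g \<in> L2"
  shows "L2_norm (\<lambda>x. f x + g x) \<le> L2_norm f + L2_norm g"
proof (rule power2_le_imp_le)
  have "(L2_norm (\<lambda>x. f x + g x))\<^sup>2
      = (LINT x|lebesgue. (norm (f x))\<^sup>2 + 2 * (f x \<bullet> g x) + (norm (g x))\<^sup>2)"
    unfolding L2_norm_power2 by (simp add: power2_norm_eq_inner inner_add inner_commute algebra_simps)
  also have "\<dots> = (L2_norm f)\<^sup>2 + 2 * (LINT x|lebesgue. f x \<bullet> g x) + (L2_norm g)\<^sup>2"
    unfolding L2_norm_power2 using L2_integrable_inner(1)[OF assms] assms[THEN L2_integrable] by simp
  also have "\<dots> \<le> (L2_norm f + L2_norm g)\<^sup>2"
    using L2_integrable_inner(2)[OF assms] by (simp add: power2_sum)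
  finally show "(L2_norm (\<lambda>x. f x + g x))\<^sup>2 \<le> (L2_norm f + L2_norm g)\<^sup>2" .
qed (simp add: L2_norm_nonneg)

lemma L2_norm_triangle_via:
  assumes "f \<in> L2" "g \<in> L2" "h \<in> L2"
  shows "L2_norm (\<lambda>x. f x - h x) \<le> L2_norm (\<lambda>x. f x - g x) + L2_norm (\<lambda>x. g x - h x)"
  using L2_norm_triangle[OF L2_diff[OF assms(1,2)] L2_diff[OF assms(2,3)]] by simp

lemma L2_norm_le_diff:
  assumes "f \<in> L2" "g \<in> L2"
  shows "L2_norm f \<le> L2_norm (\<lambda>x. f x - g x) + L2_norm g"
  using L2_norm_triangle[OF L2_diff[OF assms] assms(2)] by simp

lemma L2_norm_diff_abs:
  assumes "f \<in> L2" "g \<in> L2"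
  shows "\<bar>L2_norm f - L2_norm g\<bar> \<le> L2_norm (\<lambda>x. f x - g x)"
  using L2_norm_le_diff[OF assms] L2_norm_le_diff[OF assms(2,1)]
  by (simp add: L2_norm_minus_commute[of f g])

lemma L2_norm_tendsto:
  assumes "f \<in> L2" "\<forall>\<^sub>F i in F. g i \<in> L2" "((\<lambda>i. L2_norm (\<lambda>x. g i x - f x)) \<longlongrightarrow> 0) F"
  shows "((\<lambda>i. L2_norm (g i)) \<longlongrightarrow> L2_norm f) F"
  apply (rule Lim_null[THEN iffD2], rule Lim_null_comparison[OF _ assms(3)])
  using assms(2) by eventually_elim (use L2_norm_diff_abs assms(1) in auto)

text \<open>The squared difference is dominated directly, because that is what the applications
  offer: a multiple of the indicator of a ball for bounded functions with a common support, or |f|^2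
  for truncations of \<open>f\<close>.\<close>

lemma L2_norm_dominated_convergence:
  fixes g :: "nat \<Rightarrow> 'a::euclidean_space \<Rightarrow> complex"
  assumes "\<And>n. g n \<in> borel_measurable lebesgue" "f \<in> borel_measurable lebesgue"
    and "integrable lebesgue w" "\<And>n. AE x in lebesgue. (norm (g n x - f x))\<^sup>2 \<le> w x"
    and "AE x in lebesgue. (\<lambda>n. g n x) \<longlonglongrightarrow> f x"
  shows "(\<lambda>n. L2_norm (\<lambda>x. g n x - f x)) \<longlonglongrightarrow> 0"
proof -
  note [measurable] = assms(1,2)
  have "(\<lambda>n. LINT x|lebesgue. (norm (g n x - f x))\<^sup>2) \<longlonglongrightarrow> (LINT x::'a|lebesgue. 0)"
  proof (rule integral_dominated_convergence[OF _ _ assms(3)])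
    show "AE x in lebesgue. (\<lambda>n. (norm (g n x - f x))\<^sup>2) \<longlonglongrightarrow> 0"
      using assms(5)
    proof eventually_elim
      case (elim x)
      then have "(\<lambda>n. (norm (g n x - f x))\<^sup>2) \<longlonglongrightarrow> (norm (f x - f x))\<^sup>2" by (intro tendsto_intros)
      then show ?case by simp
    qed
  qed (use assms(4) in auto)
  then have "(\<lambda>n. sqrt (LINT x|lebesgue. (norm (g n x - f x))\<^sup>2)) \<longlonglongrightarrow> sqrt 0"
    by (intro tendsto_real_sqrt) simp
  then show ?thesis by (simp add: L2_norm_def)
qed

section \<open>Convolution with compactly supported continuous functions\<close>
text \<open>Compact support is expressed by vanishing outside a ball, because the dominating
  functions below are built from that radius. The range is left general: real kernels and complex
  approximants both belong here. \<open>R\<close> may have any sign; \<open>Cc_bounds\<close>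
  supplies a positive one.\<close>

definition Cc :: "('a::euclidean_space \<Rightarrow> 'b::real_normed_vector) set" where
  "Cc = {g. continuous_on UNIV g \<and> (\<exists>R. \<forall>x. R < norm x \<longrightarrow> g x = 0)}"

lemma Cc_continuous: "g \<in> Cc \<Longrightarrow> continuous_on UNIV g"
  by (simp add: Cc_def)

lemma CcI: "continuous_on UNIV g \<Longrightarrow> (\<And>x. R < norm x \<Longrightarrow> g x = 0) \<Longrightarrow> g \<in> Cc"
  unfolding Cc_def by blast

lemma Cc_vanish:
  assumes "g \<in> Cc"
  obtains R where "\<And>x. R < norm x \<Longrightarrow> g x = 0"
  using assms unfolding Cc_def by blast

lemma Cc_compose:
  assumes g: "g \<in> Cc" and h: "continuous_on UNIV h" "h 0 = 0"
  shows "(\<lambda>x. h (g x)) \<in> Cc"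
proof -
  obtain R where "\<And>x. R < norm x \<Longrightarrow> g x = 0" using g by (rule Cc_vanish) blast
  then show ?thesis
    using h by (intro CcI[of _ R] continuous_on_compose2[OF h(1) Cc_continuous[OF g]]) auto
qed

lemma Cc_borel: "g \<in> Cc \<Longrightarrow> g \<in> borel_measurable borel"
  by (simp add: Cc_def borel_measurable_continuous_onI)

lemma borel_imp_lebesgue: "g \<in> borel_measurable borel \<Longrightarrow> g \<in> borel_measurable lebesgue"
  by (simp add: measurable_completion)

lemma Cc_bounds:
  assumes "g \<in> Cc"
  obtains R K where "0 < R" "0 < K" "\<And>x. norm (g x) \<le> K" "\<And>x. R < norm x \<Longrightarrow> g x = 0"
proof -
  obtain R where R: "\<And>x. R < norm x \<Longrightarrow> g x = 0" using assms by (auto simp: Cc_def)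
  have "compact (g ` cball 0 R)"
    using continuous_on_subset[OF Cc_continuous[OF assms]] by (intro compact_continuous_image) auto
  then have "bounded (g ` cball 0 R)" by (rule compact_imp_bounded)
  then obtain K where K: "\<forall>y\<in>g ` cball 0 R. norm y \<le> K" "0 < K"
    unfolding bounded_pos by blast
  have "norm (g x) \<le> K" for x
  proof (cases "norm x \<le> R")
    case False
    then show ?thesis using R[of x] K(2) by simp
  qed (use K in simp)
  then show ?thesis using R K(2) that[of "max R 1" K] by simp
qed

text \<open>One change of variable serves for reflection (\<open>c = -1\<close>), translation
  (\<open>c = 1\<close>) and dilation. Beyond radius (|R| + |a|) / |c| the argument of
  \<open>g\<close> has norm above |R|.\<close>

lemma Cc_affine:
  assumes "g \<in> Cc" "c \<noteq> 0"
  shows "(\<lambda>y. g (a + c *\<^sub>R y)) \<in> Cc"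
proof -
  obtain R where R: "\<And>x. R < norm x \<Longrightarrow> g x = 0" using assms by (auto simp: Cc_def)
  have "g (a + c *\<^sub>R y) = 0" if "(\<bar>R\<bar> + norm a) / \<bar>c\<bar> < norm y" for y
  proof (rule R)
    have "\<bar>R\<bar> + norm a < \<bar>c\<bar> * norm y" using that assms(2) by (simp add: field_simps)
    then show "R < norm (a + c *\<^sub>R y)"
      using norm_diff_ineq[of "c *\<^sub>R y" a] by (simp add: add.commute)
  qed
  moreover have "continuous_on UNIV (\<lambda>y. g (a + c *\<^sub>R y))"
    by (rule continuous_on_compose2[OF Cc_continuous[OF assms(1)]]) (auto intro!: continuous_intros)
  ultimately show ?thesis unfolding Cc_def by blast
qed

lemma Cc_reflect: "g \<in> Cc \<Longrightarrow> (\<lambda>y. g (x - y)) \<in> Cc"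
  using Cc_affine[of g "-1" x] by simp

lemma Cc_add: assumes "f \<in> Cc" "g \<in> Cc" shows "(\<lambda>x. f x + g x) \<in> Cc"
proof -
  obtain R where R: "\<And>x. R < norm x \<Longrightarrow> f x = 0" using assms(1) by (rule Cc_vanish) blast
  obtain S where S: "\<And>x. S < norm x \<Longrightarrow> g x = 0" using assms(2) by (rule Cc_vanish) blast
  show ?thesis
    by (rule CcI[of _ "max R S"]) (use R S assms in \<open>auto intro: continuous_on_add Cc_continuous\<close>)
qed

lemma Cc_scaleR: "g \<in> Cc \<Longrightarrow> (\<lambda>x. c *\<^sub>R g x) \<in> Cc"
  by (rule Cc_compose) (auto intro!: continuous_intros)

lemma Cc_cmult: "g \<in> Cc \<Longrightarrow> (\<lambda>x. c * g x :: real) \<in> Cc"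
  using Cc_scaleR[of g c] by simp

lemma Cc_diff: "f \<in> Cc \<Longrightarrow> g \<in> Cc \<Longrightarrow> (\<lambda>x. f x - g x) \<in> Cc"
  using Cc_add[of f "\<lambda>x. (-1) *\<^sub>R g x"] Cc_scaleR[of g "-1"] by simp

lemma Cc_sum: "finite I \<Longrightarrow> (\<And>i. i \<in> I \<Longrightarrow> g i \<in> Cc) \<Longrightarrow> (\<lambda>x. \<Sum>i\<in>I. g i x) \<in> Cc"
proof (induction I rule: finite_induct)
  case empty
  then show ?case by (simp add: Cc_def)
next
  case (insert i I)
  then show ?case using Cc_add[of "g i" "\<lambda>x. \<Sum>i\<in>I. g i x"] by simp
qed

lemma Cc_abs: "g \<in> Cc \<Longrightarrow> (\<lambda>x. \<bar>g x\<bar> :: real) \<in> Cc"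
  by (rule Cc_compose) (auto intro!: continuous_intros)

lemma Cc_norm_power2: "g \<in> Cc \<Longrightarrow> (\<lambda>x. (norm (g x))\<^sup>2) \<in> Cc"
  by (rule Cc_compose) (auto intro!: continuous_intros)

lemma integrable_indicator_cball: "integrable lebesgue (indicator (cball c R) :: 'a::euclidean_space \<Rightarrow> real)"
  by (rule integrable_real_indicator) (use emeasure_lborel_cball_finite[of c R] in \<open>auto simp: less_top\<close>)

lemma Cc_integrable:
  fixes g :: "'a::euclidean_space \<Rightarrow> 'b::{banach, second_countable_topology}"
  assumes "g \<in> Cc" shows "integrable lebesgue g"
proof -
  obtain R K where RK: "0 < R" "0 < K" "\<And>x. norm (g x) \<le> K" "\<And>x. R < norm x \<Longrightarrow> g x = 0"
    using Cc_bounds[OF assms] by blast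
  show ?thesis
  proof (rule Bochner_Integration.integrable_bound[of _ "\<lambda>x. K * indicator (cball 0 R) x :: real"])
    show "integrable lebesgue (\<lambda>x. K * indicator (cball 0 R) x :: real)"
      by (intro integrable_mult_right integrable_indicator_cball)
    show "AE x in lebesgue. norm (g x) \<le> norm (K * indicator (cball 0 R) x :: real)"
      using RK by (intro AE_I2) (auto simp: indicator_def not_le)
  qed (use Cc_borel[OF assms] borel_imp_lebesgue in auto)
qed

lemma Cc_imp_L2: "g \<in> Cc \<Longrightarrow> g \<in> L2"
  using Cc_integrable[OF Cc_norm_power2] Cc_borel borel_imp_lebesgue by (auto simp: L2_def)

lemma L2_integrable_cball:
  assumes "f \<in> L2"
  shows "integrable lebesgue (\<lambda>x. indicator (cball c R) x * norm (f x))"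
proof -
  note [measurable] = L2_measurable[OF assms]
  have "integrable lebesgue (\<lambda>x. (indicator (cball c R) x)\<^sup>2 :: real)"
    using integrable_indicator_cball[of c R] by (simp add: power2_eq_square flip: indicator_inter_arith)
  then show ?thesis
    using L2_integrable[OF assms] integrable_indicator_cball[THEN borel_measurable_integrable]
    by (intro Cauchy_Schwarz_integral(1)) auto
qed

lemma integrable_Cc_L2:
  fixes g :: "'a::euclidean_space \<Rightarrow> real"
  assumes g: "g \<in> Cc" and f: "f \<in> L2"
  shows "integrable lebesgue (\<lambda>y. g y *\<^sub>R f y)"
    and "norm (LINT y|lebesgue. g y *\<^sub>R f y) \<le> sqrt (LINT y|lebesgue. (g y)\<^sup>2) * L2_norm f"
proof -
  note [measurable] = L2_measurable[OF f] borel_imp_lebesgue[OF Cc_borel[OF g]]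
  have g2: "integrable lebesgue (\<lambda>x. \<bar>g x\<bar>\<^sup>2)" using Cc_integrable[OF Cc_norm_power2[OF g]] by simp
  note cs = Cauchy_Schwarz_integral[OF _ _ g2 L2_integrable[OF f]]
  have int: "integrable lebesgue (\<lambda>y. norm (g y *\<^sub>R f y))"
    using cs(1) by simp
  then show "integrable lebesgue (\<lambda>y. g y *\<^sub>R f y)" by (subst (asm) integrable_norm_iff) auto
  have "norm (LINT y|lebesgue. g y *\<^sub>R f y) \<le> (LINT y|lebesgue. norm (g y *\<^sub>R f y))"
    by (rule integral_norm_bound)
  also have "\<dots> \<le> sqrt (LINT y|lebesgue. (g y)\<^sup>2) * L2_norm f"
    using cs(2) by (simp add: L2_norm_def)
  finally show "norm (LINT y|lebesgue. g y *\<^sub>R f y) \<le> sqrt (LINT y|lebesgue. (g y)\<^sup>2) * L2_norm f" .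
qed

text \<open>For a Borel function the completed measure can be replaced by \<open>lborel\<close>,
  where the affine image of the measure is explicit. Accordingly, the substitutions below are made
  in Borel, mostly continuous, functions.\<close>

lemma lebesgue_integral_affine_borel:
  fixes g :: "'a::euclidean_space \<Rightarrow> 'b::{banach, second_countable_topology}"
  assumes [measurable]: "g \<in> borel_measurable borel" and c: "c \<noteq> 0"
  shows "(LINT x|lebesgue. g x) = \<bar>c\<bar> ^ DIM('a) *\<^sub>R (LINT x|lebesgue. g (a + c *\<^sub>R x))"
proof -
  have "(LINT x|lborel. g x) = \<bar>c\<bar> ^ DIM('a) *\<^sub>R (LINT x|lborel. g (a + c *\<^sub>R x))"
    by (subst lborel_affine[OF c, of a])
       (simp add: integral_density integral_distr)
  then show ?thesis by (simp add: integral_completion)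
qed

lemma lebesgue_integral_reflect_borel:
  fixes g :: "'a::euclidean_space \<Rightarrow> 'b::{banach, second_countable_topology}"
  assumes "g \<in> borel_measurable borel"
  shows "(LINT y|lebesgue. g (x - y)) = (LINT y|lebesgue. g y)"
  using lebesgue_integral_affine_borel[OF assms, of "-1" x] by simp

lemma lebesgue_integral_translate_borel:
  fixes g :: "'a::euclidean_space \<Rightarrow> 'b::{banach, second_countable_topology}"
  assumes "g \<in> borel_measurable borel"
  shows "(LINT y|lebesgue. g (y + x)) = (LINT y|lebesgue. g y)"
  using lebesgue_integral_affine_borel[OF assms, of 1 x] by (simp add: add.commute)

lemma nn_integral_lebesgue_translate_borel:
  fixes g :: "'a::euclidean_space \<Rightarrow> ennreal"
  assumes [measurable]: "g \<in> borel_measurable borel"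
  shows "(\<integral>\<^sup>+y. g (y - x) \<partial>lebesgue) = (\<integral>\<^sup>+y. g y \<partial>lebesgue)"
proof -
  have "(\<integral>\<^sup>+y. g (y - x) \<partial>lborel) = (\<integral>\<^sup>+y. g y \<partial>lborel)"
    by (subst (2) lborel_affine[of 1 "-x"]) (simp_all add: nn_integral_density nn_integral_distr)
  then show ?thesis by (simp add: nn_integral_completion)
qed

lemma convolution_integrable:
  "f \<in> L2 \<Longrightarrow> g \<in> Cc \<Longrightarrow> integrable lebesgue (\<lambda>y. g (x - y) *\<^sub>R f y)"
  by (rule integrable_Cc_L2(1)[OF Cc_reflect])

text \<open>Cauchy-Schwarz for each \<open>x\<close>; by reflection invariance the constant does not
  depend on \<open>x\<close>. This uniformity later gives joint continuity in time and
  space.\<close>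

lemma norm_convolution_le:
  assumes "f \<in> L2" "g \<in> Cc"
  shows "norm (convolution f g x) \<le> sqrt (LINT y|lebesgue. (g y)\<^sup>2) * L2_norm f"
  using integrable_Cc_L2(2)[OF Cc_reflect[OF assms(2), of x] assms(1)]
    lebesgue_integral_reflect_borel[of "\<lambda>y. (g y)\<^sup>2" x] Cc_borel[OF assms(2)]
  by (simp add: convolution_def)

lemma convolution_diff_left:
  assumes "f \<in> L2" "f' \<in> L2" "g \<in> Cc"
  shows "convolution (\<lambda>x. f x - f' x) g x = convolution f g x - convolution f' g x"
  unfolding convolution_def scaleR_diff_right
  by (intro Bochner_Integration.integral_diff convolution_integrable assms)

lemma convolution_add_right:
  assumes "f \<in> L2" "g \<in> Cc" "g' \<in> Cc"
  shows "convolution f (\<lambda>x. g x + g' x) x = convolution f g x + convolution f g' x"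
  unfolding convolution_def scaleR_add_left
  by (intro Bochner_Integration.integral_add convolution_integrable assms)

lemma convolution_diff_right:
  assumes "f \<in> L2" "g \<in> Cc" "g' \<in> Cc"
  shows "convolution f (\<lambda>x. g x - g' x) x = convolution f g x - convolution f g' x"
  unfolding convolution_def scaleR_diff_left
  by (intro Bochner_Integration.integral_diff convolution_integrable assms)

lemma convolution_cmult_right:
  "convolution f (\<lambda>x. c * g x) x = c *\<^sub>R convolution f g x"
  unfolding convolution_def by (simp flip: scaleR_scaleR)

lemma convolution_sum_right:
  assumes "f \<in> L2" "\<And>i. i \<in> I \<Longrightarrow> g i \<in> Cc"
  shows "convolution f (\<lambda>x. \<Sum>i\<in>I. g i x) x = (\<Sum>i\<in>I. convolution f (g i) x)"
  unfolding convolution_def scaleR_sum_left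
  by (intro Bochner_Integration.integral_sum convolution_integrable assms)

text \<open>A sequence tending to \<open>x\<close> eventually stays within distance 1 of
  \<open>x\<close>, so all the shifted kernels live in the ball of radius \<open>R + 1\<close> about
  \<open>x\<close>. On that ball \<open>f\<close> is integrable, which yields the dominating
  function.\<close>

lemma continuous_convolution:
  assumes f: "f \<in> L2" and g: "g \<in> Cc"
  shows "continuous_on UNIV (convolution f g)"
proof -
  obtain R K where RK: "0 < R" "0 < K" "\<And>x. norm (g x) \<le> K" "\<And>x. R < norm x \<Longrightarrow> g x = 0"
    using Cc_bounds[OF g] by blast
  note [measurable] = L2_measurable[OF f]
  have "(\<lambda>n. convolution f g (X n)) \<longlonglongrightarrow> convolution f g x" if X: "X \<longlonglongrightarrow> x" for X x
  proof -
    have "\<exists>N. \<forall>n\<ge>N. dist (X n) x < 1"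
      using tendstoD[OF X zero_less_one] by (simp add: eventually_sequentially)
    then obtain N where N: "\<And>n. n \<ge> N \<Longrightarrow> dist (X n) x < 1" by blast
    have "(\<lambda>n. convolution f g (X (n + N))) \<longlonglongrightarrow> convolution f g x"
      unfolding convolution_def
    proof (rule integral_dominated_convergence)
      show "integrable lebesgue (\<lambda>y. K * (indicator (cball x (R + 1)) y * norm (f y)))"
        by (intro integrable_mult_right L2_integrable_cball f)
      show "(\<lambda>y. g (x - y) *\<^sub>R f y) \<in> borel_measurable lebesgue"
        by (rule borel_measurable_integrable[OF convolution_integrable[OF f g]])
      show "(\<lambda>y. g (X (n + N) - y) *\<^sub>R f y) \<in> borel_measurable lebesgue" for n
        by (rule borel_measurable_integrable[OF convolution_integrable[OF f g]])
      have "(\<lambda>n. g (X (n + N) - y)) \<longlonglongrightarrow> g (x - y)" for y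
        using Cc_continuous[OF g] LIMSEQ_ignore_initial_segment[OF X, of N]
        by (auto intro!: tendsto_intros isCont_tendsto_compose[of _ g] simp: continuous_on_eq_continuous_at)
      then show "AE y in lebesgue. (\<lambda>n. g (X (n + N) - y) *\<^sub>R f y) \<longlonglongrightarrow> g (x - y) *\<^sub>R f y"
        by (intro AE_I2 tendsto_intros)
      have "norm (g (X (n + N) - y) *\<^sub>R f y) \<le> K * (indicator (cball x (R + 1)) y * norm (f y))" for n y
      proof (cases "norm (X (n + N) - y) \<le> R")
        case True
        have "dist x y \<le> dist (X (n + N)) x + norm (X (n + N) - y)"
          by (metis dist_commute dist_norm dist_triangle)
        then have "y \<in> cball x (R + 1)" using N[of "n + N"] True by auto
        then show ?thesis using RK(3) by (simp add: mult_right_mono)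
      qed (use RK in auto)
      then show "AE y in lebesgue. norm (g (X (n + N) - y) *\<^sub>R f y)
          \<le> K * (indicator (cball x (R + 1)) y * norm (f y))" for n by simp
    qed
    then show ?thesis by (rule LIMSEQ_offset)
  qed
  then show ?thesis by (auto simp: continuous_on_sequentially o_def)
qed

text \<open>Cauchy-Schwarz with weight |g| bounds the squared convolution pointwise by the mass of
  |g| times the convolution of |g| with |f|^2, and Tonelli's theorem integrates this over
  \<open>x\<close>. In extended nonnegative integrals the finiteness comes out as part of the
  result.\<close>

lemma convolution_Young:
  assumes f: "f \<in> L2" and g: "g \<in> Cc"
  shows "convolution f g \<in> L2"
    and "L2_norm (convolution f g) \<le> (LINT y|lebesgue. \<bar>g y\<bar>) * L2_norm f"
proof -
  interpret leb: pair_sigma_finite "lebesgue :: 'a measure" "lebesgue :: 'a measure"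
    by (simp add: pair_sigma_finite_def sigma_finite_lebesgue)
  note fm [measurable] = L2_measurable[OF f]
  have gm [measurable]: "g \<in> borel_measurable borel" by (rule Cc_borel[OF g])
  define A where "A = (LINT y|lebesgue. \<bar>g y\<bar>)"
  have A0: "0 \<le> A" by (simp add: A_def)
  have A: "(\<integral>\<^sup>+y. ennreal \<bar>g y\<bar> \<partial>lebesgue) = A"
    using Cc_integrable[OF Cc_abs[OF g]] by (simp add: nn_integral_eq_integral A_def)
  have Ax: "(\<integral>\<^sup>+y. ennreal \<bar>g (x - y)\<bar> \<partial>lebesgue) = A" for x
    using Cc_integrable[OF Cc_abs[OF Cc_reflect[OF g]]] lebesgue_integral_reflect_borel[of "\<lambda>y. \<bar>g y\<bar>" x]
    by (simp add: nn_integral_eq_integral A_def)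
  have m [measurable]: "(\<lambda>x. convolution f g x) \<in> borel_measurable borel"
    by (rule borel_measurable_continuous_onI[OF continuous_convolution[OF f g]])
  have [measurable]: "(\<lambda>x. x) \<in> (lebesgue :: 'a measure) \<rightarrow>\<^sub>M borel" by (simp add: measurable_completion)
  have pw: "ennreal ((norm (convolution f g x))\<^sup>2) \<le> A * (\<integral>\<^sup>+y. ennreal (\<bar>g (x - y)\<bar> * (norm (f y))\<^sup>2) \<partial>lebesgue)"
    for x
  proof -
    have "ennreal ((norm (convolution f g x))\<^sup>2) = (ennreal (norm (convolution f g x)))\<^sup>2"
      by (simp add: ennreal_power)
    also have "\<dots> \<le> (\<integral>\<^sup>+y. ennreal (norm (g (x - y) *\<^sub>R f y)) \<partial>lebesgue)\<^sup>2"
      unfolding convolution_def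
      by (intro power_mono integral_norm_bound_ennreal convolution_integrable f g) auto
    \<comment> \<open>Splitting |g| |f| into sqrt|g| and sqrt|g| |f| leaves one factor |g| in each
      square, so the first integral becomes the mass of |g|.\<close>
    also have "\<dots> = (\<integral>\<^sup>+y. ennreal (sqrt \<bar>g (x - y)\<bar>) * ennreal (sqrt \<bar>g (x - y)\<bar> * norm (f y)) \<partial>lebesgue)\<^sup>2"
      by (intro arg_cong[where f="\<lambda>x. x\<^sup>2"] nn_integral_cong)
         (simp flip: ennreal_mult mult.assoc)
    also have "\<dots> \<le> (\<integral>\<^sup>+y. (ennreal (sqrt \<bar>g (x - y)\<bar>))\<^sup>2 \<partial>lebesgue) *
        (\<integral>\<^sup>+y. (ennreal (sqrt \<bar>g (x - y)\<bar> * norm (f y)))\<^sup>2 \<partial>lebesgue)"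
      by (rule Cauchy_Schwarz_nn_integral) auto
    also have "\<dots> = A * (\<integral>\<^sup>+y. ennreal (\<bar>g (x - y)\<bar> * (norm (f y))\<^sup>2) \<partial>lebesgue)"
      by (simp add: ennreal_power power_mult_distrib Ax)
    finally show ?thesis .
  qed
  have "(\<integral>\<^sup>+x. ennreal ((norm (convolution f g x))\<^sup>2) \<partial>lebesgue)
      \<le> (\<integral>\<^sup>+x. A * (\<integral>\<^sup>+y. ennreal (\<bar>g (x - y)\<bar> * (norm (f y))\<^sup>2) \<partial>lebesgue) \<partial>lebesgue)"
    by (intro nn_integral_mono pw)
  also have "\<dots> = A * (\<integral>\<^sup>+x. (\<integral>\<^sup>+y. ennreal (\<bar>g (x - y)\<bar> * (norm (f y))\<^sup>2) \<partial>lebesgue) \<partial>lebesgue)"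
    by (rule nn_integral_cmult) measurable
  also have "\<dots> = A * (\<integral>\<^sup>+y. (\<integral>\<^sup>+x. ennreal (\<bar>g (x - y)\<bar> * (norm (f y))\<^sup>2) \<partial>lebesgue) \<partial>lebesgue)"
    by (subst leb.Fubini') auto
  also have "\<dots> = A * (\<integral>\<^sup>+y. A * ennreal ((norm (f y))\<^sup>2) \<partial>lebesgue)"
  proof -
    have "(\<integral>\<^sup>+x. ennreal (\<bar>g (x - y)\<bar> * (norm (f y))\<^sup>2) \<partial>lebesgue) = A * ennreal ((norm (f y))\<^sup>2)" for y
      using nn_integral_lebesgue_translate_borel[of "\<lambda>x. ennreal \<bar>g x\<bar>" y]
      by (simp add: ennreal_mult nn_integral_multc A)
    then show ?thesis by simp
  qed
  also have "\<dots> = ennreal (A\<^sup>2 * (L2_norm f)\<^sup>2)"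
    using L2_integrable[OF f] A0
    by (simp add: nn_integral_cmult nn_integral_eq_integral L2_norm_power2 power2_eq_square[of A] mult.assoc
        flip: ennreal_mult)
  finally have le: "(\<integral>\<^sup>+x. ennreal ((norm (convolution f g x))\<^sup>2) \<partial>lebesgue) \<le> ennreal (A\<^sup>2 * (L2_norm f)\<^sup>2)" .
  have int: "integrable lebesgue (\<lambda>x. (norm (convolution f g x))\<^sup>2)"
    using le by (intro integrableI_nonneg) (auto simp: borel_imp_lebesgue intro: le_less_trans)
  then show "convolution f g \<in> L2" using m by (simp add: L2_def borel_imp_lebesgue)
  have "(L2_norm (convolution f g))\<^sup>2 \<le> (A * L2_norm f)\<^sup>2"
    using le int by (simp add: L2_norm_power2 nn_integral_eq_integral power_mult_distrib)
  then show "L2_norm (convolution f g) \<le> A * L2_norm f"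
    by (rule power2_le_imp_le) (simp add: A0 L2_norm_nonneg)
qed

section \<open>Continuous curves with values in L^2\<close>

lemma CL2_imp_L2: "v \<in> CL2 T \<Longrightarrow> t \<in> {0..T} \<Longrightarrow> v t \<in> L2"
  by (simp add: CL2_def)

lemma CL2_sequentially:
  assumes v: "v \<in> CL2 T" and "t \<in> {0..T}" "\<And>n. X n \<in> {0..T}" "X \<longlonglongrightarrow> t"
  shows "(\<lambda>n. L2_norm (\<lambda>x. v (X n) x - v t x)) \<longlonglongrightarrow> 0"
proof -
  have "continuous (at t within {0..T}) (\<lambda>s. L2_norm (\<lambda>x. v s x - v t x))"
    using v assms(2) by (simp add: continuous_within CL2_def L2_norm_def)
  then have "(\<lambda>n. L2_norm (\<lambda>x. v (X n) x - v t x)) \<longlonglongrightarrow> L2_norm (\<lambda>x. v t x - v t x)"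
    by (rule continuous_within_tendsto_compose') (use assms in auto)
  then show ?thesis by (simp add: L2_norm_def)
qed

lemma CL2_continuous_norm:
  assumes v: "v \<in> CL2 T"
  shows "continuous_on {0..T} (\<lambda>t. L2_norm (v t))"
proof (unfold continuous_on_def, intro ballI)
  fix t assume "t \<in> {0..T}"
  then show "((\<lambda>t. L2_norm (v t)) \<longlongrightarrow> L2_norm (v t)) (at t within {0..T})"
    using v by (intro L2_norm_tendsto) (auto simp: CL2_def eventually_at_filter)
qed

lemma CL2_diff:
  assumes v: "v \<in> CL2 T" and w: "w \<in> CL2 T"
  shows "(\<lambda>t x. v t x - w t x) \<in> CL2 T"
  unfolding CL2_def
proof (intro CollectI conjI ballI)
  fix t assume t: "t \<in> {0..T}"
  then show "(\<lambda>x. v t x - w t x) \<in> L2" using v w by (intro L2_diff) (auto simp: CL2_def)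
  have "((\<lambda>s. L2_norm (\<lambda>x. v s x - v t x) + L2_norm (\<lambda>x. w t x - w s x)) \<longlongrightarrow> 0 + 0) (at t within {0..T})"
    using v w t by (intro tendsto_add) (auto simp: CL2_def L2_norm_minus_commute[of "w t"])
  then have lim: "((\<lambda>s. L2_norm (\<lambda>x. v s x - v t x) + L2_norm (\<lambda>x. w t x - w s x)) \<longlongrightarrow> 0)
      (at t within {0..T})" by simp
  have "\<forall>\<^sub>F s in at t within {0..T}. norm (L2_norm (\<lambda>x. v s x - w s x - (v t x - w t x)))
      \<le> L2_norm (\<lambda>x. v s x - v t x) + L2_norm (\<lambda>x. w t x - w s x)"
    unfolding eventually_at_filter
  proof (intro always_eventually allI impI)
    fix s assume s: "s \<in> {0..T}"
    have "L2_norm (\<lambda>x. (v s x - v t x) + (w t x - w s x))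
        \<le> L2_norm (\<lambda>x. v s x - v t x) + L2_norm (\<lambda>x. w t x - w s x)"
      using v w s t by (intro L2_norm_triangle L2_diff) (auto simp: CL2_def)
    then show "norm (L2_norm (\<lambda>x. v s x - w s x - (v t x - w t x)))
        \<le> L2_norm (\<lambda>x. v s x - v t x) + L2_norm (\<lambda>x. w t x - w s x)"
      by (simp add: L2_norm_nonneg algebra_simps)
  qed
  then show "((\<lambda>s. L2_norm (\<lambda>x. v s x - w s x - (v t x - w t x))) \<longlongrightarrow> 0) (at t within {0..T})"
    by (rule Lim_null_comparison[OF _ lim])
qed

lemma CL2_mult_bounded:
  assumes v: "v \<in> CL2 T" and m: "m \<in> borel_measurable lebesgue"
    and M: "AE x in lebesgue. \<bar>m x\<bar> \<le> M" "0 \<le> M"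
  shows "(\<lambda>t x. m x *\<^sub>R v t x) \<in> CL2 T"
  unfolding CL2_def
proof (intro CollectI conjI ballI)
  fix t assume t: "t \<in> {0..T}"
  show "(\<lambda>x. m x *\<^sub>R v t x) \<in> L2" using v t by (intro L2_mult_bounded[OF _ m M]) (auto simp: CL2_def)
  have "((\<lambda>s. M * L2_norm (\<lambda>x. v s x - v t x)) \<longlongrightarrow> M * 0) (at t within {0..T})"
    using v t by (intro tendsto_mult_left) (auto simp: CL2_def)
  then have lim: "((\<lambda>s. M * L2_norm (\<lambda>x. v s x - v t x)) \<longlongrightarrow> 0) (at t within {0..T})" by simp
  have "\<forall>\<^sub>F s in at t within {0..T}.
      norm (L2_norm (\<lambda>x. m x *\<^sub>R v s x - m x *\<^sub>R v t x)) \<le> M * L2_norm (\<lambda>x. v s x - v t x)"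
    unfolding eventually_at_filter
  proof (intro always_eventually allI impI)
    fix s assume s: "s \<in> {0..T}"
    show "norm (L2_norm (\<lambda>x. m x *\<^sub>R v s x - m x *\<^sub>R v t x)) \<le> M * L2_norm (\<lambda>x. v s x - v t x)"
      using L2_mult_bounded(2)[OF L2_diff m M, of "v s" "v t"] v s t
      by (simp add: CL2_def scaleR_diff_right L2_norm_nonneg)
  qed
  then show "((\<lambda>s. L2_norm (\<lambda>x. m x *\<^sub>R v s x - m x *\<^sub>R v t x)) \<longlongrightarrow> 0) (at t within {0..T})"
    by (rule Lim_null_comparison[OF _ lim])
qed

text \<open>The increment splits into a change of time at the moving point, controlled uniformly in
  that point by \<open>norm_convolution_le\<close>, and a change of point at the fixed time. The
  result supplies the joint measurability that \<open>v\<close> itself may lack.\<close>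

lemma continuous_on_convolution_CL2:
  assumes v: "v \<in> CL2 T" and g: "g \<in> Cc"
  shows "continuous_on ({0..T} \<times> UNIV) (\<lambda>(t, x). convolution (v t) g x)"
proof -
  define C where "C = sqrt (LINT y|lebesgue. (g y)\<^sup>2)"
  have L2: "t \<in> {0..T} \<Longrightarrow> v t \<in> L2" for t using v by (rule CL2_imp_L2)
  have "(\<lambda>n. convolution (v (s n)) g (y n)) \<longlonglongrightarrow> convolution (v t) g x"
    if t: "t \<in> {0..T}" "\<And>n. s n \<in> {0..T}" "s \<longlonglongrightarrow> t" "y \<longlonglongrightarrow> x" for t x s y
  proof -
    have 1: "(\<lambda>n. convolution (v t) g (y n)) \<longlonglongrightarrow> convolution (v t) g x"
      using continuous_convolution[OF L2[OF t(1)] g] t(4)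
      by (auto intro: isCont_tendsto_compose simp: continuous_on_eq_continuous_at)
    have "(\<lambda>n. C * L2_norm (\<lambda>x. v (s n) x - v t x)) \<longlonglongrightarrow> C * 0"
      by (intro tendsto_mult_left CL2_sequentially[OF v] t)
    then have lim: "(\<lambda>n. C * L2_norm (\<lambda>x. v (s n) x - v t x)) \<longlonglongrightarrow> 0" by simp
    have 2: "(\<lambda>n. convolution (v (s n)) g (y n) - convolution (v t) g (y n)) \<longlonglongrightarrow> 0"
    proof (rule Lim_null_comparison[OF _ lim], intro always_eventually allI)
      fix n
      show "norm (convolution (v (s n)) g (y n) - convolution (v t) g (y n))
          \<le> C * L2_norm (\<lambda>x. v (s n) x - v t x)"
        using norm_convolution_le[OF L2_diff[OF L2[OF t(2)] L2[OF t(1)]] g, of n "y n"]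
          convolution_diff_left[OF L2[OF t(2)] L2[OF t(1)] g, of n "y n"] by (simp add: C_def)
    qed
    show ?thesis using tendsto_add[OF 2 1] by simp
  qed
  note seq = this
  have "(\<lambda>n. convolution (v (fst (p n))) g (snd (p n))) \<longlonglongrightarrow> convolution (v (fst z)) g (snd z)"
    if "z \<in> {0..T} \<times> UNIV" "\<And>n. p n \<in> {0..T} \<times> UNIV" "p \<longlonglongrightarrow> z" for p z
    by (rule seq) (use that in \<open>auto simp: mem_Times_iff intro: tendsto_fst tendsto_snd\<close>)
  then show ?thesis
    unfolding continuous_on_sequentially o_def split_beta by blast
qed

section \<open>Density and mollification\<close>
lemma L2_norm_mono:
  assumes f [measurable]: "f \<in> borel_measurable lebesgue" and g: "g \<in> L2"
    and le: "AE x in lebesgue. norm (f x) \<le> norm (g x)"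
  shows "f \<in> L2" and "L2_norm f \<le> L2_norm g"
proof -
  have le2: "AE x in lebesgue. (norm (f x))\<^sup>2 \<le> (norm (g x))\<^sup>2"
    using le by eventually_elim (simp add: power_mono)
  have int: "integrable lebesgue (\<lambda>x. (norm (f x))\<^sup>2)"
    by (rule Bochner_Integration.integrable_bound[OF L2_integrable[OF g]]) (use le2 in auto)
  then show "f \<in> L2" by (simp add: L2_def)
  show "L2_norm f \<le> L2_norm g"
    unfolding L2_norm_def using int L2_integrable[OF g] le2
    by (intro real_sqrt_le_mono integral_mono_AE) auto
qed

text \<open>For positive \<open>K\<close>, the nearest-point projection of the plane onto the closed
  disc of radius \<open>K\<close>. It imposes the bound of a limit function on its approximants
  without moving the limit.\<close>

definition radial_clamp :: "real \<Rightarrow> complex \<Rightarrow> complex" where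
  "radial_clamp K z = (K / max K (norm z)) *\<^sub>R z"

lemma radial_clamp_id: "0 < K \<Longrightarrow> norm z \<le> K \<Longrightarrow> radial_clamp K z = z"
  by (simp add: radial_clamp_def max_def)

lemma norm_radial_clamp: "0 < K \<Longrightarrow> norm (radial_clamp K z) \<le> K"
  by (auto simp: radial_clamp_def max_def field_simps)

lemma continuous_radial_clamp: "0 < K \<Longrightarrow> continuous_on UNIV (radial_clamp K)"
  unfolding radial_clamp_def by (intro continuous_intros) (auto simp: max_def)

text \<open>Lebesgue measurability, in the form \<open>measurable_on\<close>, supplies continuous
  functions converging to \<open>f\<close> almost everywhere. Clamping and cutting them off gives a
  common bound and a common ball as support, so dominated convergence upgrades the limit to
  \<open>L\<^sup>2\<close>.\<close>

lemma bounded_support_approx_Cc: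
  fixes f :: "'a::euclidean_space \<Rightarrow> complex"
  assumes f [measurable]: "f \<in> borel_measurable lebesgue" and K: "0 < K"
    and bd: "\<And>x. norm (f x) \<le> K" "\<And>x. K < norm x \<Longrightarrow> f x = 0" and e: "0 < e"
  shows "\<exists>g\<in>Cc. L2_norm (\<lambda>x. g x - f x) < e"
proof -
  have "f measurable_on UNIV"
    using f by (simp add: measurable_on_iff_borel_measurable lebesgue_on_UNIV_eq)
  then obtain N g where N: "negligible N" and g: "\<And>n. continuous_on UNIV (g n)"
      "\<And>x. x \<notin> N \<Longrightarrow> (\<lambda>n. g n x) \<longlonglongrightarrow> f x"
    unfolding measurable_on_def by auto
  \<comment> \<open>A continuous cut-off: 1 on the ball of radius \<open>K\<close>, 0 beyond
    \<open>K + 1\<close>. The constant \<open>K\<close> serves both as height and as radius of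
    \<open>f\<close>.\<close>
  define cut :: "'a \<Rightarrow> real" where "cut x = max 0 (min 1 (K + 1 - norm x))" for x
  define h where "h n x = cut x *\<^sub>R radial_clamp K (g n x)" for n x
  have cut_cont: "continuous_on UNIV cut" unfolding cut_def by (intro continuous_intros)
  have cut_bound: "0 \<le> cut x" "cut x \<le> 1" for x by (auto simp: cut_def)
  have h_cont: "continuous_on UNIV (h n)" for n
    unfolding h_def using continuous_on_compose2[OF continuous_radial_clamp[OF K] g(1)]
    by (intro continuous_intros cut_cont) auto
  have h0: "h n x = 0" if "K + 1 < norm x" for n x
    using that by (simp add: h_def cut_def)
  have hCc: "h n \<in> Cc" for n using h_cont h0 by (rule CcI)
  have h_bound: "norm (h n x) \<le> K" for n x
  proof -
    have "norm (h n x) \<le> 1 * K"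
      unfolding h_def norm_scaleR using cut_bound[of x] norm_radial_clamp[OF K] by (intro mult_mono) auto
    then show ?thesis by simp
  qed
  have lim: "(\<lambda>n. h n x) \<longlonglongrightarrow> f x" if "x \<notin> N" for x
  proof -
    have "(\<lambda>n. h n x) \<longlonglongrightarrow> cut x *\<^sub>R radial_clamp K (f x)"
      unfolding h_def using g(2)[OF that] continuous_radial_clamp[OF K]
      by (intro tendsto_intros isCont_tendsto_compose[of _ "radial_clamp K"])
         (auto simp: continuous_on_eq_continuous_at)
    also have "cut x *\<^sub>R radial_clamp K (f x) = f x"
    proof (cases "norm x \<le> K")
      case True
      then show ?thesis using radial_clamp_id[OF K bd(1)] by (simp add: cut_def)
    next
      case False
      then show ?thesis using bd(2) by (simp add: radial_clamp_def)
    qed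
    finally show ?thesis .
  qed
  have "(\<lambda>n. L2_norm (\<lambda>x. h n x - f x)) \<longlonglongrightarrow> 0"
  proof (rule L2_norm_dominated_convergence[OF _ f])
    show "integrable lebesgue (\<lambda>x. (2 * K)\<^sup>2 * indicator (cball (0::'a) (K + 1)) x :: real)"
      by (intro integrable_mult_right integrable_indicator_cball)
    show "h n \<in> borel_measurable lebesgue" for n
      by (intro borel_imp_lebesgue Cc_borel hCc)
    have "(norm (h n x - f x))\<^sup>2 \<le> (2 * K)\<^sup>2 * indicator (cball 0 (K + 1)) x" for n x
    proof (cases "norm x \<le> K + 1")
      case True
      have "norm (h n x - f x) \<le> 2 * K"
        using norm_triangle_ineq4[of "h n x" "f x"] h_bound[of n x] bd(1)[of x] by linarith
      then have "(norm (h n x - f x))\<^sup>2 \<le> (2 * K)\<^sup>2" by (intro power_mono) auto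
      then show ?thesis using True by (simp add: indicator_def)
    next
      case False
      then show ?thesis using h0[of x n] bd(2)[of x] by simp
    qed
    then show "AE x in lebesgue. (norm (h n x - f x))\<^sup>2 \<le> (2 * K)\<^sup>2 * indicator (cball 0 (K + 1)) x" for n
      by simp
    show "AE x in lebesgue. (\<lambda>n. h n x) \<longlonglongrightarrow> f x"
      by (rule AE_I'[of N]) (use N lim in \<open>auto simp: negligible_iff_null_sets\<close>)
  qed
  then obtain n where "L2_norm (\<lambda>x. h n x - f x) < e"
    using order_tendstoD(2)[OF _ e] eventually_happens'[OF sequentially_bot] by blast
  then show ?thesis using hCc by blast
qed

text \<open>Truncations of \<open>f\<close> at height \<open>n\<close> and radius \<open>n\<close>
  converge to \<open>f\<close> in \<open>L\<^sup>2\<close>, dominated by |f|^2; this reduces the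
  claim to bounded functions of bounded support.\<close>

lemma L2_approx_Cc:
  fixes f :: "'a::euclidean_space \<Rightarrow> complex"
  assumes f: "f \<in> L2" and e: "0 < e"
  obtains g where "g \<in> Cc" "L2_norm (\<lambda>x. g x - f x) < e"
proof -
  note fm [measurable] = L2_measurable[OF f]
  define F where "F n x = (if norm x \<le> real n \<and> norm (f x) \<le> real n then f x else 0)" for n x
  have Fm: "F n \<in> borel_measurable lebesgue" for n
  proof -
    have [measurable]: "(\<lambda>x. x) \<in> (lebesgue :: 'a measure) \<rightarrow>\<^sub>M borel" by (simp add: measurable_completion)
    show ?thesis unfolding F_def by measurable
  qed
  have "(\<lambda>n. L2_norm (\<lambda>x. F n x - f x)) \<longlonglongrightarrow> 0"
  proof (rule L2_norm_dominated_convergence[OF Fm fm L2_integrable[OF f]])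
    show "AE x in lebesgue. (norm (F n x - f x))\<^sup>2 \<le> (norm (f x))\<^sup>2" for n
      by (intro AE_I2) (auto simp: F_def)
    have "(\<lambda>n. F n x) \<longlonglongrightarrow> f x" for x
    proof (rule tendsto_eventually)
      show "\<forall>\<^sub>F n in sequentially. F n x = f x"
        using eventually_ge_at_top[of "nat \<lceil>max (norm x) (norm (f x))\<rceil>"]
        by eventually_elim (auto simp: F_def nat_le_iff ceiling_le_iff)
    qed
    then show "AE x in lebesgue. (\<lambda>n. F n x) \<longlonglongrightarrow> f x" by simp
  qed
  then have "\<forall>\<^sub>F n in sequentially. L2_norm (\<lambda>x. F n x - f x) < e / 2"
    by (rule order_tendstoD(2)) (use e in simp)
  \<comment> \<open>The truncation level becomes the constant \<open>K\<close> of
    \<open>bounded_support_approx_Cc\<close>, which must be positive; hence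
    \<open>n \<ge> 1\<close>.\<close>
  then have "\<forall>\<^sub>F n in sequentially. L2_norm (\<lambda>x. F n x - f x) < e / 2 \<and> n \<ge> 1"
    using eventually_ge_at_top[of 1] by eventually_elim simp
  then obtain n where n: "L2_norm (\<lambda>x. F n x - f x) < e / 2" "n \<ge> 1"
    using eventually_happens'[OF sequentially_bot] by blast
  have "norm (F n x) \<le> real n" "real n < norm x \<Longrightarrow> F n x = 0" for x by (simp_all add: F_def)
  then obtain g where g: "g \<in> Cc" "L2_norm (\<lambda>x. g x - F n x) < e / 2"
    using bounded_support_approx_Cc[OF Fm[of n], of "real n" "e / 2"] n(2) e by auto
  have "F n \<in> L2" by (rule L2_norm_mono(1)[OF Fm f]) (auto simp: F_def)
  then have "L2_norm (\<lambda>x. g x - f x) < e"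
    using L2_norm_triangle_via[OF Cc_imp_L2[OF g(1)] _ f, of "F n"] n g by linarith
  then show ?thesis using g(1) that by blast
qed

text \<open>The kernel of \<open>mollifier_net\<close> with its width as a free argument, so that
  convergence can be stated for any null sequence of widths.\<close>

definition dilate :: "('a::euclidean_space \<Rightarrow> real) \<Rightarrow> real \<Rightarrow> 'a \<Rightarrow> real" where
  "dilate \<psi> c x = \<psi> (x /\<^sub>R c) / c ^ DIM('a)"

lemma mollifier_net_eq_dilate: "mollifier_net \<psi> \<omega> \<epsilon> = dilate \<psi> (\<omega> \<epsilon>)"
  by (simp add: fun_eq_iff mollifier_net_def dilate_def)

lemma dilate_Cc:
  assumes "\<psi> \<in> Cc" "0 < c" shows "dilate \<psi> c \<in> Cc"
  using Cc_scaleR[OF Cc_affine[OF assms(1), of "inverse c" 0], of "inverse (c ^ DIM('a))"] assms(2)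
  by (simp add: dilate_def[abs_def] divide_inverse mult.commute)

text \<open>The substitution \<open>y = x - c z\<close> moves the scale from the kernel into
  \<open>f\<close>, so that limits in \<open>c\<close> can be taken under the integral against a
  fixed kernel.\<close>

lemma convolution_dilate:
  fixes f :: "'a::euclidean_space \<Rightarrow> 'b::{banach, second_countable_topology}"
  assumes \<psi>: "\<psi> \<in> Cc" and f: "f \<in> borel_measurable borel" and c: "0 < c"
  shows "convolution f (dilate \<psi> c) x = (LINT z|lebesgue. \<psi> z *\<^sub>R f (x - c *\<^sub>R z))"
proof -
  note [measurable] = f Cc_borel[OF \<psi>] Cc_borel[OF dilate_Cc[OF \<psi> c]]
  have "convolution f (dilate \<psi> c) x
      = c ^ DIM('a) *\<^sub>R (LINT z|lebesgue. dilate \<psi> c (x - (x + (- c) *\<^sub>R z)) *\<^sub>R f (x + (- c) *\<^sub>R z))"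
    unfolding convolution_def
    by (subst lebesgue_integral_affine_borel[of _ "- c" x]) (use c in auto)
  also have "\<dots> = (LINT z|lebesgue. c ^ DIM('a) *\<^sub>R (dilate \<psi> c (x - (x + (- c) *\<^sub>R z)) *\<^sub>R f (x + (- c) *\<^sub>R z)))"
    by (rule integral_scaleR_right[symmetric])
  also have "\<dots> = (LINT z|lebesgue. \<psi> z *\<^sub>R f (x - c *\<^sub>R z))"
    using c by (simp add: dilate_def)
  finally show ?thesis .
qed

locale nonneg_mollifier =
  fixes \<psi> :: "'a::euclidean_space \<Rightarrow> real"
  assumes Cc: "\<psi> \<in> Cc" and nonneg: "0 \<le> \<psi> x" and integral_1: "(LINT x|lebesgue. \<psi> x) = 1"
begin

lemma dilate_nonneg: "0 < c \<Longrightarrow> 0 \<le> dilate \<psi> c x"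
  by (simp add: dilate_def nonneg)

lemma integral_dilate: "0 < c \<Longrightarrow> (LINT y|lebesgue. dilate \<psi> c (x - y)) = 1"
  using convolution_dilate[OF Cc, of "\<lambda>_. 1::real" c x] integral_1 by (simp add: convolution_def)

text \<open>A nonnegative kernel of mass 1 has constant 1 in Young's inequality, whatever its
  width.\<close>

lemma L2_norm_mollify_le:
  assumes "f \<in> L2" "0 < c"
  shows "L2_norm (convolution f (dilate \<psi> c)) \<le> L2_norm f"
  using convolution_Young(2)[OF assms(1) dilate_Cc[OF Cc assms(2)]] integral_dilate[OF assms(2), of 0]
    lebesgue_integral_reflect_borel[OF Cc_borel[OF dilate_Cc[OF Cc assms(2)]], of 0]
  by (simp add: dilate_nonneg assms(2))

text \<open>The widths are bounded by some \<open>B\<close>, so every mollification of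
  \<open>g\<close> is bounded by \<open>K\<close> and vanishes outside the ball of radius
  \<open>R + B * S\<close>. Dominated convergence applies twice: in the kernel variable, where
  continuity of \<open>g\<close> gives the pointwise limit, and then in \<open>x\<close>.\<close>

lemma mollify_Cc_tendsto:
  assumes g: "g \<in> Cc" and c: "\<And>n. 0 < c n" "c \<longlonglongrightarrow> 0"
  shows "(\<lambda>n. L2_norm (\<lambda>x. convolution g (dilate \<psi> (c n)) x - g x)) \<longlonglongrightarrow> 0"
proof -
  note [measurable] = Cc_borel[OF g] Cc_borel[OF Cc]
  have gL2: "g \<in> L2" by (rule Cc_imp_L2[OF g])
  obtain R K where g_bd: "0 < R" "0 < K" "\<And>x. norm (g x) \<le> K" "\<And>x. R < norm x \<Longrightarrow> g x = 0"
    using Cc_bounds[OF g] by blast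
  obtain S L where \<psi>_bd: "0 < S" "0 < L" "\<And>x. norm (\<psi> x) \<le> L" "\<And>x. S < norm x \<Longrightarrow> \<psi> x = 0"
    using Cc_bounds[OF Cc] by blast
  obtain B where B: "0 < B" "\<And>n. norm (c n) \<le> B"
    using convergent_imp_Bseq[of c] c(2) unfolding convergent_def Bseq_def by blast
  have conv: "convolution g (dilate \<psi> (c n)) x = (LINT z|lebesgue. \<psi> z *\<^sub>R g (x - c n *\<^sub>R z))" for n x
    by (rule convolution_dilate) (use c Cc in auto)
  have int: "integrable lebesgue (\<lambda>z. \<psi> z * K)"
    by (intro integrable_mult_left Cc_integrable Cc)
  have ptw: "norm (\<psi> z *\<^sub>R g (x - c n *\<^sub>R z)) \<le> \<psi> z * K" for n x z
    using g_bd(3) nonneg by (simp add: mult_left_mono)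
  have bound: "norm (convolution g (dilate \<psi> (c n)) x) \<le> K" for n x
  proof -
    have "norm (convolution g (dilate \<psi> (c n)) x) \<le> (LINT z|lebesgue. \<psi> z * K)"
      unfolding conv
    proof (rule Bochner_Integration.integral_norm_bound_integral[OF _ int ptw])
      have "norm (\<psi> z *\<^sub>R g (x - c n *\<^sub>R z)) \<le> norm (\<psi> z * K)" for z
        using order_trans[OF ptw abs_ge_self] by simp
      then show "integrable lebesgue (\<lambda>z. \<psi> z *\<^sub>R g (x - c n *\<^sub>R z))"
        by (intro Bochner_Integration.integrable_bound[OF int] borel_imp_lebesgue AE_I2) auto
    qed
    then show ?thesis by (simp add: integral_1)
  qed
  have zero: "convolution g (dilate \<psi> (c n)) x = 0" if "R + B * S < norm x" for n x
  proof -
    have "\<psi> z *\<^sub>R g (x - c n *\<^sub>R z) = 0" for z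
    proof (cases "norm z \<le> S")
      case True
      have "norm (c n *\<^sub>R z) \<le> B * S" using B(2)[of n] True B(1) by (auto intro: mult_mono)
      then have "R < norm (x - c n *\<^sub>R z)" using that norm_triangle_ineq2[of x "c n *\<^sub>R z"] by linarith
      then show ?thesis using g_bd(4) by simp
    qed (use \<psi>_bd(4) in simp)
    then show ?thesis unfolding conv by (simp only: integral_zero)
  qed
  show ?thesis
  proof (rule L2_norm_dominated_convergence)
    show "convolution g (dilate \<psi> (c n)) \<in> borel_measurable lebesgue" for n
      using convolution_Young(1)[OF gL2 dilate_Cc[OF Cc c(1)]] by (rule L2_measurable)
    show "g \<in> borel_measurable lebesgue" by (rule L2_measurable[OF gL2])
    show "integrable lebesgue (\<lambda>x. (2 * K)\<^sup>2 * indicator (cball (0::'a) (R + B * S)) x :: real)"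
      by (intro integrable_mult_right integrable_indicator_cball)
    have "(norm (convolution g (dilate \<psi> (c n)) x - g x))\<^sup>2
        \<le> (2 * K)\<^sup>2 * indicator (cball 0 (R + B * S)) x" for n x
    proof (cases "norm x \<le> R + B * S")
      case True
      have "norm (convolution g (dilate \<psi> (c n)) x - g x) \<le> 2 * K"
        using norm_triangle_ineq4[of "convolution g (dilate \<psi> (c n)) x" "g x"] bound[of n x] g_bd(3)[of x]
        by linarith
      then have "(norm (convolution g (dilate \<psi> (c n)) x - g x))\<^sup>2 \<le> (2 * K)\<^sup>2" by (intro power_mono) auto
      then show ?thesis using True by (simp add: indicator_def)
    next
      case False
      moreover have "0 < B * S" using B(1) \<psi>_bd(1) by simp
      ultimately have "R < norm x" by linarith
      then show ?thesis using False zero[of x n] g_bd(4)[of x] by simp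
    qed
    then show "AE x in lebesgue. (norm (convolution g (dilate \<psi> (c n)) x - g x))\<^sup>2
        \<le> (2 * K)\<^sup>2 * indicator (cball 0 (R + B * S)) x" for n by simp
    have "(\<lambda>n. convolution g (dilate \<psi> (c n)) x) \<longlonglongrightarrow> g x" for x
    proof -
      have "(\<lambda>n. LINT z|lebesgue. \<psi> z *\<^sub>R g (x - c n *\<^sub>R z)) \<longlonglongrightarrow> (LINT z|lebesgue. \<psi> z *\<^sub>R g x)"
      proof (rule integral_dominated_convergence[OF _ _ int])
        have "(\<lambda>n. g (x - c n *\<^sub>R z)) \<longlonglongrightarrow> g x" for z
        proof -
          have "(\<lambda>n. x - c n *\<^sub>R z) \<longlonglongrightarrow> x - 0 *\<^sub>R z" by (intro tendsto_intros c)
          then show ?thesis using Cc_continuous[OF g]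
            by (intro isCont_tendsto_compose[of _ g]) (auto simp: continuous_on_eq_continuous_at)
        qed
        then show "AE z in lebesgue. (\<lambda>n. \<psi> z *\<^sub>R g (x - c n *\<^sub>R z)) \<longlonglongrightarrow> \<psi> z *\<^sub>R g x"
          by (intro AE_I2 tendsto_intros)
      qed (use ptw in \<open>auto intro!: borel_imp_lebesgue\<close>)
      moreover have "(LINT z|lebesgue. \<psi> z *\<^sub>R g x) = g x"
        using integral_scaleR_left[of "g x" lebesgue \<psi>] Cc_integrable[OF Cc] by (simp add: integral_1)
      ultimately show ?thesis by (simp add: conv)
    qed
    then show "AE x in lebesgue. (\<lambda>n. convolution g (dilate \<psi> (c n)) x) \<longlonglongrightarrow> g x" by simp
  qed
qed

text \<open>Approximation by \<open>g\<close> in \<open>Cc\<close> at distance e/3: since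
  mollification is a contraction, the mollified functions are no farther apart than \<open>f\<close>
  and \<open>g\<close>, uniformly in the width.\<close>

lemma mollify_tendsto:
  assumes f: "f \<in> L2" and c: "\<And>n. 0 < c n" "c \<longlonglongrightarrow> 0"
  shows "(\<lambda>n. L2_norm (\<lambda>x. convolution f (dilate \<psi> (c n)) x - f x)) \<longlonglongrightarrow> 0"
proof (rule LIMSEQ_I)
  fix e :: real assume e: "0 < e"
  obtain g where g: "g \<in> Cc" "L2_norm (\<lambda>x. g x - f x) < e / 3"
    using L2_approx_Cc[OF f, of "e / 3"] e by auto
  have gL2: "g \<in> L2" by (rule Cc_imp_L2[OF g(1)])
  have "\<forall>\<^sub>F n in sequentially. L2_norm (\<lambda>x. convolution g (dilate \<psi> (c n)) x - g x) < e / 3"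
    by (rule order_tendstoD(2)[OF mollify_Cc_tendsto[OF g(1) c]]) (use e in auto)
  then obtain N where N: "\<And>n. n \<ge> N \<Longrightarrow> L2_norm (\<lambda>x. convolution g (dilate \<psi> (c n)) x - g x) < e / 3"
    unfolding eventually_sequentially by blast
  have "norm (L2_norm (\<lambda>x. convolution f (dilate \<psi> (c n)) x - f x) - 0) < e" if n: "n \<ge> N" for n
  proof -
    note D = dilate_Cc[OF Cc c(1)[of n]]
    note L = convolution_Young(1)[OF f D] convolution_Young(1)[OF gL2 D]
    have "L2_norm (\<lambda>x. convolution f (dilate \<psi> (c n)) x - convolution g (dilate \<psi> (c n)) x)
        = L2_norm (convolution (\<lambda>x. f x - g x) (dilate \<psi> (c n)))"
      by (simp add: convolution_diff_left[OF f gL2 D, abs_def])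
    also have "\<dots> \<le> L2_norm (\<lambda>x. f x - g x)"
      by (rule L2_norm_mollify_le[OF L2_diff[OF f gL2] c(1)])
    finally have "L2_norm (\<lambda>x. convolution f (dilate \<psi> (c n)) x - convolution g (dilate \<psi> (c n)) x) < e / 3"
      using g(2) by (simp add: L2_norm_minus_commute[of f g])
    then show ?thesis
      using L2_norm_triangle_via[OF L f] L2_norm_triangle_via[OF L(2) gL2 f] N[OF n] g(2)
        L2_norm_nonneg[of "\<lambda>x. convolution f (dilate \<psi> (c n)) x - f x"] by simp
  qed
  then show "\<exists>no. \<forall>n\<ge>no. norm (L2_norm (\<lambda>x. convolution f (dilate \<psi> (c n)) x - f x) - 0) < e" by blast
qed

text \<open>An average against a probability density. The bound is the essential bound of
  \<open>q\<close> itself, and it holds at every \<open>x\<close> and for every width.\<close>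

lemma abs_mollify_le:
  fixes q :: "'a \<Rightarrow> real"
  assumes [measurable]: "q \<in> borel_measurable lebesgue" and M: "AE x in lebesgue. \<bar>q x\<bar> \<le> M"
    and c: "0 < c"
  shows "\<bar>convolution q (dilate \<psi> c) x\<bar> \<le> M"
proof -
  note [measurable] = borel_imp_lebesgue[OF Cc_borel[OF Cc_reflect[OF dilate_Cc[OF Cc c], of x]]]
  have int: "integrable lebesgue (\<lambda>y. dilate \<psi> c (x - y) * M)"
    by (intro integrable_mult_left Cc_integrable Cc_reflect dilate_Cc Cc c)
  have le: "AE y in lebesgue. norm (dilate \<psi> c (x - y) *\<^sub>R q y) \<le> dilate \<psi> c (x - y) * M"
    using M by eventually_elim (simp add: abs_mult mult_left_mono dilate_nonneg[OF c])
  have "norm (convolution q (dilate \<psi> c) x) \<le> (LINT y|lebesgue. norm (dilate \<psi> c (x - y) *\<^sub>R q y))"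
    unfolding convolution_def by (rule integral_norm_bound)
  also have "\<dots> \<le> (LINT y|lebesgue. dilate \<psi> c (x - y) * M)"
    using le int by (intro integral_mono_AE Bochner_Integration.integrable_bound[OF int]) auto
  finally show ?thesis using integral_dilate[OF c] by simp
qed

text \<open>On the support of \<open>g\<close> the mollification sees \<open>q\<close> only in a fixed ball, where \<open>q\<close> is square integrable.\<close>

lemma mollify_bounded_mult_Cc_tendsto:
  fixes q :: "'a \<Rightarrow> real"
  assumes qm [measurable]: "q \<in> borel_measurable lebesgue" and M: "AE x in lebesgue. \<bar>q x\<bar> \<le> M"
    and qn [measurable]: "\<And>n. convolution q (dilate \<psi> (c n)) \<in> borel_measurable lebesgue"
    and g: "g \<in> Cc" and c: "\<And>n. 0 < c n" "c \<longlonglongrightarrow> 0"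
  shows "(\<lambda>n. L2_norm (\<lambda>x. (convolution q (dilate \<psi> (c n)) x - q x) *\<^sub>R g x)) \<longlonglongrightarrow> 0"
proof -
  obtain R K where g_bd: "0 < R" "0 < K" "\<And>x. norm (g x) \<le> K" "\<And>x. R < norm x \<Longrightarrow> g x = 0"
    using Cc_bounds[OF g] by blast
  obtain S L where \<psi>_bd: "0 < S" "0 < L" "\<And>x. norm (\<psi> x) \<le> L" "\<And>x. S < norm x \<Longrightarrow> \<psi> x = 0"
    using Cc_bounds[OF Cc] by blast
  obtain B where B: "0 < B" "\<And>n. norm (c n) \<le> B"
    using convergent_imp_Bseq[of c] c(2) unfolding convergent_def Bseq_def by blast
  have [measurable]: "(indicator (cball (0::'a) (R + B * S)) :: 'a \<Rightarrow> real) \<in> borel_measurable lebesgue"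
    by (rule borel_measurable_integrable[OF integrable_indicator_cball])
  \<comment> \<open>\<open>q\<close> cut down to the ball that the kernels can reach from the
    support of \<open>g\<close>. Casting it to complex values makes it an element of
    \<open>L2\<close>, so that \<open>mollify_tendsto\<close> applies to it.\<close>
  define p :: "'a \<Rightarrow> complex" where "p x = of_real (indicator (cball 0 (R + B * S)) x * q x)" for x
  have pm [measurable]: "p \<in> borel_measurable lebesgue" unfolding p_def by measurable
  have "integrable lebesgue (\<lambda>x. (norm (p x))\<^sup>2)"
  proof (rule Bochner_Integration.integrable_bound)
    show "integrable lebesgue (\<lambda>x. M\<^sup>2 * indicator (cball (0::'a) (R + B * S)) x :: real)"
      by (intro integrable_mult_right integrable_indicator_cball)
    show "AE x in lebesgue. norm ((norm (p x))\<^sup>2) \<le> norm (M\<^sup>2 * indicator (cball 0 (R + B * S)) x :: real)"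
      using M
    proof eventually_elim
      case (elim x)
      then have "\<bar>q x\<bar>\<^sup>2 \<le> M\<^sup>2" by (intro power_mono) auto
      then show ?case by (auto simp: p_def indicator_def norm_mult)
    qed
  qed simp
  then have p: "p \<in> L2" using pm by (simp add: L2_def)
  have eq: "convolution p (dilate \<psi> (c n)) x = of_real (convolution q (dilate \<psi> (c n)) x)"
    if x: "norm x \<le> R" for x n
  proof -
    have "dilate \<psi> (c n) (x - y) *\<^sub>R p y = of_real (dilate \<psi> (c n) (x - y) *\<^sub>R q y)" for y
    proof (cases "norm y \<le> R + B * S")
      case True
      then show ?thesis by (simp add: p_def scaleR_conv_of_real)
    next
      case False
      \<comment> \<open>Such a \<open>y\<close> is farther from \<open>x\<close> than
        \<open>B * S\<close>, while the kernel of width \<open>c n\<close> vanishes beyond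
        \<open>c n * S\<close>.\<close>
      have "B * S < norm (x - y)" using False x norm_triangle_ineq2[of y x] by (simp add: norm_minus_commute)
      moreover have "c n * S \<le> B * S" using B(2)[of n] \<psi>_bd(1) by (auto intro: mult_right_mono)
      ultimately have "c n * S < norm (x - y)" by linarith
      then have "S < norm (x - y) / c n" using c(1)[of n] by (simp add: pos_less_divide_eq mult.commute)
      then have "S < norm ((x - y) /\<^sub>R c n)" using c(1)[of n] by (simp add: divide_inverse mult.commute)
      then have "dilate \<psi> (c n) (x - y) = 0" using \<psi>_bd(4) by (simp add: dilate_def)
      then show ?thesis by simp
    qed
    then show ?thesis unfolding convolution_def by (simp only: integral_complex_of_real)
  qed
  have "(\<lambda>n. K * L2_norm (\<lambda>x. convolution p (dilate \<psi> (c n)) x - p x)) \<longlonglongrightarrow> K * 0"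
    by (intro tendsto_mult_left mollify_tendsto p c)
  then have lim: "(\<lambda>n. K * L2_norm (\<lambda>x. convolution p (dilate \<psi> (c n)) x - p x)) \<longlonglongrightarrow> 0" by simp
  show ?thesis
  proof (rule Lim_null_comparison[OF _ lim], intro always_eventually allI)
    fix n
    let ?d = "\<lambda>x. convolution p (dilate \<psi> (c n)) x - p x"
    have d: "?d \<in> L2" by (intro L2_diff convolution_Young(1) p dilate_Cc Cc c)
    have Kd: "(\<lambda>x. K *\<^sub>R ?d x) \<in> L2" by (rule L2_scaleR[OF d])
    have "L2_norm (\<lambda>x. (convolution q (dilate \<psi> (c n)) x - q x) *\<^sub>R g x) \<le> L2_norm (\<lambda>x. K *\<^sub>R ?d x)"
    proof (rule L2_norm_mono(2)[OF _ Kd])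
      show "(\<lambda>x. (convolution q (dilate \<psi> (c n)) x - q x) *\<^sub>R g x) \<in> borel_measurable lebesgue"
        using borel_imp_lebesgue[OF Cc_borel[OF g]] by simp
      have "norm ((convolution q (dilate \<psi> (c n)) x - q x) *\<^sub>R g x) \<le> norm (K *\<^sub>R ?d x)" for x
      proof (cases "norm x \<le> R")
        case True
        have "0 < B * S" using B \<psi>_bd by simp
        then have "p x = of_real (q x)" using True by (simp add: p_def indicator_def)
        then have "?d x = of_real (convolution q (dilate \<psi> (c n)) x - q x)" using eq[OF True] by simp
        then have "norm (?d x) = \<bar>convolution q (dilate \<psi> (c n)) x - q x\<bar>" by (metis norm_of_real)
        then show ?thesis using g_bd(2,3) by (simp add: mult.commute mult_right_mono)
      qed (use g_bd in simp)
      then show "AE x in lebesgue. norm ((convolution q (dilate \<psi> (c n)) x - q x) *\<^sub>R g x) \<le> norm (K *\<^sub>R ?d x)"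
        by simp
    qed
    also have "\<dots> \<le> K * L2_norm ?d"
      using L2_mult_bounded(2)[OF d, of "\<lambda>_. K" K] g_bd(2) by simp
    finally show "norm (L2_norm (\<lambda>x. (convolution q (dilate \<psi> (c n)) x - q x) *\<^sub>R g x)) \<le> K * L2_norm ?d"
      by (simp add: L2_norm_nonneg)
  qed
qed

text \<open>Replacing \<open>f\<close> by a nearby \<open>g\<close> in \<open>Cc\<close> costs at
  most \<open>2 * M\<close> times their distance for every \<open>n\<close>, because the mollified
  and the original coefficient share the bound \<open>M\<close>.\<close>

lemma mollify_bounded_mult_tendsto:
  fixes q :: "'a \<Rightarrow> real"
  assumes qm [measurable]: "q \<in> borel_measurable lebesgue" and M: "AE x in lebesgue. \<bar>q x\<bar> \<le> M" "0 \<le> M"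
    and qn [measurable]: "\<And>n. convolution q (dilate \<psi> (c n)) \<in> borel_measurable lebesgue"
    and f: "f \<in> L2" and c: "\<And>n. 0 < c n" "c \<longlonglongrightarrow> 0"
  shows "(\<lambda>n. L2_norm (\<lambda>x. (convolution q (dilate \<psi> (c n)) x - q x) *\<^sub>R f x)) \<longlonglongrightarrow> 0"
proof (rule LIMSEQ_I)
  fix e :: real assume e: "0 < e"
  let ?d = "\<lambda>n x. convolution q (dilate \<psi> (c n)) x - q x"
  have dm: "?d n \<in> borel_measurable lebesgue" for n by measurable
  have d: "AE x in lebesgue. \<bar>?d n x\<bar> \<le> 2 * M" for n
    using M(1)
  proof eventually_elim
    case (elim x)
    then show ?case using abs_mollify_le[OF qm M(1) c(1), of n x] by linarith
  qed
  \<comment> \<open>The summand 1 keeps the denominator positive when \<open>M = 0\<close>.\<close>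
  define e' where "e' = e / (2 * (2 * M + 1))"
  have e': "0 < e'" "2 * M * e' < e / 2"
    using e M(2) by (auto simp: e'_def field_simps add_pos_nonneg)
  obtain g where g: "g \<in> Cc" "L2_norm (\<lambda>x. g x - f x) < e'"
    using L2_approx_Cc[OF f e'(1)] by blast
  have gL2: "g \<in> L2" by (rule Cc_imp_L2[OF g(1)])
  have "\<forall>\<^sub>F n in sequentially. L2_norm (\<lambda>x. ?d n x *\<^sub>R g x) < e / 2"
    by (rule order_tendstoD(2)[OF mollify_bounded_mult_Cc_tendsto[OF qm M(1) qn g(1) c]]) (use e in auto)
  then obtain N where N: "\<And>n. n \<ge> N \<Longrightarrow> L2_norm (\<lambda>x. ?d n x *\<^sub>R g x) < e / 2"
    unfolding eventually_sequentially by blast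
  have "norm (L2_norm (\<lambda>x. ?d n x *\<^sub>R f x) - 0) < e" if n: "n \<ge> N" for n
  proof -
    have M2: "0 \<le> 2 * M" using M(2) by simp
    have "L2_norm (\<lambda>x. ?d n x *\<^sub>R (f x - g x)) \<le> 2 * M * L2_norm (\<lambda>x. f x - g x)"
      by (rule L2_mult_bounded(2)[OF L2_diff[OF f gL2] dm d M2])
    also have "\<dots> \<le> 2 * M * e'"
      using g(2) M(2) by (intro mult_left_mono) (auto simp: L2_norm_minus_commute[of f g])
    finally have "L2_norm (\<lambda>x. ?d n x *\<^sub>R f x - ?d n x *\<^sub>R g x) < e / 2"
      using e'(2) by (simp add: scaleR_diff_right)
    then show ?thesis
      using L2_norm_le_diff[OF L2_mult_bounded(1)[OF f dm d M2] L2_mult_bounded(1)[OF gL2 dm d M2], of n n]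
        N[OF n] L2_norm_nonneg[of "\<lambda>x. ?d n x *\<^sub>R f x"] by simp
  qed
  then show "\<exists>no. \<forall>n\<ge>no. norm (L2_norm (\<lambda>x. ?d n x *\<^sub>R f x) - 0) < e" by blast
qed

end

section \<open>Smooth functions and the Laplacian\<close>
lemma partial_deriv_eq: "(f has_derivative f') (at x) \<Longrightarrow> partial_deriv i f x = f' i"
  by (simp add: partial_deriv_def frechet_derivative_at[symmetric])

lemma has_derivative_frechet_UNIV:
  "f differentiable_on UNIV \<Longrightarrow> (f has_derivative frechet_derivative f (at x)) (at x)"
  by (simp add: differentiable_on_def frechet_derivative_works)

lemma Ck_continuous: "Ck k f \<Longrightarrow> continuous_on UNIV f"
  by (cases k) (auto intro: differentiable_imp_continuous_on)

lemma Ck_SucD: "Ck (Suc k) f \<Longrightarrow> Ck k f"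
proof (induction k arbitrary: f)
  case 0
  then show ?case using Ck_continuous[of "Suc 0" f] by simp
next
  case (Suc k)
  then show ?case by auto
qed

text \<open>The factor \<open>c\<close> is carried along for the sake of the induction: a partial
  derivative of such a function has the same shape, with \<open>c * b\<close> in place of
  \<open>c\<close>.\<close>

lemma Ck_mult_affine:
  fixes f :: "'a::euclidean_space \<Rightarrow> real"
  shows "Ck k f \<Longrightarrow> Ck k (\<lambda>y. c * f (a + b *\<^sub>R y))"
    and "f differentiable_on UNIV \<Longrightarrow>
      partial_deriv i (\<lambda>y. c * f (a + b *\<^sub>R y)) = (\<lambda>y. (c * b) * partial_deriv i f (a + b *\<^sub>R y))"
proof -
  have der: "((\<lambda>y. c * f (a + b *\<^sub>R y)) has_derivative
      (\<lambda>h. c * frechet_derivative f (at (a + b *\<^sub>R y)) (b *\<^sub>R h))) (at y)"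
    if "f differentiable_on UNIV" for f :: "'a \<Rightarrow> real" and y :: 'a and c
    by (rule bounded_linear.has_derivative[OF bounded_linear_mult_right
          has_derivative_compose[OF _ has_derivative_frechet_UNIV[OF that]]])
       (auto intro!: derivative_eq_intros)
  have pd: "partial_deriv i (\<lambda>y. c * f (a + b *\<^sub>R y)) = (\<lambda>y. (c * b) * partial_deriv i f (a + b *\<^sub>R y))"
    if f: "f differentiable_on UNIV" for f :: "'a \<Rightarrow> real" and c i
  proof
    fix y
    have "linear (frechet_derivative f (at (a + b *\<^sub>R y)))"
      by (rule has_derivative_linear[OF has_derivative_frechet_UNIV[OF f]])
    then show "partial_deriv i (\<lambda>y. c * f (a + b *\<^sub>R y)) y = (c * b) * partial_deriv i f (a + b *\<^sub>R y)"
      unfolding partial_deriv_eq[OF der[OF f]] by (simp add: partial_deriv_def linear_cmul)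
  qed
  then show "f differentiable_on UNIV \<Longrightarrow>
      partial_deriv i (\<lambda>y. c * f (a + b *\<^sub>R y)) = (\<lambda>y. (c * b) * partial_deriv i f (a + b *\<^sub>R y))"
    by blast
  show "Ck k f \<Longrightarrow> Ck k (\<lambda>y. c * f (a + b *\<^sub>R y))"
  proof (induction k arbitrary: f c)
    case 0
    then show ?case
      by (auto intro!: continuous_intros continuous_on_compose2[of UNIV f])
  next
    case (Suc k)
    then have f: "f differentiable_on UNIV" by simp
    have "(\<lambda>y. c * f (a + b *\<^sub>R y)) differentiable_on UNIV"
      unfolding differentiable_on_def differentiable_def using der[OF f] by blast
    then show ?case using Suc by (simp add: pd[OF f])
  qed
qed

lemma Ck_diff:
  fixes f g :: "'a::euclidean_space \<Rightarrow> real"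
  shows "Ck k f \<Longrightarrow> Ck k g \<Longrightarrow> Ck k (\<lambda>x. f x - g x)"
proof (induction k arbitrary: f g)
  case 0
  then show ?case by (auto intro: continuous_intros)
next
  case (Suc k)
  then have d: "f differentiable_on UNIV" "g differentiable_on UNIV" by auto
  have "partial_deriv i (\<lambda>x. f x - g x) = (\<lambda>x. partial_deriv i f x - partial_deriv i g x)" for i
    using partial_deriv_eq[OF has_derivative_diff[OF has_derivative_frechet_UNIV[OF d(1)]
      has_derivative_frechet_UNIV[OF d(2)]]]
    by (simp add: fun_eq_iff partial_deriv_def)
  then show ?case using Suc d by (auto intro: differentiable_on_diff)
qed

text \<open>Along a coordinate line the ordinary derivative is the restriction of
  \<open>partial_deriv e f\<close>, so the induction stays among restrictions to that line.\<close>

lemma Ck_line: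
  fixes f :: "'a::euclidean_space \<Rightarrow> real"
  assumes e: "e \<in> Basis"
  shows "Ck k f \<Longrightarrow> Ck k (\<lambda>s::real. f (a + s *\<^sub>R e))"
proof (induction k arbitrary: f)
  case 0
  then show ?case by (auto intro!: continuous_intros continuous_on_compose2[of UNIV f])
next
  case (Suc k)
  then have f: "f differentiable_on UNIV" by simp
  have der: "((\<lambda>s. f (a + s *\<^sub>R e)) has_derivative (\<lambda>h. frechet_derivative f (at (a + s *\<^sub>R e)) (h *\<^sub>R e))) (at s)" for s
    by (rule has_derivative_compose[OF _ has_derivative_frechet_UNIV[OF f]]) (auto intro!: derivative_eq_intros)
  have "partial_deriv 1 (\<lambda>s. f (a + s *\<^sub>R e)) = (\<lambda>s. partial_deriv e f (a + s *\<^sub>R e))"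
    by (rule ext) (simp add: partial_deriv_eq[OF der] partial_deriv_def)
  moreover have "(\<lambda>s. f (a + s *\<^sub>R e)) differentiable_on UNIV"
    unfolding differentiable_on_def differentiable_def using der by blast
  ultimately show ?case using Suc e by simp
qed

lemma partial_deriv_line:
  fixes f :: "'a::euclidean_space \<Rightarrow> real"
  assumes f: "f differentiable_on UNIV"
  shows "((\<lambda>s. f (a + s *\<^sub>R e)) has_real_derivative partial_deriv e f (a + s *\<^sub>R e)) (at s)"
proof -
  have "linear (frechet_derivative f (at (a + s *\<^sub>R e)))"
    by (rule has_derivative_linear[OF has_derivative_frechet_UNIV[OF f]])
  moreover have "((\<lambda>s. f (a + s *\<^sub>R e)) has_derivative (\<lambda>h. frechet_derivative f (at (a + s *\<^sub>R e)) (h *\<^sub>R e))) (at s)"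
    by (rule has_derivative_compose[OF _ has_derivative_frechet_UNIV[OF f]]) (auto intro!: derivative_eq_intros)
  ultimately show ?thesis
    by (simp add: has_field_derivative_def partial_deriv_def linear_cmul mult_commute_abs)
qed

lemma partial_deriv_real: "(f has_real_derivative d) (at x) \<Longrightarrow> partial_deriv 1 f x = d"
  by (simp add: has_field_derivative_def partial_deriv_eq)

lemma Ck_antiderivative:
  fixes f F :: "real \<Rightarrow> real"
  assumes "\<And>x. (F has_real_derivative f x) (at x)" "Ck k f"
  shows "Ck (Suc k) F"
proof -
  have "partial_deriv 1 F = f" using partial_deriv_real[OF assms(1)] by blast
  moreover have "F differentiable_on UNIV"
    unfolding differentiable_on_def real_differentiable_def using assms(1) by blast
  ultimately show ?thesis using assms(2) by simp
qed

lemma smooth_antiderivative: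
  fixes f F :: "real \<Rightarrow> real"
  assumes "\<And>x. (F has_real_derivative f x) (at x)" "smooth f"
  shows "smooth F"
  unfolding smooth_def
proof
  fix k
  show "Ck k F"
    by (rule Ck_SucD[OF Ck_antiderivative[OF assms(1)]]) (use assms(2) in \<open>simp add: smooth_def\<close>)
qed

lemma smooth_Ck: "smooth f \<Longrightarrow> Ck k f"
  by (simp add: smooth_def)

lemma smooth_differentiable: "smooth f \<Longrightarrow> f differentiable_on UNIV"
  using smooth_Ck[of f "Suc 0"] by simp

lemma smooth_continuous: "smooth f \<Longrightarrow> continuous_on UNIV f"
  using smooth_Ck[of f 0] by simp

lemma smooth_partial_deriv:
  assumes "smooth f" "i \<in> Basis" shows "smooth (partial_deriv i f)"
  unfolding smooth_def
proof
  fix k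
  show "Ck k (partial_deriv i f)" using smooth_Ck[OF assms(1), of "Suc k"] assms(2) by simp
qed

lemma smooth_mult_affine: "smooth f \<Longrightarrow> smooth (\<lambda>y. c * f (a + b *\<^sub>R y))"
  unfolding smooth_def by (intro allI Ck_mult_affine(1)) (rule spec)

lemma smooth_diff: "smooth f \<Longrightarrow> smooth g \<Longrightarrow> smooth (\<lambda>x. f x - g x)"
  unfolding smooth_def by (intro allI Ck_diff) (erule spec)+

section \<open>Products of a function of time and a function of space as test functions\<close>

lemma partial_deriv_tensor:
  fixes \<rho> :: "'a::euclidean_space \<Rightarrow> real" and \<eta> :: "real \<Rightarrow> real"
  assumes \<eta>: "\<eta> differentiable_on UNIV" and \<rho>: "\<rho> differentiable_on UNIV"
  shows "(\<lambda>z. \<eta> (fst z) * \<rho> (snd z)) differentiable_on UNIV"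
    and "partial_deriv (1, 0) (\<lambda>z. \<eta> (fst z) * \<rho> (snd z)) = (\<lambda>z. partial_deriv 1 \<eta> (fst z) * \<rho> (snd z))"
    and "partial_deriv (0, i) (\<lambda>z. \<eta> (fst z) * \<rho> (snd z)) = (\<lambda>z. \<eta> (fst z) * partial_deriv i \<rho> (snd z))"
proof -
  have der: "((\<lambda>z. \<eta> (fst z) * \<rho> (snd z)) has_derivative
      (\<lambda>h. \<eta> (fst z) * frechet_derivative \<rho> (at (snd z)) (snd h)
         + frechet_derivative \<eta> (at (fst z)) (fst h) * \<rho> (snd z))) (at z)" for z
    by (rule has_derivative_mult)
       (rule has_derivative_compose[OF _ has_derivative_frechet_UNIV[OF \<eta>]]
             has_derivative_compose[OF _ has_derivative_frechet_UNIV[OF \<rho>]],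
        auto intro!: derivative_eq_intros)+
  have lin: "linear (frechet_derivative \<rho> (at x))" "linear (frechet_derivative \<eta> (at t))" for x t
    by (rule has_derivative_linear[OF has_derivative_frechet_UNIV], fact)+
  show "(\<lambda>z. \<eta> (fst z) * \<rho> (snd z)) differentiable_on UNIV"
    unfolding differentiable_on_def differentiable_def using der by blast
  show "partial_deriv (1, 0) (\<lambda>z. \<eta> (fst z) * \<rho> (snd z)) = (\<lambda>z. partial_deriv 1 \<eta> (fst z) * \<rho> (snd z))"
    by (rule ext) (simp add: partial_deriv_eq[OF der] partial_deriv_def linear_0[OF lin(1)])
  show "partial_deriv (0, i) (\<lambda>z. \<eta> (fst z) * \<rho> (snd z)) = (\<lambda>z. \<eta> (fst z) * partial_deriv i \<rho> (snd z))"
    by (rule ext) (simp add: partial_deriv_eq[OF der] partial_deriv_def linear_0[OF lin(2)])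
qed

lemma Ck_tensor:
  fixes \<rho> :: "'a::euclidean_space \<Rightarrow> real" and \<eta> :: "real \<Rightarrow> real"
  shows "Ck k \<eta> \<Longrightarrow> Ck k \<rho> \<Longrightarrow> Ck k (\<lambda>z. \<eta> (fst z) * \<rho> (snd z))"
proof (induction k arbitrary: \<eta> \<rho>)
  case 0
  then show ?case
    by (auto intro!: continuous_intros continuous_on_compose2[of UNIV \<eta>] continuous_on_compose2[of UNIV \<rho>])
next
  case (Suc k)
  then have d: "\<eta> differentiable_on UNIV" "\<rho> differentiable_on UNIV" by auto
  have "Ck k (partial_deriv j (\<lambda>z. \<eta> (fst z) * \<rho> (snd z)))" if "j \<in> Basis" for j
  proof -
    from that consider "j = (1, 0)" | i where "j = (0, i)" "i \<in> Basis" by (auto simp: Basis_prod_def)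
    then show ?thesis
    proof cases
      case 1
      show ?thesis unfolding 1 partial_deriv_tensor(2)[OF d]
        by (rule Suc.IH[OF _ Ck_SucD[OF Suc.prems(2)]]) (use Suc.prems in simp)
    next
      case 2
      show ?thesis unfolding 2 partial_deriv_tensor(3)[OF d]
        by (rule Suc.IH[OF Ck_SucD[OF Suc.prems(1)]]) (use Suc.prems 2(2) in simp)
    qed
  qed
  then show ?case using partial_deriv_tensor(1)[OF d] by simp
qed

lemma smooth_tensor:
  fixes \<rho> :: "'a::euclidean_space \<Rightarrow> real" and \<eta> :: "real \<Rightarrow> real"
  assumes "smooth \<eta>" "smooth \<rho>" shows "smooth (\<lambda>z. \<eta> (fst z) * \<rho> (snd z))"
  using assms unfolding smooth_def by (intro allI Ck_tensor) (erule spec)+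

text \<open>The Laplacian for functions of \<open>x\<close> alone; on a product of
  \<open>\<eta>(t)\<close> and \<open>\<rho>(x)\<close> the operator \<open>laplace\<close> reduces
  to it.\<close>

definition lap :: "('a::euclidean_space \<Rightarrow> real) \<Rightarrow> 'a \<Rightarrow> real" where
  "lap \<rho> x = (\<Sum>i\<in>Basis. partial_deriv i (partial_deriv i \<rho>) x)"

text \<open>Each derivative contributes a factor -1, and two of them cancel. Hence testing with a
  reflected translate of a kernel turns the Laplacian term into the convolution with
  \<open>lap \<rho>\<close>.\<close>

lemma lap_reflect:
  fixes \<rho> :: "'a::euclidean_space \<Rightarrow> real"
  assumes "smooth \<rho>"
  shows "lap (\<lambda>y. \<rho> (x - y)) y = lap \<rho> (x - y)"
proof -
  have "partial_deriv i (partial_deriv i (\<lambda>y. \<rho> (x - y))) y = partial_deriv i (partial_deriv i \<rho>) (x - y)"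
    if i: "i \<in> Basis" for i
  proof -
    have "partial_deriv i (\<lambda>y. \<rho> (x - y)) = (\<lambda>y. (-1) * partial_deriv i \<rho> (x + (-1) *\<^sub>R y))"
      using Ck_mult_affine(2)[OF smooth_differentiable[OF assms], of i 1 x "-1"] by simp
    then show ?thesis
      using Ck_mult_affine(2)[OF smooth_differentiable[OF smooth_partial_deriv[OF assms i]], of i "-1" x "-1"]
      by simp
  qed
  then show ?thesis by (simp add: lap_def)
qed

lemma dt_tensor: "smooth \<eta> \<Longrightarrow> smooth \<rho> \<Longrightarrow>
    dt (\<lambda>z. \<eta> (fst z) * \<rho> (snd z)) (t, x) = partial_deriv 1 \<eta> t * \<rho> x"
  by (simp add: dt_def partial_deriv_tensor(2) smooth_differentiable)

lemma laplace_tensor: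
  assumes "smooth \<eta>" "smooth \<rho>"
  shows "laplace (\<lambda>z. \<eta> (fst z) * \<rho> (snd z)) (t, x) = \<eta> t * lap \<rho> x"
proof -
  have "partial_deriv (0, i) (partial_deriv (0, i) (\<lambda>z. \<eta> (fst z) * \<rho> (snd z))) (t, x)
      = \<eta> t * partial_deriv i (partial_deriv i \<rho>) x" if "i \<in> Basis" for i
    using assms that by (simp add: partial_deriv_tensor(3) smooth_differentiable smooth_partial_deriv)
  then show ?thesis by (simp add: laplace_def lap_def sum_distrib_left)
qed

lemma Cc_partial_deriv:
  fixes f :: "'a::euclidean_space \<Rightarrow> real"
  assumes "smooth f" "f \<in> Cc" "i \<in> Basis"
  shows "partial_deriv i f \<in> Cc"
proof -
  obtain R where R: "\<And>x. R < norm x \<Longrightarrow> f x = 0" using assms(2) by (rule Cc_vanish) blast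
  show ?thesis
  proof (rule CcI[of _ R])
    show "continuous_on UNIV (partial_deriv i f)"
      by (rule smooth_continuous[OF smooth_partial_deriv[OF assms(1,3)]])
    fix x :: 'a assume x: "R < norm x"
    have "((\<lambda>_. 0) has_derivative (\<lambda>_. 0)) (at x)" by simp
    moreover have "open {x::'a. R < norm x}" by (intro open_Collect_less continuous_intros)
    ultimately have "(f has_derivative (\<lambda>_. 0)) (at x)"
      by (rule has_derivative_transform_within_open[of "\<lambda>_. 0"]) (use x R in auto)
    then show "partial_deriv i f x = 0" by (rule partial_deriv_eq)
  qed
qed

lemma Cc_lap:
  assumes "smooth f" "f \<in> Cc" shows "lap f \<in> Cc"
  unfolding lap_def[abs_def]
  by (intro Cc_sum finite_Basis Cc_partial_deriv smooth_partial_deriv assms)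

lemma test_functions_imp_Cc:
  assumes "\<phi> \<in> test_functions \<Omega>" shows "smooth \<phi>" "\<phi> \<in> Cc"
proof -
  show sm: "smooth \<phi>" using assms by (simp add: test_functions_def)
  have "bounded (supp \<phi>)" using assms by (simp add: test_functions_def compact_imp_bounded)
  then obtain R where R: "\<And>x. x \<in> supp \<phi> \<Longrightarrow> norm x \<le> R" unfolding bounded_iff by blast
  have "\<phi> x = 0" if "R < norm x" for x
    using R[of x] closure_subset[of "{x. \<phi> x \<noteq> 0}"] that unfolding supp_def by force
  then show "\<phi> \<in> Cc" using smooth_continuous[OF sm] by (intro CcI[of _ R])
qed

text \<open>A compact interval inside \<open>{0<..<T}\<close> keeps the support off the boundary
  times. This is why the time identities are first obtained between interior times.\<close>

lemma tensor_test_function: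
  fixes \<rho> :: "'a::euclidean_space \<Rightarrow> real" and \<eta> :: "real \<Rightarrow> real"
  assumes \<eta>: "smooth \<eta>" "\<And>s. s \<notin> {a..b} \<Longrightarrow> \<eta> s = 0" "{a..b} \<subseteq> {0<..<T}"
    and \<rho>: "smooth \<rho>" "\<rho> \<in> Cc"
  shows "(\<lambda>z. \<eta> (fst z) * \<rho> (snd z)) \<in> test_functions ({0<..<T} \<times> UNIV)"
proof -
  obtain R where R: "\<And>x. R < norm x \<Longrightarrow> \<rho> x = 0" using \<rho>(2) by (rule Cc_vanish) blast
  have sub: "supp (\<lambda>z. \<eta> (fst z) * \<rho> (snd z)) \<subseteq> {a..b} \<times> cball 0 R"
    unfolding supp_def
  proof (rule closure_minimal)
    show "{z. \<eta> (fst z) * \<rho> (snd z) \<noteq> 0} \<subseteq> {a..b} \<times> cball 0 R"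
      using \<eta>(2) R by (force simp: not_less[symmetric])
  qed (intro closed_Times, auto)
  have "compact ({a..b} \<times> cball (0::'a) R)" by (intro compact_Times) auto
  then have "compact (supp (\<lambda>z. \<eta> (fst z) * \<rho> (snd z)))"
    using compact_Int_closed[OF _ closed_closure] sub unfolding supp_def by (metis Int_absorb1)
  then show ?thesis
    using sub \<eta>(3) smooth_tensor[OF \<eta>(1) \<rho>(1)] unfolding test_functions_def by auto
qed

section \<open>Sign of the Laplacian on mollified functions, by second differences\<close>

definition second_difference :: "'a::euclidean_space \<Rightarrow> real \<Rightarrow> ('a \<Rightarrow> real) \<Rightarrow> 'a \<Rightarrow> real" where
  "second_difference i h \<rho> x = inverse (h\<^sup>2) * (\<rho> (x + h *\<^sub>R i) + \<rho> (x - h *\<^sub>R i) - 2 * \<rho> x)"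

text \<open>Taylor's formula of order 2 for the even function
  \<open>\<rho>(x + t i) + \<rho>(x - t i)\<close> of \<open>t\<close>: the first-order term
  vanishes by symmetry, and the Lagrange remainder is the average of two values of the second
  derivative.\<close>

lemma second_difference_eq:
  fixes \<rho> :: "'a::euclidean_space \<Rightarrow> real"
  assumes \<rho>: "smooth \<rho>" and i: "i \<in> Basis" and h: "0 < h"
  shows "\<exists>t. 0 < t \<and> t \<le> h \<and> second_difference i h \<rho> x =
    (partial_deriv i (partial_deriv i \<rho>) (x + t *\<^sub>R i) + partial_deriv i (partial_deriv i \<rho>) (x - t *\<^sub>R i)) / 2"
proof -
  let ?d = "\<lambda>m::nat. if m = 0 then (\<lambda>t. \<rho> (x + t *\<^sub>R i) + \<rho> (x + (- t) *\<^sub>R i))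
     else if m = 1 then (\<lambda>t. partial_deriv i \<rho> (x + t *\<^sub>R i) - partial_deriv i \<rho> (x + (- t) *\<^sub>R i))
     else (\<lambda>t. partial_deriv i (partial_deriv i \<rho>) (x + t *\<^sub>R i)
              + partial_deriv i (partial_deriv i \<rho>) (x + (- t) *\<^sub>R i))"
  have line: "((\<lambda>s. f (x + s *\<^sub>R i)) has_real_derivative partial_deriv i f (x + t *\<^sub>R i)) (at t)"
    "((\<lambda>s. f (x + (- s) *\<^sub>R i)) has_real_derivative - partial_deriv i f (x + (- t) *\<^sub>R i)) (at t)"
    if "smooth f" for f t
  proof -
    show 1: "((\<lambda>s. f (x + s *\<^sub>R i)) has_real_derivative partial_deriv i f (x + t *\<^sub>R i)) (at t)" for t
      by (rule partial_deriv_line[OF smooth_differentiable[OF that]])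
    show "((\<lambda>s. f (x + (- s) *\<^sub>R i)) has_real_derivative - partial_deriv i f (x + (- t) *\<^sub>R i)) (at t)"
    proof -
      have "((\<lambda>s. f (x + (- s) *\<^sub>R i)) has_real_derivative partial_deriv i f (x + (- t) *\<^sub>R i) * - 1) (at t)"
        by (rule DERIV_chain2[where f="\<lambda>s. f (x + s *\<^sub>R i)" and g=uminus, OF 1])
           (auto intro!: derivative_eq_intros)
      then show ?thesis by simp
    qed
  qed
  have sm: "smooth (partial_deriv i \<rho>)" by (rule smooth_partial_deriv[OF \<rho> i])
  have "\<exists>t>0. t \<le> h \<and> ?d 0 h = (\<Sum>m<2. ?d m 0 / fact m * h ^ m) + ?d 2 t / fact 2 * h ^ 2"
  proof (rule Maclaurin2[OF h refl], intro allI impI)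
    fix m :: nat and t :: real assume "m < 2 \<and> 0 \<le> t \<and> t \<le> h"
    then consider "m = 0" | "m = 1" by linarith
    then show "(?d m has_real_derivative ?d (Suc m) t) (at t)"
    proof cases
      case 1
      then show ?thesis using DERIV_add[OF line[OF \<rho>, of t]] by simp
    next
      case 2
      then show ?thesis using DERIV_diff[OF line[OF sm, of t]] by simp
    qed
  qed
  then obtain t where "0 < t" "t \<le> h" "\<rho> (x + h *\<^sub>R i) + \<rho> (x - h *\<^sub>R i) = 2 * \<rho> x +
    (partial_deriv i (partial_deriv i \<rho>) (x + t *\<^sub>R i) + partial_deriv i (partial_deriv i \<rho>) (x - t *\<^sub>R i)) / 2 * h\<^sup>2"
    by (auto simp: numeral_2_eq_2)
  then show ?thesis using h by (intro exI[of _ t]) (simp add: second_difference_def field_simps)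
qed

lemma second_difference_Cc:
  assumes "\<rho> \<in> Cc" shows "second_difference i h \<rho> \<in> Cc"
proof -
  have "(\<lambda>x. inverse (h\<^sup>2) * (\<rho> (h *\<^sub>R i + 1 *\<^sub>R x) + \<rho> (- h *\<^sub>R i + 1 *\<^sub>R x) - 2 * \<rho> x)) \<in> Cc"
    by (intro Cc_cmult Cc_diff Cc_add Cc_affine assms) auto
  then show ?thesis by (simp add: second_difference_def[abs_def] add.commute)
qed

text \<open>Each quotient averages two values of the second derivative at points within distance 1
  of \<open>x\<close>. So all quotients share a bound and a bounded support, and pointwise
  convergence becomes convergence in \<open>L\<^sup>1\<close>.\<close>

lemma second_difference_tendsto:
  fixes \<rho> :: "'a::euclidean_space \<Rightarrow> real"
  assumes \<rho>: "smooth \<rho>" "\<rho> \<in> Cc" and i: "i \<in> Basis"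
  shows "(\<lambda>n. LINT x|lebesgue. \<bar>second_difference i (inverse (real (Suc n))) \<rho> x - partial_deriv i (partial_deriv i \<rho>) x\<bar>)
    \<longlonglongrightarrow> 0"
proof -
  let ?d = "partial_deriv i (partial_deriv i \<rho>)" and ?h = "\<lambda>n. inverse (real (Suc n))"
  have dCc: "?d \<in> Cc" by (intro Cc_partial_deriv smooth_partial_deriv \<rho> i)
  obtain R K where RK: "0 < R" "0 < K" "\<And>x. norm (?d x) \<le> K" "\<And>x. R < norm x \<Longrightarrow> ?d x = 0"
    using Cc_bounds[OF dCc] by blast
  have h: "0 < ?h n" "?h n \<le> 1" for n by (auto simp: field_simps)
  have "\<forall>n x. \<exists>t. 0 < t \<and> t \<le> ?h n \<and> second_difference i (?h n) \<rho> x = (?d (x + t *\<^sub>R i) + ?d (x - t *\<^sub>R i)) / 2"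
    using second_difference_eq[OF \<rho>(1) i h(1)] by blast
  then obtain t where t: "\<And>n x. 0 < t n x" "\<And>n x. t n x \<le> ?h n"
      "\<And>n x. second_difference i (?h n) \<rho> x = (?d (x + t n x *\<^sub>R i) + ?d (x - t n x *\<^sub>R i)) / 2"
    by metis
  \<comment> \<open>Measurability is taken from the quotient itself, since the intermediate points
    \<open>t n x\<close> are merely chosen for each \<open>x\<close>.\<close>
  have m: "(\<lambda>x. \<bar>second_difference i (?h n) \<rho> x - ?d x\<bar>) \<in> borel_measurable lebesgue" for n
    by (intro borel_imp_lebesgue Cc_borel Cc_abs Cc_diff second_difference_Cc \<rho> dCc)
  have "(\<lambda>n. LINT x|lebesgue. \<bar>second_difference i (?h n) \<rho> x - ?d x\<bar>) \<longlonglongrightarrow> (LINT x::'a|lebesgue. 0)"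
  proof (rule integral_dominated_convergence[OF _ m])
    show "integrable lebesgue (\<lambda>x. (2 * K) * indicator (cball (0::'a) (R + 1)) x :: real)"
      by (intro integrable_mult_right integrable_indicator_cball)
    have "(\<lambda>n. \<bar>second_difference i (?h n) \<rho> x - ?d x\<bar>) \<longlonglongrightarrow> 0" for x
    proof -
      have t0: "(\<lambda>n. t n x) \<longlonglongrightarrow> 0"
        by (rule tendsto_sandwich[OF _ _ tendsto_const LIMSEQ_inverse_real_of_nat])
           (use t(1,2) in \<open>auto intro!: always_eventually less_imp_le simp del: of_nat_Suc\<close>)
      have "(\<lambda>n. x + t n x *\<^sub>R i) \<longlonglongrightarrow> x + 0 *\<^sub>R i" "(\<lambda>n. x - t n x *\<^sub>R i) \<longlonglongrightarrow> x - 0 *\<^sub>R i"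
        by (intro tendsto_intros t0)+
      then have "(\<lambda>n. ?d (x + t n x *\<^sub>R i)) \<longlonglongrightarrow> ?d x" "(\<lambda>n. ?d (x - t n x *\<^sub>R i)) \<longlonglongrightarrow> ?d x"
        using Cc_continuous[OF dCc]
        by (auto intro!: isCont_tendsto_compose[of _ ?d] simp: continuous_on_eq_continuous_at)
      then have "(\<lambda>n. \<bar>(?d (x + t n x *\<^sub>R i) + ?d (x - t n x *\<^sub>R i)) / 2 - ?d x\<bar>) \<longlonglongrightarrow> \<bar>(?d x + ?d x) / 2 - ?d x\<bar>"
        by (intro tendsto_intros) auto
      then show ?thesis unfolding t(3) by simp
    qed
    then show "AE x in lebesgue. (\<lambda>n. \<bar>second_difference i (?h n) \<rho> x - ?d x\<bar>) \<longlonglongrightarrow> 0" by simp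
    have "norm \<bar>second_difference i (?h n) \<rho> x - ?d x\<bar> \<le> (2 * K) * indicator (cball (0::'a) (R + 1)) x" for n x
    proof (cases "norm x \<le> R + 1")
      case True
      have avg: "\<bar>(a + b) / 2 - c\<bar> \<le> 2 * K" if "\<bar>a\<bar> \<le> K" "\<bar>b\<bar> \<le> K" "\<bar>c\<bar> \<le> K" for a b c :: real
        using that unfolding abs_le_iff by (auto simp: field_simps)
      have "\<bar>(?d (x + t n x *\<^sub>R i) + ?d (x - t n x *\<^sub>R i)) / 2 - ?d x\<bar> \<le> 2 * K"
        by (rule avg) (use RK(3) in \<open>simp_all only: real_norm_def\<close>)
      then show ?thesis using True by (simp add: t(3) del: of_nat_Suc)
    next
      case False
      have "norm (t n x *\<^sub>R i) \<le> 1" using t(1,2)[of n x] h(2)[of n] i by simp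
      then have "R < norm (x + t n x *\<^sub>R i)" "R < norm (x - t n x *\<^sub>R i)"
        using False norm_diff_ineq[of x "t n x *\<^sub>R i"] norm_triangle_ineq2[of x "t n x *\<^sub>R i"] by linarith+
      then show ?thesis using RK(4) False by (simp add: t(3) del: of_nat_Suc)
    qed
    then show "AE x in lebesgue. norm \<bar>second_difference i (?h n) \<rho> x - ?d x\<bar>
        \<le> (2 * K) * indicator (cball (0::'a) (R + 1)) x" for n by simp
  qed simp
  then show ?thesis by simp
qed

text \<open>Convolution commutes with translation, so the quotient may be taken after convolving.
  Pairing with it then involves only the mollified function and its own translates.\<close>

lemma convolution_second_difference:
  assumes f: "f \<in> L2" and \<rho>: "\<rho> \<in> Cc"
  shows "convolution f (second_difference i h \<rho>) x = inverse (h\<^sup>2) *\<^sub>R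
    (convolution f \<rho> (x + h *\<^sub>R i) + convolution f \<rho> (x - h *\<^sub>R i) - 2 *\<^sub>R convolution f \<rho> x)"
proof -
  have shift: "(\<lambda>x. \<rho> (x + a)) \<in> Cc" "convolution f (\<lambda>x. \<rho> (x + a)) x = convolution f \<rho> (x + a)" for a
    using Cc_affine[OF \<rho>, of 1 a] by (simp_all add: add.commute convolution_def algebra_simps)
  have shift': "(\<lambda>x. \<rho> (x - a)) \<in> Cc" "convolution f (\<lambda>x. \<rho> (x - a)) x = convolution f \<rho> (x - a)" for a
    using shift[of "- a"] by simp_all
  have "convolution f (\<lambda>x. inverse (h\<^sup>2) * (\<rho> (x + h *\<^sub>R i) + \<rho> (x - h *\<^sub>R i) - 2 * \<rho> x)) x
    = inverse (h\<^sup>2) *\<^sub>R (convolution f (\<lambda>x. \<rho> (x + h *\<^sub>R i)) x + convolution f (\<lambda>x. \<rho> (x - h *\<^sub>R i)) x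
        - 2 *\<^sub>R convolution f \<rho> x)"
    by (simp only: convolution_cmult_right convolution_diff_right[OF f Cc_add[OF shift(1) shift'(1)] Cc_cmult[OF \<rho>]]
        convolution_add_right[OF f shift(1) shift'(1)])
  then show ?thesis by (simp only: second_difference_def[abs_def] shift shift')
qed

lemma L2_shift_inner_le:
  assumes V: "V \<in> L2" "V \<in> borel_measurable borel"
  shows "integrable lebesgue (\<lambda>x. V x \<bullet> V (x + a))" "(LINT x|lebesgue. V x \<bullet> V (x + a)) \<le> (L2_norm V)\<^sup>2"
proof -
  note [measurable] = V(2)
  have "integrable lborel (\<lambda>x. (norm (V x))\<^sup>2)"
    using L2_integrable[OF V(1)] by (simp add: integrable_completion)
  then have "integrable lborel (\<lambda>x. (norm (V (a + 1 *\<^sub>R x)))\<^sup>2)"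
    by (subst (asm) lborel_affine[of 1 a]) (simp_all add: density_1 integrable_distr_eq)
  then have L: "(\<lambda>x. V (x + a)) \<in> L2"
    by (auto simp: L2_def integrable_completion add.commute intro!: borel_imp_lebesgue)
  have eq: "L2_norm (\<lambda>x. V (x + a)) = L2_norm V"
    using lebesgue_integral_translate_borel[of "\<lambda>x. (norm (V x))\<^sup>2" a] by (simp add: L2_norm_def)
  show "integrable lebesgue (\<lambda>x. V x \<bullet> V (x + a))" by (rule L2_integrable_inner(1)[OF V(1) L])
  show "(LINT x|lebesgue. V x \<bullet> V (x + a)) \<le> (L2_norm V)\<^sup>2"
    using L2_integrable_inner(2)[OF V(1) L] by (simp add: eq power2_eq_square)
qed

text \<open>No integration by parts: the pairing with a second difference quotient of the translates is
  nonpositive by Cauchy--Schwarz, and the difference quotients of \<open>\<rho>\<close> converge in \<open>L\<^sup>1\<close>.\<close>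

lemma convolution_second_deriv_nonpos:
  assumes f: "f \<in> L2" and \<rho>: "smooth \<rho>" "\<rho> \<in> Cc" and i: "i \<in> Basis"
  shows "(LINT x|lebesgue. convolution f \<rho> x \<bullet> convolution f (partial_deriv i (partial_deriv i \<rho>)) x) \<le> 0"
proof -
  let ?V = "convolution f \<rho>" and ?d = "partial_deriv i (partial_deriv i \<rho>)"
  let ?h = "\<lambda>n. inverse (real (Suc n))"
  let ?D = "\<lambda>n. second_difference i (?h n) \<rho>"
  have dCc: "?d \<in> Cc" by (intro Cc_partial_deriv smooth_partial_deriv \<rho> i)
  have DCc: "?D n \<in> Cc" for n by (rule second_difference_Cc[OF \<rho>(2)])
  have V: "?V \<in> L2" by (rule convolution_Young(1)[OF f \<rho>(2)])
  have Vb: "?V \<in> borel_measurable borel"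
    by (rule borel_measurable_continuous_onI[OF continuous_convolution[OF f \<rho>(2)]])
  have neg: "(LINT x|lebesgue. ?V x \<bullet> convolution f (?D n) x) \<le> 0" for n
  proof -
    note sh = L2_shift_inner_le[OF V Vb]
    have sh': "integrable lebesgue (\<lambda>x. ?V x \<bullet> ?V (x - a))" "(LINT x|lebesgue. ?V x \<bullet> ?V (x - a)) \<le> (L2_norm ?V)\<^sup>2" for a
      using sh[of "- a"] by simp_all
    have "(LINT x|lebesgue. ?V x \<bullet> convolution f (?D n) x) = (LINT x|lebesgue. inverse ((?h n)\<^sup>2) *
        (?V x \<bullet> ?V (x + ?h n *\<^sub>R i) + ?V x \<bullet> ?V (x - ?h n *\<^sub>R i) - 2 * (norm (?V x))\<^sup>2))"
      by (simp only: convolution_second_difference[OF f \<rho>(2)] inner_scaleR_right inner_add_right inner_diff_right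
          power2_norm_eq_inner)
    also have "\<dots> = inverse ((?h n)\<^sup>2) * ((LINT x|lebesgue. ?V x \<bullet> ?V (x + ?h n *\<^sub>R i)) +
        (LINT x|lebesgue. ?V x \<bullet> ?V (x - ?h n *\<^sub>R i)) - 2 * (L2_norm ?V)\<^sup>2)"
      using sh(1) sh'(1) L2_integrable[OF V] by (simp add: L2_norm_power2 del: of_nat_Suc)
    \<comment> \<open>Each of the two pairings with a translate is at most the squared norm, and
      together they meet \<open>- 2 * (L2_norm ?V)\<^sup>2\<close>.\<close>
    also have "\<dots> \<le> 0"
      using sh(2)[of "?h n *\<^sub>R i"] sh'(2)[of "?h n *\<^sub>R i"]
      by (intro mult_nonneg_nonpos) (auto simp del: of_nat_Suc)
    finally show ?thesis .
  qed
  have lim0: "(\<lambda>n. L2_norm ?V * ((LINT x|lebesgue. \<bar>?D n x - ?d x\<bar>) * L2_norm f)) \<longlonglongrightarrow> L2_norm ?V * (0 * L2_norm f)"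
    by (intro tendsto_intros second_difference_tendsto \<rho> i)
  have "(\<lambda>n. (LINT x|lebesgue. ?V x \<bullet> convolution f (?D n) x) - (LINT x|lebesgue. ?V x \<bullet> convolution f ?d x)) \<longlonglongrightarrow> 0"
  proof (rule Lim_null_comparison[OF _ lim0[simplified mult_zero_left mult_zero_right]], intro always_eventually allI)
    fix n
    note L = convolution_Young(1)[OF f DCc[of n]] convolution_Young(1)[OF f dCc] convolution_Young[OF f Cc_diff[OF DCc[of n] dCc]]
    have "(LINT x|lebesgue. ?V x \<bullet> convolution f (?D n) x) - (LINT x|lebesgue. ?V x \<bullet> convolution f ?d x)
        = (LINT x|lebesgue. ?V x \<bullet> convolution f (\<lambda>x. ?D n x - ?d x) x)"
      using L2_integrable_inner(1)[OF V L(1)] L2_integrable_inner(1)[OF V L(2)]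
      by (simp add: convolution_diff_right[OF f DCc dCc] inner_diff_right del: of_nat_Suc)
    then have "norm ((LINT x|lebesgue. ?V x \<bullet> convolution f (?D n) x) - (LINT x|lebesgue. ?V x \<bullet> convolution f ?d x))
        \<le> L2_norm ?V * L2_norm (convolution f (\<lambda>x. ?D n x - ?d x))"
      using L2_integrable_inner(2)[OF V L(3)] by simp
    \<comment> \<open>Young's inequality turns \<open>L\<^sup>1\<close> convergence of the kernels
      into \<open>L\<^sup>2\<close> convergence of the convolutions.\<close>
    also have "\<dots> \<le> L2_norm ?V * ((LINT x|lebesgue. \<bar>?D n x - ?d x\<bar>) * L2_norm f)"
      by (intro mult_left_mono L(4) L2_norm_nonneg)
    finally show "norm ((LINT x|lebesgue. ?V x \<bullet> convolution f (?D n) x) - (LINT x|lebesgue. ?V x \<bullet> convolution f ?d x))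
        \<le> L2_norm ?V * ((LINT x|lebesgue. \<bar>?D n x - ?d x\<bar>) * L2_norm f)" .
  qed
  then have "(\<lambda>n. LINT x|lebesgue. ?V x \<bullet> convolution f (?D n) x) \<longlonglongrightarrow> (LINT x|lebesgue. ?V x \<bullet> convolution f ?d x)"
    by (rule Lim_null[THEN iffD2])
  then show ?thesis by (rule LIMSEQ_le_const2) (use neg in auto)
qed

lemma convolution_lap_nonpos:
  assumes f: "f \<in> L2" and \<rho>: "smooth \<rho>" "\<rho> \<in> Cc"
  shows "(LINT x|lebesgue. convolution f \<rho> x \<bullet> convolution f (lap \<rho>) x) \<le> 0"
proof -
  have d: "partial_deriv i (partial_deriv i \<rho>) \<in> Cc" if "i \<in> Basis" for i
    by (intro Cc_partial_deriv smooth_partial_deriv \<rho> that)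
  have eq: "convolution f (lap \<rho>) x = (\<Sum>i\<in>Basis. convolution f (partial_deriv i (partial_deriv i \<rho>)) x)" for x
    unfolding lap_def[abs_def] by (rule convolution_sum_right[OF f d])
  have "(LINT x|lebesgue. convolution f \<rho> x \<bullet> convolution f (lap \<rho>) x)
      = (\<Sum>i\<in>Basis. LINT x|lebesgue. convolution f \<rho> x \<bullet> convolution f (partial_deriv i (partial_deriv i \<rho>)) x)"
    unfolding eq inner_sum_right
    by (intro Bochner_Integration.integral_sum L2_integrable_inner(1) convolution_Young(1) f \<rho> d)
  also have "\<dots> \<le> 0" by (intro sum_nonpos convolution_second_deriv_nonpos f \<rho>)
  finally show ?thesis .
qed

section \<open>From distributional solutions to integral identities\<close>
lemma friedrichs_mollifierD:
  assumes "friedrichs_mollifier \<psi>"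
  shows "smooth \<psi>" "\<psi> \<in> Cc" "\<And>x. 0 \<le> \<psi> x" "(LINT x|lebesgue. \<psi> x) = 1"
  using assms test_functions_imp_Cc[of \<psi> UNIV] by (auto simp: friedrichs_mollifier_def)

text \<open>Beyond the support of \<open>\<theta>\<close> the primitive is constant: 0 on the left,
  the total integral on the right. These flat ends are what a smooth step needs.\<close>

lemma Cc_antiderivative:
  fixes \<theta> :: "real \<Rightarrow> real"
  assumes "\<theta> \<in> Cc"
  shows "\<exists>F S. 0 < S \<and> (\<forall>x. (F has_real_derivative \<theta> x) (at x)) \<and>
    (\<forall>x\<le>- S. F x = 0) \<and> (\<forall>x\<ge>S. F x = F S) \<and> (\<forall>x. S \<le> \<bar>x\<bar> \<longrightarrow> \<theta> x = 0)"
proof -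
  obtain R K where R: "0 < R" "\<And>x. R < \<bar>x\<bar> \<Longrightarrow> \<theta> x = 0"
    using Cc_bounds[OF assms] by (metis real_norm_def)
  define F where "F x = integral {- R - 1..x} \<theta>" for x
  have F0: "F x = 0" if "x < - R" for x
    unfolding F_def by (rule integral_unique, rule has_integral_is_0) (use that R in auto)
  \<comment> \<open>To the left of the support \<open>F\<close> is locally 0. Elsewhere the base
    point \<open>- R - 1\<close> lies strictly to the left of \<open>x\<close>, so \<open>x\<close>
    is interior to the interval on which the derivative of the integral is known.\<close>
  have der: "(F has_real_derivative \<theta> x) (at x)" for x
  proof (cases "x < - R")
    case True
    have "((\<lambda>_. 0) has_real_derivative 0) (at x)" by simp
    then have "(F has_real_derivative 0) (at x)"
      by (rule has_field_derivative_transform_within_open[where S="{..<- R}"]) (use True F0 in auto)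
    then show ?thesis using True R by simp
  next
    case False
    have "(F has_real_derivative \<theta> x) (at x within {- R - 1..x + 1})"
      unfolding F_def using False
      by (intro integral_has_real_derivative continuous_on_subset[OF Cc_continuous[OF assms]]) auto
    then show ?thesis using False by (simp add: at_within_Icc_at)
  qed
  have const: "F x = F (R + 1)" if "R + 1 \<le> x" for x
  proof (cases "x = R + 1")
    case False
    show ?thesis
    proof (rule DERIV_isconst_end[of "R + 1" x F])
      show "R + 1 < x" using False that by simp
      show "continuous_on {R + 1..x} F" using der DERIV_isCont by (auto intro!: continuous_at_imp_continuous_on)
      fix y assume "R + 1 < y" "y < x"
      then show "(F has_real_derivative 0) (at y)" using der[of y] R(2)[of y] R(1) by simp
    qed
  qed simp
  show ?thesis
  proof (intro exI[of _ F] exI[of _ "R + 1"] conjI allI impI)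
    show "F x = F (R + 1)" if "R + 1 \<le> x" for x using that by (rule const)
    show "F x = 0" if "x \<le> - (R + 1)" for x using that by (intro F0) simp
    show "\<theta> x = 0" if "R + 1 \<le> \<bar>x\<bar>" for x using that by (intro R(2)) simp
  qed (use R(1) der in simp_all)
qed

text \<open>The restriction of \<open>\<psi>\<close> to a line through a point where it does not vanish serves as a bump
  function on the real line.\<close>

lemma smooth_step_exists:
  fixes \<psi> :: "'a::euclidean_space \<Rightarrow> real"
  assumes "friedrichs_mollifier \<psi>"
  obtains \<Psi> \<theta> :: "real \<Rightarrow> real" and S where "smooth \<Psi>" "\<theta> \<in> Cc" "\<And>x. (\<Psi> has_real_derivative \<theta> x) (at x)"
    "0 < S" "\<And>x. x \<le> - S \<Longrightarrow> \<Psi> x = 0" "\<And>x. S \<le> x \<Longrightarrow> \<Psi> x = 1" "\<And>x. S \<le> \<bar>x\<bar> \<Longrightarrow> \<theta> x = 0"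
    "\<And>x. 0 \<le> \<Psi> x" "\<And>x. \<Psi> x \<le> 1"
proof -
  note \<psi> = friedrichs_mollifierD[OF assms]
  obtain x0 where x0: "\<psi> x0 \<noteq> 0"
  proof (rule ccontr)
    assume "\<not> thesis"
    then have "\<psi> = (\<lambda>_. 0)" using that by blast
    then show False using \<psi>(4) by simp
  qed
  obtain e :: 'a where e: "e \<in> Basis" using nonempty_Basis by blast
  define \<theta>0 where "\<theta>0 s = \<psi> (x0 + s *\<^sub>R e)" for s
  have sm: "smooth \<theta>0"
    unfolding smooth_def \<theta>0_def by (intro allI) (rule Ck_line[OF e smooth_Ck[OF \<psi>(1)]])
  obtain R where R: "\<And>x. R < norm x \<Longrightarrow> \<psi> x = 0" using \<psi>(2) by (rule Cc_vanish) blast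
  have "\<theta>0 s = 0" if "R + norm x0 < norm s" for s
    unfolding \<theta>0_def using that norm_diff_ineq[of "s *\<^sub>R e" x0] e by (intro R) (simp add: add.commute)
  then have \<theta>0: "\<theta>0 \<in> Cc" using smooth_continuous[OF sm] by (intro CcI[of _ "R + norm x0"])
  obtain F S where F': "0 < S \<and> (\<forall>x. (F has_real_derivative \<theta>0 x) (at x)) \<and>
      (\<forall>x\<le>- S. F x = 0) \<and> (\<forall>x\<ge>S. F x = F S) \<and> (\<forall>x. S \<le> \<bar>x\<bar> \<longrightarrow> \<theta>0 x = 0)"
    using Cc_antiderivative[OF \<theta>0] by (elim exE) (rule that)
  have F: "0 < S" "(F has_real_derivative \<theta>0 x) (at x)" "x \<le> - S \<Longrightarrow> F x = 0" "S \<le> x \<Longrightarrow> F x = F S"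
      "S \<le> \<bar>x\<bar> \<Longrightarrow> \<theta>0 x = 0" for x
    using F' by blast+
  have mono: "F x \<le> F y" if "x \<le> y" for x y
    by (rule DERIV_nonneg_imp_nondecreasing[OF that]) (use F(2) \<psi>(3) in \<open>auto simp: \<theta>0_def\<close>)
  have nonneg: "0 \<le> F x" for x
    using mono[of "min x (- S)" x] F(3)[of "min x (- S)"] by simp
  have le: "F x \<le> F S" for x
    using mono[of x "max x S"] F(4)[of "max x S"] by simp
  \<comment> \<open>Squeezed between 0 and \<open>F S = 0\<close>, the function \<open>F\<close>
    would vanish identically, and so would its derivative, whereas \<open>\<theta>0 0\<close> is
    \<open>\<psi> x0\<close>. Division by \<open>F S\<close> then normalises the height of the
    step.\<close>
  have "F S \<noteq> 0"
  proof
    assume "F S = 0"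
    then have "F = (\<lambda>_. 0)" using nonneg le by (auto simp: fun_eq_iff intro: antisym)
    then have "(F has_real_derivative 0) (at 0)" by simp
    then have "\<theta>0 0 = 0" using F(2)[of 0] DERIV_unique by blast
    then show False using x0 by (simp add: \<theta>0_def)
  qed
  then have c: "0 < F S" using nonneg[of S] by simp
  have sm': "smooth (\<lambda>x. inverse (F S) * \<theta>0 x)"
    using smooth_mult_affine[OF sm, of "inverse (F S)" 0 1] by simp
  have der: "((\<lambda>x. inverse (F S) * F x) has_real_derivative inverse (F S) * \<theta>0 x) (at x)" for x
    by (rule DERIV_cmult[OF F(2)])
  have right: "inverse (F S) * F x = 1" if "S \<le> x" for x
    unfolding F(4)[OF that] using c by simp
  show ?thesis
    by (rule that[of "\<lambda>x. inverse (F S) * F x" "\<lambda>x. inverse (F S) * \<theta>0 x" S])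
       (use smooth_antiderivative[OF der sm'] Cc_cmult[OF \<theta>0, of "inverse (F S)"] der F(1,3,5) right c nonneg le in
         \<open>auto simp: field_simps\<close>)
qed

text \<open>A smooth Heaviside function \<open>\<Psi>\<close> with transition zone from
  \<open>- S\<close> to \<open>S\<close> and derivative \<open>\<theta>\<close>. Under rescaling by
  \<open>k\<close> the step sharpens at \<open>a\<close>, while \<open>k \<theta>(k (s - a))\<close>
  becomes an approximate identity there.\<close>

locale smooth_step =
  fixes \<Psi> \<theta> :: "real \<Rightarrow> real" and S :: real
  assumes smooth: "smooth \<Psi>" and Cc: "\<theta> \<in> Cc" and deriv: "(\<Psi> has_real_derivative \<theta> x) (at x)"
    and S: "0 < S" and left: "x \<le> - S \<Longrightarrow> \<Psi> x = 0" and right: "S \<le> x \<Longrightarrow> \<Psi> x = 1"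
    and zero: "S \<le> \<bar>x\<bar> \<Longrightarrow> \<theta> x = 0" and nonneg: "0 \<le> \<Psi> x" and le_1: "\<Psi> x \<le> 1"
begin

lemma integral_1: "(LINT x|lebesgue. \<theta> x) = 1"
proof -
  have "integral\<^sup>L lborel (\<lambda>x. indicator {- S..S} x *\<^sub>R \<theta> x) = \<Psi> S - \<Psi> (- S)"
    using S deriv Cc_continuous[OF Cc]
    by (intro integral_FTC_atLeastAtMost)
       (auto intro: continuous_on_subset has_field_derivative_at_within simp flip: has_real_derivative_iff_has_vector_derivative)
  moreover have "(\<lambda>x. indicator {- S..S} x *\<^sub>R \<theta> x) = \<theta>"
  proof
    show "indicator {- S..S} x *\<^sub>R \<theta> x = \<theta> x" for x
      using zero[of x] by (cases "x \<in> {- S..S}") auto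
  qed
  ultimately have "integral\<^sup>L lborel \<theta> = 1" using left[of "- S"] right[of S] by (simp only:)
  then show ?thesis using Cc_borel[OF Cc] by (simp add: integral_completion)
qed

text \<open>The substitution \<open>z = k n * (s - a)\<close> fixes the kernel and moves the scale
  into the bounded continuous \<open>m\<close>; the integrands are dominated by |\<theta>| times
  \<open>B\<close>.\<close>

lemma concentrate_tendsto:
  fixes m :: "real \<Rightarrow> complex"
  assumes m: "continuous_on UNIV m" "\<And>s. norm (m s) \<le> B"
    and k: "\<And>n. 0 < k n" "filterlim k at_top sequentially"
  shows "(\<lambda>n. LINT s|lebesgue. (k n * \<theta> (k n * (s - a))) *\<^sub>R m s) \<longlonglongrightarrow> m a"
proof -
  have [measurable]: "m \<in> borel_measurable borel" "\<theta> \<in> borel_measurable borel"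
    using m(1) Cc_borel[OF Cc] by (auto intro: borel_measurable_continuous_onI)
  have eq: "(LINT s|lebesgue. (k n * \<theta> (k n * (s - a))) *\<^sub>R m s) = (LINT z|lebesgue. \<theta> z *\<^sub>R m (a + inverse (k n) * z))" for n
  proof -
    have "(LINT s|lebesgue. (k n * \<theta> (k n * (s - a))) *\<^sub>R m s) =
        inverse (k n) *\<^sub>R (LINT z|lebesgue. (k n * \<theta> (k n * (a + inverse (k n) *\<^sub>R z - a))) *\<^sub>R m (a + inverse (k n) *\<^sub>R z))"
      by (subst lebesgue_integral_affine_borel[of _ "inverse (k n)" a]) (use k(1)[of n] in auto)
    also have "\<dots> = (LINT z|lebesgue. inverse (k n) *\<^sub>R ((k n * \<theta> (k n * (a + inverse (k n) *\<^sub>R z - a))) *\<^sub>R m (a + inverse (k n) *\<^sub>R z)))"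
      by (rule integral_scaleR_right[symmetric])
    also have "\<dots> = (LINT z|lebesgue. \<theta> z *\<^sub>R m (a + inverse (k n) * z))"
      using k(1)[of n] by (intro Bochner_Integration.integral_cong) (auto simp flip: mult.assoc)
    finally show ?thesis .
  qed
  have "(\<lambda>n. LINT z|lebesgue. \<theta> z *\<^sub>R m (a + inverse (k n) * z)) \<longlonglongrightarrow> (LINT z|lebesgue. \<theta> z *\<^sub>R m a)"
  proof (rule integral_dominated_convergence)
    show "integrable lebesgue (\<lambda>z. \<bar>\<theta> z\<bar> * B)"
      by (intro integrable_mult_left Cc_integrable Cc_abs Cc)
    have "(\<lambda>n. m (a + inverse (k n) * z)) \<longlonglongrightarrow> m a" for z
    proof -
      have "(\<lambda>n. inverse (k n)) \<longlonglongrightarrow> 0" by (rule tendsto_inverse_0_at_top[OF k(2)])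
      then have "(\<lambda>n. a + inverse (k n) * z) \<longlonglongrightarrow> a + 0 * z" by (intro tendsto_intros)
      then show ?thesis
        using m(1) by (intro isCont_tendsto_compose[of _ m]) (auto simp: continuous_on_eq_continuous_at)
    qed
    then show "AE z in lebesgue. (\<lambda>n. \<theta> z *\<^sub>R m (a + inverse (k n) * z)) \<longlonglongrightarrow> \<theta> z *\<^sub>R m a"
      by (intro AE_I2 tendsto_intros)
    show "AE z in lebesgue. norm (\<theta> z *\<^sub>R m (a + inverse (k n) * z)) \<le> \<bar>\<theta> z\<bar> * B" for n
      using m(2) by (intro AE_I2) (simp add: mult_left_mono)
  qed (auto intro!: borel_imp_lebesgue)
  moreover have "(LINT z|lebesgue. \<theta> z *\<^sub>R m a) = m a"
    using integral_scaleR_left[of "m a" lebesgue \<theta>] Cc_integrable[OF Cc] by (simp add: integral_1)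
  ultimately show ?thesis by (simp add: eq)
qed

text \<open>For \<open>s \<noteq> a\<close> the argument has left the transition zone once
  \<open>k n\<close> reaches S / |s - a|, and from there on the value is exactly 0 or 1.\<close>

lemma step_tendsto:
  assumes k: "filterlim k at_top sequentially" and "s \<noteq> a"
  shows "(\<lambda>n. \<Psi> (k n * (s - a))) \<longlonglongrightarrow> (if a < s then 1 else 0)"
proof (rule tendsto_eventually)
  show "\<forall>\<^sub>F n in sequentially. \<Psi> (k n * (s - a)) = (if a < s then 1 else 0)"
    using filterlim_at_top[THEN iffD1, OF k, rule_format, of "S / \<bar>s - a\<bar>"]
  proof eventually_elim
    case (elim n)
    then have *: "S \<le> k n * \<bar>s - a\<bar>" using assms(2) by (simp add: field_simps)
    show ?case
    proof (cases "a < s")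
      case True
      then show ?thesis using * right by simp
    next
      case False
      then have "k n * (s - a) \<le> - S" using * assms(2) by (simp add: algebra_simps)
      then show ?thesis using False left by simp
    qed
  qed
qed

text \<open>The test function is a step at \<open>a\<close> minus a step at \<open>b\<close>. Its
  derivative is a bump at \<open>a\<close> minus a bump at \<open>b\<close>, so in the limit the
  weak identity becomes \<open>m a - m b\<close> plus the integral of \<open>g\<close> over
  \<open>{a..b}\<close>, equal to 0.\<close>

lemma du_Bois_Reymond_interior:
  fixes m g :: "real \<Rightarrow> complex"
  assumes m: "continuous_on UNIV m" "\<And>s. norm (m s) \<le> B" and g: "continuous_on UNIV g" "\<And>s. norm (g s) \<le> B"
    and ab: "0 < a" "a < b" "b < T"
    and weak: "\<And>\<eta> \<eta>' \<alpha> \<beta>. smooth \<eta> \<Longrightarrow> (\<And>s. (\<eta> has_real_derivative \<eta>' s) (at s)) \<Longrightarrow> {\<alpha>..\<beta>} \<subseteq> {0<..<T} \<Longrightarrow>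
      (\<And>s. s \<notin> {\<alpha>..\<beta>} \<Longrightarrow> \<eta> s = 0) \<Longrightarrow> (LINT s:{0<..<T}|lebesgue. \<eta>' s *\<^sub>R m s + \<eta> s *\<^sub>R g s) = 0"
  shows "m b - m a = integral {a..b} g"
proof -
  have B: "0 \<le> B" using m(2)[of 0] norm_ge_zero order_trans by blast
  have [measurable]: "m \<in> borel_measurable borel" "g \<in> borel_measurable borel" "\<theta> \<in> borel_measurable borel"
      "\<Psi> \<in> borel_measurable borel"
    using m(1) g(1) Cc_borel[OF Cc] smooth_continuous[OF smooth] by (auto intro: borel_measurable_continuous_onI)
  \<comment> \<open>Already for \<open>n = 0\<close> this puts \<open>S / k n\<close> below the
    distances of \<open>a\<close> from 0 and of \<open>b\<close> from \<open>T\<close>, so the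
    transition zones stay inside \<open>{0<..<T}\<close>.\<close>
  define k0 where "k0 = S / min a (T - b) + 1"
  define k where "k n = real n + k0" for n :: nat
  have k0: "1 \<le> k0" using S ab by (simp add: k0_def)
  have k: "0 < k n" for n using k0 by (simp add: k_def)
  have klim: "filterlim k at_top sequentially"
    by (rule filterlim_at_top_mono[OF filterlim_real_sequentially]) (use k0 in \<open>simp add: k_def\<close>)
  have kS: "S < k n * a" "S < k n * (T - b)" for n
  proof -
    have "S / min a (T - b) < k n" by (simp add: k_def k0_def)
    then have *: "S < k n * min a (T - b)" using ab by (simp add: field_simps)
    have "k n * min a (T - b) \<le> k n * a" "k n * min a (T - b) \<le> k n * (T - b)"
      using k[of n] by (auto intro: mult_left_mono)
    with * show "S < k n * a" "S < k n * (T - b)" by linarith+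
  qed
  define \<eta> where "\<eta> n s = \<Psi> (k n * (s - a)) - \<Psi> (k n * (s - b))" for n s
  define \<eta>' where "\<eta>' n s = k n * \<theta> (k n * (s - a)) - k n * \<theta> (k n * (s - b))" for n s
  have sm: "smooth (\<eta> n)" for n
    using smooth_diff[OF smooth_mult_affine[OF smooth, of 1 "- (k n * a)" "k n"]
        smooth_mult_affine[OF smooth, of 1 "- (k n * b)" "k n"]]
    by (simp add: \<eta>_def[abs_def] algebra_simps)
  have der: "(\<eta> n has_real_derivative \<eta>' n s) (at s)" for n s
  proof -
    have "((\<lambda>s. \<Psi> (k n * (s - c))) has_real_derivative \<theta> (k n * (s - c)) * k n) (at s)" for c
      by (rule DERIV_chain2[where f=\<Psi> and g="\<lambda>s. k n * (s - c)", OF deriv]) (auto intro!: derivative_eq_intros)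
    from DERIV_diff[OF this[of a] this[of b]] show ?thesis
      by (simp add: \<eta>_def[abs_def] \<eta>'_def mult.commute)
  qed
  define \<alpha> where "\<alpha> n = a - S / k n" for n
  define \<beta> where "\<beta> n = b + S / k n" for n
  have sub: "{\<alpha> n..\<beta> n} \<subseteq> {0<..<T}" for n
    using kS[of n] k[of n] by (auto simp: \<alpha>_def \<beta>_def field_simps)
       (smt (verit, best) mult.commute mult_le_cancel_left_pos right_diff_distrib')+
  \<comment> \<open>Before \<open>\<alpha> n\<close> both steps are 0; after
    \<open>\<beta> n\<close> both are 1 and cancel.\<close>
  have out: "\<eta> n s = 0 \<and> \<eta>' n s = 0" if "s \<notin> {\<alpha> n..\<beta> n}" for n s
  proof -
    have lt: "k n * (s - b) < k n * (s - a)" using k[of n] ab by simp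
    from that consider "s < \<alpha> n" | "\<beta> n < s" by fastforce
    then show ?thesis
    proof cases
      case 1
      then have "k n * s < k n * \<alpha> n" using k[of n] by simp
      also have "k n * \<alpha> n = k n * a - S" using k[of n] by (simp add: \<alpha>_def algebra_simps)
      finally have "k n * (s - a) \<le> - S" by (simp add: algebra_simps)
      then show ?thesis using lt S left zero by (simp add: \<eta>_def \<eta>'_def)
    next
      case 2
      then have "k n * \<beta> n < k n * s" using k[of n] by simp
      moreover have "k n * \<beta> n = k n * b + S" using k[of n] by (simp add: \<beta>_def algebra_simps)
      ultimately have "S \<le> k n * (s - b)" by (simp add: algebra_simps)
      then show ?thesis using lt S right zero by (simp add: \<eta>_def \<eta>'_def)
    qed
  qed
  have \<eta>_le: "\<bar>\<eta> n s\<bar> \<le> 1" for n s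
    using nonneg[of "k n * (s - a)"] le_1[of "k n * (s - a)"] nonneg[of "k n * (s - b)"] le_1[of "k n * (s - b)"]
    by (simp add: \<eta>_def abs_le_iff)
  have [measurable]: "\<eta> n \<in> borel_measurable borel" for n unfolding \<eta>_def by measurable
  have int1: "integrable lebesgue (\<lambda>s. (k n * \<theta> (k n * (s - c))) *\<^sub>R m s)" for n c
  proof (rule Bochner_Integration.integrable_bound)
    have "(\<lambda>s. \<theta> (- (k n * c) + k n *\<^sub>R s)) \<in> Cc" using k[of n] by (intro Cc_affine Cc) simp
    then have "(\<lambda>s. \<theta> (k n * (s - c))) \<in> Cc" by (simp add: algebra_simps)
    then show "integrable lebesgue (\<lambda>s. \<bar>k n * \<theta> (k n * (s - c))\<bar> * B)"
      by (intro integrable_mult_left Cc_integrable Cc_abs Cc_cmult)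
    show "AE s in lebesgue. norm ((k n * \<theta> (k n * (s - c))) *\<^sub>R m s) \<le> norm (\<bar>k n * \<theta> (k n * (s - c))\<bar> * B)"
      using m(2) B by (intro AE_I2) (simp add: abs_mult mult_left_mono)
  qed (auto intro!: borel_imp_lebesgue)
  have dom: "norm (\<eta> n s *\<^sub>R g s) \<le> B * indicator {0..T} s" for n s
  proof (cases "s \<in> {\<alpha> n..\<beta> n}")
    case True
    then have "s \<in> {0..T}" using sub[of n] by (meson greaterThanLessThan_subseteq_atLeastAtMost_iff order_refl subsetD)
    moreover have "\<bar>\<eta> n s\<bar> * norm (g s) \<le> 1 * B" using \<eta>_le g(2) by (intro mult_mono) auto
    ultimately show ?thesis by simp
  qed (use out B in simp)
  have intB: "integrable lebesgue (\<lambda>s::real. B * indicator {0..T} s)"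
    by (intro integrable_mult_right integrable_real_indicator) (auto simp: emeasure_lborel_Icc_eq)
  have int2: "integrable lebesgue (\<lambda>s. \<eta> n s *\<^sub>R g s)" for n
    by (rule Bochner_Integration.integrable_bound[OF intB])
       (use dom[of n] B in \<open>auto intro!: borel_imp_lebesgue\<close>)
  have eq: "(LINT s|lebesgue. (k n * \<theta> (k n * (s - a))) *\<^sub>R m s) - (LINT s|lebesgue. (k n * \<theta> (k n * (s - b))) *\<^sub>R m s)
      + (LINT s|lebesgue. \<eta> n s *\<^sub>R g s) = 0" for n
  proof -
    have "(LINT s:{0<..<T}|lebesgue. \<eta>' n s *\<^sub>R m s + \<eta> n s *\<^sub>R g s) = 0"
      by (rule weak[OF sm der sub]) (use out in blast)
    \<comment> \<open>Outside \<open>{0<..<T}\<close> the test function and its derivative vanish,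
      so the set integral is an integral over the whole line and can be split into three.\<close>
    moreover have "indicator {0<..<T} s *\<^sub>R (\<eta>' n s *\<^sub>R m s + \<eta> n s *\<^sub>R g s) =
        (k n * \<theta> (k n * (s - a))) *\<^sub>R m s - (k n * \<theta> (k n * (s - b))) *\<^sub>R m s + \<eta> n s *\<^sub>R g s" for s
    proof -
      have "indicator {0<..<T} s *\<^sub>R (\<eta>' n s *\<^sub>R m s + \<eta> n s *\<^sub>R g s) = \<eta>' n s *\<^sub>R m s + \<eta> n s *\<^sub>R g s"
      proof (cases "s \<in> {0<..<T}")
        case False
        then have "s \<notin> {\<alpha> n..\<beta> n}" using sub by blast
        then show ?thesis using out by simp
      qed simp
      then show ?thesis by (simp add: \<eta>'_def scaleR_diff_left)
    qed
    ultimately show ?thesis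
      using int1 int2 by (simp add: set_lebesgue_integral_def)
  qed
  have gind: "(\<lambda>n. LINT s|lebesgue. \<eta> n s *\<^sub>R g s) \<longlonglongrightarrow> (LINT s|lebesgue. indicator {a..b} s *\<^sub>R g s)"
  proof (rule integral_dominated_convergence[OF _ _ intB])
    show "AE s in lebesgue. norm (\<eta> n s *\<^sub>R g s) \<le> B * indicator {0..T} s" for n using dom by simp
    have "(\<lambda>n. \<eta> n s *\<^sub>R g s) \<longlonglongrightarrow> indicator {a..b} s *\<^sub>R g s" if "s \<noteq> a" "s \<noteq> b" for s
    proof -
      have "(\<lambda>n. \<eta> n s *\<^sub>R g s) \<longlonglongrightarrow> ((if a < s then 1 else 0) - (if b < s then 1 else 0)) *\<^sub>R g s"
        unfolding \<eta>_def by (intro tendsto_intros step_tendsto klim that)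
      then show ?thesis using that ab by (auto simp: indicator_def split: if_splits)
    qed
    then show "AE s in lebesgue. (\<lambda>n. \<eta> n s *\<^sub>R g s) \<longlonglongrightarrow> indicator {a..b} s *\<^sub>R g s"
      by (intro AE_I'[of "{a, b}"]) (auto simp: negligible_iff_null_sets[symmetric])
  qed (auto intro!: borel_imp_lebesgue)
  have "(\<lambda>n. (LINT s|lebesgue. (k n * \<theta> (k n * (s - a))) *\<^sub>R m s) - (LINT s|lebesgue. (k n * \<theta> (k n * (s - b))) *\<^sub>R m s)
      + (LINT s|lebesgue. \<eta> n s *\<^sub>R g s)) \<longlonglongrightarrow> m a - m b + (LINT s|lebesgue. indicator {a..b} s *\<^sub>R g s)"
    by (intro tendsto_intros concentrate_tendsto[OF m k klim] gind)
  then have "m a - m b + (LINT s|lebesgue. indicator {a..b} s *\<^sub>R g s) = 0"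
    unfolding eq using LIMSEQ_unique tendsto_const by blast
  moreover have "(LINT s|lebesgue. indicator {a..b} s *\<^sub>R g s) = integral {a..b} g"
  proof -
    have "set_integrable lebesgue {a..b} g"
      unfolding absolutely_integrable_on_def[symmetric]
      using continuous_on_subset[OF g(1)] by (intro absolutely_integrable_continuous_real) auto
    then show ?thesis
      by (simp add: set_lebesgue_integral_def[symmetric] set_lebesgue_integral_eq_integral(2))
  qed
  ultimately show ?thesis by (simp add: algebra_simps)
qed

text \<open>The function \<open>P\<close>, \<open>m\<close> minus the primitive of \<open>g\<close>,
  is constant on the open interval by the interior version, and its continuity on
  \<open>{0..T}\<close> extends this to both end points. That is how the value at time 0
  enters.\<close>

lemma du_Bois_Reymond:
  fixes m g :: "real \<Rightarrow> complex"
  assumes T: "0 < T" and m: "continuous_on {0..T} m" and g: "continuous_on {0..T} g"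
    and weak: "\<And>\<eta> \<eta>' \<alpha> \<beta>. smooth \<eta> \<Longrightarrow> (\<And>s. (\<eta> has_real_derivative \<eta>' s) (at s)) \<Longrightarrow> {\<alpha>..\<beta>} \<subseteq> {0<..<T} \<Longrightarrow>
      (\<And>s. s \<notin> {\<alpha>..\<beta>} \<Longrightarrow> \<eta> s = 0) \<Longrightarrow> (LINT s:{0<..<T}|lebesgue. \<eta>' s *\<^sub>R m s + \<eta> s *\<^sub>R g s) = 0"
    and t: "t \<in> {0..T}"
  shows "m t - m 0 = integral {0..t} g"
proof -
  \<comment> \<open>Clamping time to \<open>{0..T}\<close> extends \<open>m\<close> and
    \<open>g\<close> to bounded continuous functions on the line, as
    \<open>du_Bois_Reymond_interior\<close> requires.\<close>
  define r where "r s = max 0 (min T s)" for s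
  have r: "r s \<in> {0..T}" "s \<in> {0..T} \<Longrightarrow> r s = s" for s using T by (auto simp: r_def)
  have rc: "continuous_on UNIV r" unfolding r_def by (intro continuous_intros)
  have ext: "continuous_on UNIV (\<lambda>s. f (r s))" "\<exists>B. \<forall>s. norm (f (r s)) \<le> B"
    if f: "continuous_on {0..T} f" for f :: "real \<Rightarrow> complex"
  proof -
    show "continuous_on UNIV (\<lambda>s. f (r s))"
      by (rule continuous_on_compose2[OF f rc]) (use r in auto)
    have "bounded (f ` {0..T})" by (intro compact_imp_bounded compact_continuous_image f) auto
    then show "\<exists>B. \<forall>s. norm (f (r s)) \<le> B" unfolding bounded_iff using r(1) by blast
  qed
  obtain B1 where B1: "\<And>s. norm (m (r s)) \<le> B1" using ext(2)[OF m] by blast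
  obtain B2 where B2: "\<And>s. norm (g (r s)) \<le> B2" using ext(2)[OF g] by blast
  have B: "norm (m (r s)) \<le> max B1 B2" "norm (g (r s)) \<le> max B1 B2" for s
    using B1[of s] B2[of s] by auto
  define P where "P s = m s - integral {0..s} g" for s
  have gi: "g integrable_on {x..y}" if "0 \<le> x" "y \<le> T" for x y
    using that by (intro integrable_continuous_real continuous_on_subset[OF g]) auto
  have Pc: "continuous_on {0..T} P"
    unfolding P_def by (intro continuous_intros m indefinite_integral_continuous_1 gi) auto
  have P: "P a = P b" if ab: "0 < a" "a < b" "b < T" for a b
  proof -
    have "m (r b) - m (r a) = integral {a..b} (\<lambda>s. g (r s))"
    proof (rule du_Bois_Reymond_interior[OF ext(1)[OF m] B(1) ext(1)[OF g] B(2) ab])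
      fix \<eta> \<eta>' :: "real \<Rightarrow> real" and \<alpha> \<beta>
      assume "smooth \<eta>" "\<And>s. (\<eta> has_real_derivative \<eta>' s) (at s)" "{\<alpha>..\<beta>} \<subseteq> {0<..<T}" "\<And>s. s \<notin> {\<alpha>..\<beta>} \<Longrightarrow> \<eta> s = 0"
      then have "(LINT s:{0<..<T}|lebesgue. \<eta>' s *\<^sub>R m s + \<eta> s *\<^sub>R g s) = 0" by (rule weak)
      moreover have "(LINT s:{0<..<T}|lebesgue. \<eta>' s *\<^sub>R m (r s) + \<eta> s *\<^sub>R g (r s)) =
          (LINT s:{0<..<T}|lebesgue. \<eta>' s *\<^sub>R m s + \<eta> s *\<^sub>R g s)"
        by (intro set_lebesgue_integral_cong) (auto simp: r(2))
      ultimately show "(LINT s:{0<..<T}|lebesgue. \<eta>' s *\<^sub>R m (r s) + \<eta> s *\<^sub>R g (r s)) = 0" by simp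
    qed
    moreover have "integral {a..b} (\<lambda>s. g (r s)) = integral {a..b} g"
      by (rule Henstock_Kurzweil_Integration.integral_cong) (use ab r(2) in auto)
    moreover have "integral {0..a} g + integral {a..b} g = integral {0..b} g"
      using ab by (intro Henstock_Kurzweil_Integration.integral_combine gi) auto
    ultimately show ?thesis using ab r(2)[of a] r(2)[of b] by (simp add: P_def algebra_simps)
  qed
  have "P x = P (T / 2)" if "x \<in> {0<..<T}" for x
  proof -
    consider "x < T / 2" | "x = T / 2" | "T / 2 < x" by linarith
    then show ?thesis
      by cases (use that T P[of x "T / 2"] P[of "T / 2" x] in auto)
  qed
  note interior = this
  have cl: "closure {0<..<T} = {0..T}" using T by simp
  have const: "P x = P (T / 2)" if "x \<in> {0..T}" for x
    by (rule continuous_constant_on_closure[of "{0<..<T}" P]) (unfold cl, (fact Pc interior that)+)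
  have "0 \<in> {0..T}" using T by simp
  then have "P t = P 0" by (rule trans[OF const[OF t] const[symmetric]])
  then show ?thesis by (simp add: P_def algebra_simps)
qed
end

section \<open>The equation tested with a function of space\<close>

lemma CL2_pairing_continuous:
  assumes v: "v \<in> CL2 T" and \<rho>: "\<rho> \<in> Cc"
  shows "continuous_on {0..T} (\<lambda>t. LINT x|lebesgue. \<rho> x *\<^sub>R v t x)"
proof -
  \<comment> \<open>Pairing with \<open>\<rho>\<close> is convolution with the reflected kernel,
    evaluated at 0.\<close>
  have "continuous_on {0..T} (\<lambda>t. case (t, 0) of (t, x) \<Rightarrow> convolution (v t) (\<lambda>y. \<rho> (0 - y)) x)"
    by (rule continuous_on_compose2[OF continuous_on_convolution_CL2[OF v Cc_reflect[OF \<rho>, of 0]]])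
       (auto intro!: continuous_intros)
  then show ?thesis by (simp add: convolution_def)
qed

text \<open>The mollifier is the source of the smooth step for \<open>du_Bois_Reymond\<close>.
  Boundedness of \<open>q\<close> puts \<open>q u\<close> into \<open>CL2 T\<close>, so that the
  integrand in time is continuous.\<close>

lemma cauchy_solution_weak:
  fixes u :: "real \<Rightarrow> 'a::euclidean_space \<Rightarrow> complex"
  assumes T: "0 < T" and sol: "cauchy_solution T q u0 u" and \<psi>: "friedrichs_mollifier (\<psi> :: 'a \<Rightarrow> real)"
    and q: "q \<in> borel_measurable lebesgue" "AE x in lebesgue. \<bar>q x\<bar> \<le> M" "0 \<le> M"
    and \<rho>: "smooth \<rho>" "\<rho> \<in> Cc" and t: "t \<in> {0..T}"
  shows "(LINT x|lebesgue. \<rho> x *\<^sub>R u t x) - (LINT x|lebesgue. \<rho> x *\<^sub>R u 0 x) =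
    integral {0..t} (\<lambda>s. (LINT x|lebesgue. lap \<rho> x *\<^sub>R u s x) + (LINT x|lebesgue. \<rho> x *\<^sub>R (q x *\<^sub>R u s x)))"
proof -
  obtain \<Psi> \<theta> S where "smooth_step \<Psi> \<theta> S"
    using smooth_step_exists[OF \<psi>] unfolding smooth_step_def by metis
  then interpret smooth_step \<Psi> \<theta> S .
  have u: "u \<in> CL2 T" using sol by (simp add: cauchy_solution_def)
  note qu = CL2_mult_bounded[OF u q]
  note L = Cc_lap[OF \<rho>]
  show ?thesis
  proof (rule du_Bois_Reymond[OF T CL2_pairing_continuous[OF u \<rho>(2)] _ _ t])
    show "continuous_on {0..T} (\<lambda>s. (LINT x|lebesgue. lap \<rho> x *\<^sub>R u s x) + (LINT x|lebesgue. \<rho> x *\<^sub>R (q x *\<^sub>R u s x)))"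
      by (intro continuous_on_add CL2_pairing_continuous u qu L \<rho>)
    fix \<eta> \<eta>' :: "real \<Rightarrow> real" and \<alpha> \<beta>
    assume \<eta>: "smooth \<eta>" "\<And>s. (\<eta> has_real_derivative \<eta>' s) (at s)" "{\<alpha>..\<beta>} \<subseteq> {0<..<T}" "\<And>s. s \<notin> {\<alpha>..\<beta>} \<Longrightarrow> \<eta> s = 0"
    let ?\<phi> = "\<lambda>z. \<eta> (fst z) * \<rho> (snd z)"
    let ?g = "\<lambda>s. (LINT x|lebesgue. lap \<rho> x *\<^sub>R u s x) + (LINT x|lebesgue. \<rho> x *\<^sub>R (q x *\<^sub>R u s x))"
    have "(LINT s:{0<..<T}|lebesgue. LINT x|lebesgue.
           (- dt ?\<phi> (s, x) - laplace ?\<phi> (s, x) - q x * ?\<phi> (s, x)) *\<^sub>R u s x) = 0"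
      by (rule bspec[OF _ tensor_test_function[OF \<eta>(1,4,3) \<rho>]]) (use sol in \<open>simp add: cauchy_solution_def\<close>)
    \<comment> \<open>Pulling out the common minus sign of the distributional formulation leaves the
      form in which \<open>du_Bois_Reymond\<close> takes its hypothesis.\<close>
    moreover have "(LINT x|lebesgue. (- dt ?\<phi> (s, x) - laplace ?\<phi> (s, x) - q x * ?\<phi> (s, x)) *\<^sub>R u s x) =
        - (\<eta>' s *\<^sub>R (LINT x|lebesgue. \<rho> x *\<^sub>R u s x) + \<eta> s *\<^sub>R ?g s)" if s: "s \<in> {0<..<T}" for s
    proof -
      have us: "u s \<in> L2" "(\<lambda>x. q x *\<^sub>R u s x) \<in> L2"
        using CL2_imp_L2[OF u] CL2_imp_L2[OF qu] s by auto
      note int = integrable_Cc_L2(1)[OF \<rho>(2) us(1)] integrable_Cc_L2(1)[OF L us(1)] integrable_Cc_L2(1)[OF \<rho>(2) us(2)]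
      have "(- dt ?\<phi> (s, x) - laplace ?\<phi> (s, x) - q x * ?\<phi> (s, x)) *\<^sub>R u s x =
          - (\<eta>' s *\<^sub>R (\<rho> x *\<^sub>R u s x) + (\<eta> s *\<^sub>R (lap \<rho> x *\<^sub>R u s x) + \<eta> s *\<^sub>R (\<rho> x *\<^sub>R (q x *\<^sub>R u s x))))" for x
        unfolding dt_tensor[OF \<eta>(1) \<rho>(1)] laplace_tensor[OF \<eta>(1) \<rho>(1)] partial_deriv_real[OF \<eta>(2)]
        by (simp add: scaleR_diff_left mult_ac)
      then have "(LINT x|lebesgue. (- dt ?\<phi> (s, x) - laplace ?\<phi> (s, x) - q x * ?\<phi> (s, x)) *\<^sub>R u s x) =
          (LINT x|lebesgue. - (\<eta>' s *\<^sub>R (\<rho> x *\<^sub>R u s x) + (\<eta> s *\<^sub>R (lap \<rho> x *\<^sub>R u s x) + \<eta> s *\<^sub>R (\<rho> x *\<^sub>R (q x *\<^sub>R u s x)))))"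
        by (intro Bochner_Integration.integral_cong refl)
      also have "\<dots> = - (\<eta>' s *\<^sub>R (LINT x|lebesgue. \<rho> x *\<^sub>R u s x) + (\<eta> s *\<^sub>R (LINT x|lebesgue. lap \<rho> x *\<^sub>R u s x)
          + \<eta> s *\<^sub>R (LINT x|lebesgue. \<rho> x *\<^sub>R (q x *\<^sub>R u s x))))"
        using int by (simp del: scaleR_scaleR minus_add_distrib)
      finally show ?thesis by (simp only: scaleR_add_right)
    qed
    ultimately have "(LINT s:{0<..<T}|lebesgue. - (\<eta>' s *\<^sub>R (LINT x|lebesgue. \<rho> x *\<^sub>R u s x) + \<eta> s *\<^sub>R ?g s)) = 0"
      by (subst (asm) set_lebesgue_integral_cong[of _ _ _ "\<lambda>s. - (\<eta>' s *\<^sub>R (LINT x|lebesgue. \<rho> x *\<^sub>R u s x) + \<eta> s *\<^sub>R ?g s)"])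
         auto
    then show "(LINT s:{0<..<T}|lebesgue. \<eta>' s *\<^sub>R (LINT x|lebesgue. \<rho> x *\<^sub>R u s x) + \<eta> s *\<^sub>R ?g s) = 0"
      by (simp add: set_lebesgue_integral_def del: minus_add_distrib)
  qed
qed

section \<open>Energy estimate and convergence\<close>
lemma CL2_norm_bound:
  assumes "v \<in> CL2 T"
  obtains B where "0 \<le> B" "\<And>t. t \<in> {0..T} \<Longrightarrow> L2_norm (v t) \<le> B"
proof -
  have "bounded ((\<lambda>t. L2_norm (v t)) ` {0..T})"
    by (intro compact_imp_bounded compact_continuous_image CL2_continuous_norm assms) auto
  then obtain B where "\<forall>y\<in>(\<lambda>t. L2_norm (v t)) ` {0..T}. norm y \<le> B" unfolding bounded_iff by blast
  then have "L2_norm (v t) \<le> max B 0" if "t \<in> {0..T}" for t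
    using that L2_norm_nonneg[of "v t"] by (force simp: max_def)
  then show ?thesis using that[of "max B 0"] by simp
qed

text \<open>Clamping the time variable extends \<open>f\<close> continuously from the strip to the
  whole space, hence to a Borel function; the indicator then erases the extension. The second factor
  is the completed measure because the spatial integrals are taken over it.\<close>

lemma continuous_on_Icc_times_measurable:
  fixes f :: "real \<times> 'a::euclidean_space \<Rightarrow> real"
  assumes f: "continuous_on ({0..T} \<times> UNIV) f" and T: "0 \<le> t" "t \<le> T"
  shows "(\<lambda>z. indicator {0..t} (fst z) * f z) \<in> borel_measurable (lborel \<Otimes>\<^sub>M lebesgue)"
proof -
  define r where "r s = max 0 (min T s)" for s
  have "continuous_on UNIV (\<lambda>z. f (r (fst z), snd z))"
    by (rule continuous_on_compose2[OF f]) (use T in \<open>auto simp: r_def intro!: continuous_intros\<close>)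
  then have "(\<lambda>z. f (r (fst z), snd z)) \<in> borel_measurable (borel \<Otimes>\<^sub>M borel)"
    by (simp add: borel_prod borel_measurable_continuous_onI)
  moreover have "(\<lambda>z. z) \<in> (lborel :: real measure) \<Otimes>\<^sub>M (lebesgue :: 'a measure) \<rightarrow>\<^sub>M borel \<Otimes>\<^sub>M borel"
  proof -
    have [measurable]: "(\<lambda>x. x) \<in> (lebesgue :: 'a measure) \<rightarrow>\<^sub>M borel" by (simp add: measurable_completion)
    have "(\<lambda>z. (fst z, snd z)) \<in> (lborel :: real measure) \<Otimes>\<^sub>M (lebesgue :: 'a measure) \<rightarrow>\<^sub>M borel \<Otimes>\<^sub>M borel"
      by (intro measurable_Pair measurable_compose[OF measurable_fst] measurable_compose[OF measurable_snd]) simp_all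
    then show ?thesis by simp
  qed
  ultimately have [measurable]: "(\<lambda>z. f (r (fst z), snd z)) \<in> borel_measurable (lborel \<Otimes>\<^sub>M lebesgue)"
    by (rule measurable_compose[rotated])
  have "(\<lambda>z. indicator {0..t} (fst z) * f (r (fst z), snd z)) \<in> borel_measurable (lborel \<Otimes>\<^sub>M lebesgue)"
    by measurable
  also have "(\<lambda>z. indicator {0..t} (fst z) * f (r (fst z), snd z)) = (\<lambda>z. indicator {0..t} (fst z) * f z)"
    using T by (auto simp: fun_eq_iff indicator_def r_def)
  finally show ?thesis .
qed

lemma integral_indicator_eq:
  fixes f :: "real \<Rightarrow> real"
  assumes "continuous_on {a..b} f"
  shows "integrable lborel (\<lambda>s. indicator {a..b} s * f s)"
    "(LINT s|lborel. indicator {a..b} s * f s) = integral {a..b} f"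
proof -
  have si: "set_integrable lborel {a..b} f" by (rule borel_integrable_atLeastAtMost'[OF assms])
  then show "integrable lborel (\<lambda>s. indicator {a..b} s * f s)" by (simp add: set_integrable_def)
  show "(LINT s|lborel. indicator {a..b} s * f s) = integral {a..b} f"
    using set_borel_integral_eq_integral(2)[OF si] by (simp add: set_lebesgue_integral_def)
qed

text \<open>The identity \<open>weak\<close> is assumed for all kernels because it is used with the
  kernel \<open>\<rho>(x - y)\<close> in \<open>y\<close> for every \<open>x\<close>. The unit mass
  of |\<rho>| makes convolution a contraction, so the right-hand side is free of
  \<open>\<rho>\<close>.\<close>

lemma mollified_energy:
  fixes v F :: "real \<Rightarrow> 'a::euclidean_space \<Rightarrow> complex"
  assumes v: "v \<in> CL2 T" and F: "F \<in> CL2 T"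
    and \<rho>: "smooth \<rho>" "\<rho> \<in> Cc" "(LINT x|lebesgue. \<bar>\<rho> x\<bar>) = 1"
    and weak: "\<And>\<rho> t. smooth \<rho> \<Longrightarrow> \<rho> \<in> Cc \<Longrightarrow> t \<in> {0..T} \<Longrightarrow>
      (LINT x|lebesgue. \<rho> x *\<^sub>R v t x) - (LINT x|lebesgue. \<rho> x *\<^sub>R v 0 x) =
      integral {0..t} (\<lambda>s. (LINT x|lebesgue. lap \<rho> x *\<^sub>R v s x) + (LINT x|lebesgue. \<rho> x *\<^sub>R F s x))"
    and t: "t \<in> {0..T}"
  shows "(L2_norm (convolution (v t) \<rho>))\<^sup>2 \<le> (L2_norm (v 0))\<^sup>2 + integral {0..t} (\<lambda>s. (L2_norm (v s))\<^sup>2 + (L2_norm (F s))\<^sup>2)"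
proof -
  interpret pair_sigma_finite "lborel :: real measure" "lebesgue :: 'a measure"
    by (simp add: pair_sigma_finite_def sigma_finite_lebesgue lborel.sigma_finite_measure_axioms)
  note L = Cc_lap[OF \<rho>(1,2)]
  have vL2: "v s \<in> L2" "F s \<in> L2" if "s \<in> {0..T}" for s using that CL2_imp_L2 v F by auto
  define V where "V s = convolution (v s) \<rho>" for s
  define Lv where "Lv s = convolution (v s) (lap \<rho>)" for s
  define Fr where "Fr s = convolution (F s) \<rho>" for s
  define G where "G s x = Lv s x + Fr s x" for s x
  have VL2: "V s \<in> L2" "Lv s \<in> L2" "Fr s \<in> L2" "G s \<in> L2" if "s \<in> {0..T}" for s
    unfolding V_def Lv_def Fr_def G_def[abs_def] using vL2[OF that] by (intro L2_add convolution_Young(1) \<rho> L; simp)+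
  have Vle: "L2_norm (V s) \<le> L2_norm (v s)" "L2_norm (Fr s) \<le> L2_norm (F s)" if "s \<in> {0..T}" for s
    unfolding V_def Fr_def using convolution_Young(2)[OF vL2(1)[OF that] \<rho>(2)] convolution_Young(2)[OF vL2(2)[OF that] \<rho>(2)]
    by (simp_all add: \<rho>(3))
  have Vc: "continuous_on ({0..T} \<times> UNIV) (\<lambda>z. V (fst z) (snd z))"
    and Gc: "continuous_on ({0..T} \<times> UNIV) (\<lambda>z. G (fst z) (snd z))"
    unfolding V_def G_def Lv_def Fr_def
    using continuous_on_convolution_CL2[OF v \<rho>(2)] continuous_on_convolution_CL2[OF v L] continuous_on_convolution_CL2[OF F \<rho>(2)]
    by (auto simp: split_beta intro: continuous_on_add)
  have slice: "continuous_on {0..T} (\<lambda>s. V s x)" "continuous_on {0..T} (\<lambda>s. G s x)" for x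
  proof -
    have "continuous_on {0..T} (\<lambda>s. (s, x))" "(\<lambda>s. (s, x)) ` {0..T} \<subseteq> {0..T} \<times> UNIV"
      by (auto intro!: continuous_intros)
    from continuous_on_compose2[OF Vc this] continuous_on_compose2[OF Gc this]
    show "continuous_on {0..T} (\<lambda>s. V s x)" "continuous_on {0..T} (\<lambda>s. G s x)" by simp_all
  qed
  have int: "V s x = V 0 x + integral {0..s} (\<lambda>s. G s x)" if s: "s \<in> {0..T}" for s x
  proof -
    have sm: "smooth (\<lambda>y. \<rho> (x - y))"
      using smooth_mult_affine[OF \<rho>(1), of 1 x "-1"] by simp
    show ?thesis
      using weak[OF sm Cc_reflect[OF \<rho>(2)] s]
      by (simp add: V_def G_def Lv_def Fr_def convolution_def lap_reflect[OF \<rho>(1)] algebra_simps)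
  qed
  have der: "((\<lambda>s. V s x) has_vector_derivative G s x) (at s within {0..T})" if s: "s \<in> {0..T}" for s x
  proof -
    have "((\<lambda>s. V 0 x + integral {0..s} (\<lambda>s. G s x)) has_vector_derivative 0 + G s x) (at s within {0..T})"
      by (intro has_vector_derivative_add has_vector_derivative_const integral_has_vector_derivative slice s)
    then have "((\<lambda>s. V 0 x + integral {0..s} (\<lambda>s. G s x)) has_vector_derivative G s x) (at s within {0..T})" by simp
    then show ?thesis
      by (rule has_vector_derivative_transform[OF s int, rotated])
  qed
  have ftc: "(LINT s|lborel. indicator {0..t} s * (2 * (V s x \<bullet> G s x))) = (norm (V t x))\<^sup>2 - (norm (V 0 x))\<^sup>2" for x
  proof -
    have "((\<lambda>s. V s x \<bullet> V s x) has_vector_derivative (2 * (V s x \<bullet> G s x))) (at s within {0..t})" if "0 \<le> s" "s \<le> t" for s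
    proof -
      have "((\<lambda>s. V s x) has_vector_derivative G s x) (at s within {0..t})"
        by (rule has_vector_derivative_within_subset[OF der]) (use that t in auto)
      from bounded_bilinear.has_vector_derivative[OF bounded_bilinear_inner this this]
      show ?thesis by (simp add: inner_commute)
    qed
    then have "integral\<^sup>L lborel (\<lambda>s. indicator {0..t} s *\<^sub>R (2 * (V s x \<bullet> G s x))) = V t x \<bullet> V t x - V 0 x \<bullet> V 0 x"
      using t by (intro integral_FTC_atLeastAtMost continuous_intros continuous_on_subset[OF slice(1)] continuous_on_subset[OF slice(2)]) auto
    then show ?thesis by (simp add: power2_norm_eq_inner)
  qed
  \<comment> \<open>The constants \<open>Bv\<close>, \<open>BF\<close> and \<open>BL\<close> serve
    integrability for Fubini's theorem: \<open>C\<close> depends on \<open>\<rho>\<close> through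
    its Laplacian, but it does not enter the estimate.\<close>
  obtain Bv where Bv: "0 \<le> Bv" "\<And>s. s \<in> {0..T} \<Longrightarrow> L2_norm (v s) \<le> Bv" using CL2_norm_bound[OF v] by blast
  obtain BF where BF: "0 \<le> BF" "\<And>s. s \<in> {0..T} \<Longrightarrow> L2_norm (F s) \<le> BF" using CL2_norm_bound[OF F] by blast
  define BL where "BL = (LINT x|lebesgue. \<bar>lap \<rho> x\<bar>)"
  have BL: "0 \<le> BL" by (simp add: BL_def)
  define C where "C = 2 * (Bv * (BL * Bv + BF))"
  have C: "0 \<le> C" using Bv BF BL by (simp add: C_def)
  have GC: "(LINT x|lebesgue. \<bar>2 * (V s x \<bullet> G s x)\<bar>) \<le> C" if s: "s \<in> {0..T}" for s
  proof -
    have "L2_norm (Lv s) \<le> BL * L2_norm (v s)"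
      unfolding Lv_def BL_def by (rule convolution_Young(2)[OF vL2(1)[OF s] L])
    also have "\<dots> \<le> BL * Bv" using Bv(2)[OF s] BL by (rule mult_left_mono)
    finally have "L2_norm (G s) \<le> BL * Bv + BF"
      using L2_norm_triangle[OF VL2(2,3)[OF s]] Vle(2)[OF s] BF(2)[OF s] unfolding G_def by linarith
    then have "L2_norm (V s) * L2_norm (G s) \<le> Bv * (BL * Bv + BF)"
      using Vle(1)[OF s] Bv by (intro mult_mono) (auto simp: L2_norm_nonneg intro: order_trans[OF _ Bv(2)[OF s]])
    moreover have "(LINT x|lebesgue. \<bar>V s x \<bullet> G s x\<bar>) \<le> (LINT x|lebesgue. norm (V s x) * norm (G s x))"
      using L2_norm_mult(1)[OF VL2(1,4)[OF s]] L2_integrable_inner(1)[OF VL2(1,4)[OF s]]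
      by (intro integral_mono) (auto simp: Cauchy_Schwarz_ineq2)
    ultimately show ?thesis
      using L2_norm_mult(2)[OF VL2(1,4)[OF s]] by (simp add: C_def abs_mult)
  qed
  define H where "H s x = indicator {0..t} s * (2 * (V s x \<bullet> G s x))" for s x
  have Hm: "case_prod H \<in> borel_measurable (lborel \<Otimes>\<^sub>M lebesgue)"
  proof -
    have "(\<lambda>z. indicator {0..t} (fst z) * (2 * (V (fst z) (snd z) \<bullet> G (fst z) (snd z)))) \<in> borel_measurable (lborel \<Otimes>\<^sub>M lebesgue)"
      by (rule continuous_on_Icc_times_measurable[where T=T]) (use t in \<open>auto intro!: continuous_intros Vc Gc\<close>)
    then show ?thesis by (simp add: H_def split_beta')
  qed
  have Hint: "integrable (lborel \<Otimes>\<^sub>M lebesgue) (case_prod H)"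
  proof (rule Fubini_integrable[OF Hm])
    show "AE s in lborel. integrable lebesgue (\<lambda>x. case (s, x) of (s, x) \<Rightarrow> H s x)"
    proof (intro AE_I2)
      fix s
      show "integrable lebesgue (\<lambda>x. case (s, x) of (s, x) \<Rightarrow> H s x)"
        using L2_integrable_inner(1)[OF VL2(1,4), of s] t by (cases "s \<in> {0..t}") (auto simp: H_def)
    qed
    have m: "(\<lambda>s. LINT x|lebesgue. norm (case (s, x) of (s, x) \<Rightarrow> H s x)) \<in> borel_measurable lborel"
      by (rule sigma_finite_measure.borel_measurable_lebesgue_integral[OF sigma_finite_lebesgue])
         (use Hm in \<open>simp add: split_beta'\<close>)
    show "integrable lborel (\<lambda>s. LINT x|lebesgue. norm (case (s, x) of (s, x) \<Rightarrow> H s x))"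
    proof (rule Bochner_Integration.integrable_bound[OF _ m])
      show "integrable lborel (\<lambda>s. indicator {0..t} s * C)"
        by (rule integral_indicator_eq(1)) (rule continuous_on_const)
      have "norm (LINT x|lebesgue. norm (case (s, x) of (s, x) \<Rightarrow> H s x)) \<le> norm (indicator {0..t} s * C)" for s
      proof (cases "s \<in> {0..t}")
        case True
        then have "s \<in> {0..T}" using t by auto
        from GC[OF this] show ?thesis using True C by (simp add: H_def)
      qed (simp add: H_def)
      then show "AE s in lborel. norm (LINT x|lebesgue. norm (case (s, x) of (s, x) \<Rightarrow> H s x)) \<le> norm (indicator {0..t} s * C)"
        by simp
    qed
  qed
  have t0: "0 \<in> {0..T}" using t by auto
  have "(L2_norm (V t))\<^sup>2 - (L2_norm (V 0))\<^sup>2 = (LINT x|lebesgue. (norm (V t x))\<^sup>2 - (norm (V 0 x))\<^sup>2)"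
    unfolding L2_norm_power2 using L2_integrable[OF VL2(1)[OF t]] L2_integrable[OF VL2(1)[OF t0]] by simp
  also have "\<dots> = (LINT x|lebesgue. LINT s|lborel. H s x)"
    by (simp only: H_def ftc)
  also have "\<dots> = (LINT s|lborel. LINT x|lebesgue. H s x)"
    by (rule Fubini_integral[OF Hint])
  also have "\<dots> \<le> (LINT s|lborel. indicator {0..t} s * ((L2_norm (v s))\<^sup>2 + (L2_norm (F s))\<^sup>2))"
  proof (rule integral_mono)
    show "integrable lborel (\<lambda>s. LINT x|lebesgue. H s x)"
      using integrable_fst'[OF Hint] by simp
    show "integrable lborel (\<lambda>s. indicator {0..t} s * ((L2_norm (v s))\<^sup>2 + (L2_norm (F s))\<^sup>2))"
      using t by (intro integral_indicator_eq(1) continuous_intros continuous_on_subset[OF CL2_continuous_norm[OF v]]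
        continuous_on_subset[OF CL2_continuous_norm[OF F]]) auto
    fix s
    show "(LINT x|lebesgue. H s x) \<le> indicator {0..t} s * ((L2_norm (v s))\<^sup>2 + (L2_norm (F s))\<^sup>2)"
    proof (cases "s \<in> {0..t}")
      case True
      then have s: "s \<in> {0..T}" using t by auto
      have "(LINT x|lebesgue. H s x) = 2 * ((LINT x|lebesgue. V s x \<bullet> Lv s x) + (LINT x|lebesgue. V s x \<bullet> Fr s x))"
        using True L2_integrable_inner(1)[OF VL2(1,2)[OF s]] L2_integrable_inner(1)[OF VL2(1,3)[OF s]]
        by (simp add: H_def G_def inner_add_right)
      moreover have "(LINT x|lebesgue. V s x \<bullet> Lv s x) \<le> 0"
        unfolding V_def Lv_def by (rule convolution_lap_nonpos[OF vL2(1)[OF s] \<rho>(1,2)])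
      moreover have "2 * (LINT x|lebesgue. V s x \<bullet> Fr s x) \<le> (L2_norm (v s))\<^sup>2 + (L2_norm (F s))\<^sup>2"
      proof -
        have "2 * (LINT x|lebesgue. V s x \<bullet> Fr s x) \<le> 2 * L2_norm (V s) * L2_norm (Fr s)"
          using L2_integrable_inner(2)[OF VL2(1,3)[OF s]] by simp
        also have "\<dots> \<le> (L2_norm (V s))\<^sup>2 + (L2_norm (Fr s))\<^sup>2" by (rule sum_squares_bound)
        also have "\<dots> \<le> (L2_norm (v s))\<^sup>2 + (L2_norm (F s))\<^sup>2"
          by (intro add_mono power_mono Vle[OF s] L2_norm_nonneg)
        finally show ?thesis .
      qed
      ultimately show ?thesis using True by simp
    qed (simp add: H_def)
  qed
  also have "\<dots> = integral {0..t} (\<lambda>s. (L2_norm (v s))\<^sup>2 + (L2_norm (F s))\<^sup>2)"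
    using t by (intro integral_indicator_eq(2) continuous_intros continuous_on_subset[OF CL2_continuous_norm[OF v]]
        continuous_on_subset[OF CL2_continuous_norm[OF F]]) auto
  finally have "(L2_norm (V t))\<^sup>2 - (L2_norm (V 0))\<^sup>2 \<le> integral {0..t} (\<lambda>s. (L2_norm (v s))\<^sup>2 + (L2_norm (F s))\<^sup>2)" .
  moreover have "(L2_norm (V 0))\<^sup>2 \<le> (L2_norm (v 0))\<^sup>2"
    by (intro power_mono Vle t0 L2_norm_nonneg)
  ultimately show ?thesis unfolding V_def by linarith
qed

text \<open>With kernels of width 1/(n + 1) the right-hand side of \<open>mollified_energy\<close>
  is the same for all \<open>n\<close>, so only the left-hand side has to pass to the limit.\<close>

lemma energy_estimate:
  fixes v F :: "real \<Rightarrow> 'a::euclidean_space \<Rightarrow> complex"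
  assumes \<psi>: "friedrichs_mollifier (\<psi> :: 'a \<Rightarrow> real)" and v: "v \<in> CL2 T" and F: "F \<in> CL2 T"
    and weak: "\<And>\<rho> t. smooth \<rho> \<Longrightarrow> \<rho> \<in> Cc \<Longrightarrow> t \<in> {0..T} \<Longrightarrow>
      (LINT x|lebesgue. \<rho> x *\<^sub>R v t x) - (LINT x|lebesgue. \<rho> x *\<^sub>R v 0 x) =
      integral {0..t} (\<lambda>s. (LINT x|lebesgue. lap \<rho> x *\<^sub>R v s x) + (LINT x|lebesgue. \<rho> x *\<^sub>R F s x))"
    and t: "t \<in> {0..T}"
  shows "(L2_norm (v t))\<^sup>2 \<le> (L2_norm (v 0))\<^sup>2 + integral {0..t} (\<lambda>s. (L2_norm (v s))\<^sup>2 + (L2_norm (F s))\<^sup>2)"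
proof -
  note \<psi>' = friedrichs_mollifierD[OF \<psi>]
  interpret nonneg_mollifier \<psi> by unfold_locales (use \<psi>' in auto)
  let ?c = "\<lambda>n. inverse (real (Suc n))"
  have c: "0 < ?c n" "?c \<longlonglongrightarrow> 0" for n by (simp, rule LIMSEQ_inverse_real_of_nat)
  note D = dilate_Cc[OF Cc c(1)]
  have vt: "v t \<in> L2" using CL2_imp_L2[OF v t] .
  have "(\<lambda>n. L2_norm (convolution (v t) (dilate \<psi> (?c n)))) \<longlonglongrightarrow> L2_norm (v t)"
    by (rule L2_norm_tendsto[OF vt always_eventually mollify_tendsto[OF vt c]])
       (use convolution_Young(1)[OF vt D] in blast)
  then have "(\<lambda>n. (L2_norm (convolution (v t) (dilate \<psi> (?c n))))\<^sup>2) \<longlonglongrightarrow> (L2_norm (v t))\<^sup>2"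
    by (intro tendsto_intros)
  moreover have "(L2_norm (convolution (v t) (dilate \<psi> (?c n))))\<^sup>2
      \<le> (L2_norm (v 0))\<^sup>2 + integral {0..t} (\<lambda>s. (L2_norm (v s))\<^sup>2 + (L2_norm (F s))\<^sup>2)" for n
  proof (rule mollified_energy[OF v F _ D _ weak t])
    show "smooth (dilate \<psi> (?c n))"
      using smooth_mult_affine[OF \<psi>'(1), of "inverse (?c n ^ DIM('a))" 0 "inverse (?c n)"]
      by (simp add: dilate_def[abs_def] divide_inverse mult.commute del: of_nat_Suc)
    have "(LINT x|lebesgue. dilate \<psi> (?c n) x) = 1"
      using integral_dilate[OF c(1), of n 0] lebesgue_integral_reflect_borel[OF Cc_borel[OF D], of n 0] by simp
    then show "(LINT x|lebesgue. \<bar>dilate \<psi> (?c n) x\<bar>) = 1"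
      using dilate_nonneg[OF c(1)] by (simp del: of_nat_Suc)
  qed
  ultimately show ?thesis by (intro LIMSEQ_le_const2) auto
qed

text \<open>The majorant \<open>Z\<close> is differentiable although \<open>y\<close> is merely
  continuous. The derivative of \<open>exp (- A * s) * Z s\<close> is
  \<open>exp (- A * s) * (A * (y s - Z s))\<close>, which is nonpositive by the hypothesis.\<close>

lemma Gronwall_integral:
  fixes y :: "real \<Rightarrow> real"
  assumes y: "continuous_on {0..T} y" and A: "0 \<le> A" and a: "0 \<le> a"
    and le: "\<And>t. t \<in> {0..T} \<Longrightarrow> y t \<le> a + A * integral {0..t} y" and t: "t \<in> {0..T}"
  shows "y t \<le> a * exp (A * T)"
proof -
  define Z where "Z s = a + A * integral {0..s} y" for s
  have Zc: "continuous_on {0..T} Z"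
    unfolding Z_def by (intro continuous_intros indefinite_integral_continuous_1 integrable_continuous_real y)
  have Zd: "(Z has_real_derivative A * y s) (at s)" if "0 < s" "s < T" for s
  proof -
    have "((\<lambda>s. integral {0..s} y) has_real_derivative y s) (at s within {0..T})"
      by (rule integral_has_real_derivative[OF y]) (use that in auto)
    then have "((\<lambda>s. integral {0..s} y) has_real_derivative y s) (at s)"
      using that by (simp add: at_within_Icc_at)
    then show ?thesis unfolding Z_def by (auto intro!: derivative_eq_intros)
  qed
  have "exp (- A * t) * Z t \<le> exp (- A * 0) * Z 0"
  proof (rule DERIV_nonpos_imp_decreasing_open[of 0 t "\<lambda>s. exp (- A * s) * Z s"])
    show "0 \<le> t" using t by simp
    show "continuous_on {0..t} (\<lambda>s. exp (- A * s) * Z s)"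
      using t by (intro continuous_intros continuous_on_subset[OF Zc]) auto
    fix s assume s: "0 < s" "s < t"
    have "((\<lambda>s. exp (- A * s) * Z s) has_real_derivative exp (- A * s) * (A * (y s - Z s))) (at s)"
      using Zd[of s] s t by (auto intro!: derivative_eq_intros simp: algebra_simps)
    moreover have "exp (- A * s) * (A * (y s - Z s)) \<le> 0"
      using le[of s] s t A by (intro mult_nonneg_nonpos) (auto simp: Z_def)
    ultimately show "\<exists>d. ((\<lambda>s. exp (- A * s) * Z s) has_real_derivative d) (at s) \<and> d \<le> 0" by blast
  qed
  then have "Z t \<le> a * exp (A * t)" by (simp add: Z_def exp_minus field_simps)
  also have "\<dots> \<le> a * exp (A * T)" using t A a by (intro mult_left_mono) (auto intro: mult_left_mono)
  finally show ?thesis using le[OF t] by (simp add: Z_def)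
qed

section \<open>Comparison of solutions with different coefficients, and the limit\<close>

lemma Linf_bound:
  assumes "q \<in> Linf"
  obtains M where "0 \<le> M" "AE x in lebesgue. \<bar>q x\<bar> \<le> M"
proof -
  have fin: "esssup lebesgue (\<lambda>x. ereal \<bar>q x\<bar>) < \<infinity>" using assms by (simp add: Linf_def)
  then obtain M where "esssup lebesgue (\<lambda>x. ereal \<bar>q x\<bar>) \<le> ereal M"
    by (cases "esssup lebesgue (\<lambda>x. ereal \<bar>q x\<bar>)") auto
  \<comment> \<open>The maximum with 0 secures a nonnegative bound without a discussion of the sign
    of the essential supremum.\<close>
  then have imp: "ereal \<bar>q x\<bar> \<le> esssup lebesgue (\<lambda>x. ereal \<bar>q x\<bar>) \<Longrightarrow> \<bar>q x\<bar> \<le> max M 0" for x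
    using order_trans ereal_less_eq(3) by (metis max.coboundedI1)
  have "AE x in lebesgue. \<bar>q x\<bar> \<le> max M 0"
    by (rule eventually_mono[OF esssup_AE imp])
  then show ?thesis using that[of "max M 0"] by simp
qed

text \<open>In the exponent, 1 is the coefficient of |v|^2 in the energy inequality, and
  \<open>2 * M\<^sup>2\<close> comes from squaring the sum that bounds the norm of \<open>F\<close>;
  the same squaring puts the factor 2 in front of the integral. As \<open>M\<close> bounds both
  coefficients, the constant is uniform over all \<open>p\<close> with that bound.\<close>

lemma perturbation_estimate:
  fixes u w :: "real \<Rightarrow> 'a::euclidean_space \<Rightarrow> complex"
  assumes T: "0 < T" and \<psi>: "friedrichs_mollifier (\<psi> :: 'a \<Rightarrow> real)"
    and u: "cauchy_solution T q u0 u" and w: "cauchy_solution T p w0 w"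
    and q: "q \<in> borel_measurable lebesgue" "AE x in lebesgue. \<bar>q x\<bar> \<le> M"
    and p: "p \<in> borel_measurable lebesgue" "AE x in lebesgue. \<bar>p x\<bar> \<le> M" and M: "0 \<le> M"
    and t: "t \<in> {0..T}"
  shows "(L2_norm (\<lambda>x. w t x - u t x))\<^sup>2 \<le> ((L2_norm (\<lambda>x. w 0 x - u 0 x))\<^sup>2 +
    2 * integral {0..T} (\<lambda>s. (L2_norm (\<lambda>x. (p x - q x) *\<^sub>R u s x))\<^sup>2)) * exp ((1 + 2 * M\<^sup>2) * T)"
proof -
  have uC: "u \<in> CL2 T" and wC: "w \<in> CL2 T" using u w by (auto simp: cauchy_solution_def)
  note quC = CL2_mult_bounded[OF uC q M] and pwC = CL2_mult_bounded[OF wC p M]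
  define v where "v t x = w t x - u t x" for t x
  define F where "F t x = p x *\<^sub>R w t x - q x *\<^sub>R u t x" for t x
  have vC: "v \<in> CL2 T" unfolding v_def[abs_def] by (rule CL2_diff[OF wC uC])
  have FC: "F \<in> CL2 T" unfolding F_def[abs_def] by (rule CL2_diff[OF pwC quC])
  have pm: "(\<lambda>x. p x - q x) \<in> borel_measurable lebesgue" using p q by simp
  have pb: "AE x in lebesgue. \<bar>p x - q x\<bar> \<le> 2 * M"
    using p(2) q(2) by eventually_elim linarith
  have M2: "0 \<le> 2 * M" using M by simp
  note eC = CL2_mult_bounded[OF uC pm pb M2] and pvC = CL2_mult_bounded[OF vC p M]
  define e where "e s = (L2_norm (\<lambda>x. (p x - q x) *\<^sub>R u s x))\<^sup>2" for s
  have ec: "continuous_on {0..T} e" unfolding e_def by (intro continuous_intros CL2_continuous_norm eC)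
  have e0: "0 \<le> e s" for s by (simp add: e_def)
  define y where "y s = (L2_norm (v s))\<^sup>2" for s
  have yc: "continuous_on {0..T} y" unfolding y_def by (intro continuous_intros CL2_continuous_norm vC)
  have weak: "(LINT x|lebesgue. \<rho> x *\<^sub>R v t x) - (LINT x|lebesgue. \<rho> x *\<^sub>R v 0 x) =
      integral {0..t} (\<lambda>s. (LINT x|lebesgue. lap \<rho> x *\<^sub>R v s x) + (LINT x|lebesgue. \<rho> x *\<^sub>R F s x))"
    if \<rho>: "smooth \<rho>" "\<rho> \<in> Cc" and t: "t \<in> {0..T}" for \<rho> t
  proof -
    have diff: "(LINT x|lebesgue. g x *\<^sub>R (f s x - h s x)) = (LINT x|lebesgue. g x *\<^sub>R f s x) - (LINT x|lebesgue. g x *\<^sub>R h s x)"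
      if "g \<in> Cc" "f \<in> CL2 T" "h \<in> CL2 T" "s \<in> {0..T}" for f h :: "real \<Rightarrow> 'a \<Rightarrow> complex" and g s
      using that by (simp add: scaleR_diff_right integrable_Cc_L2(1) CL2_imp_L2)
    note L = Cc_lap[OF \<rho>]
    let ?gu = "\<lambda>s. (LINT x|lebesgue. lap \<rho> x *\<^sub>R u s x) + (LINT x|lebesgue. \<rho> x *\<^sub>R (q x *\<^sub>R u s x))"
    let ?gw = "\<lambda>s. (LINT x|lebesgue. lap \<rho> x *\<^sub>R w s x) + (LINT x|lebesgue. \<rho> x *\<^sub>R (p x *\<^sub>R w s x))"
    have sub: "{0..t} \<subseteq> {0..T}" and t0: "0 \<in> {0..T}" using t by auto
    have gi: "?gu integrable_on {0..t}" "?gw integrable_on {0..t}"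
      by (intro integrable_continuous_real continuous_on_subset[OF _ sub] continuous_on_add CL2_pairing_continuous
          uC wC quC pwC L \<rho>)+
    have "(LINT x|lebesgue. \<rho> x *\<^sub>R v t x) - (LINT x|lebesgue. \<rho> x *\<^sub>R v 0 x) = integral {0..t} ?gw - integral {0..t} ?gu"
      unfolding v_def diff[OF \<rho>(2) wC uC t] diff[OF \<rho>(2) wC uC t0]
        cauchy_solution_weak[OF T u \<psi> q M \<rho> t, symmetric] cauchy_solution_weak[OF T w \<psi> p M \<rho> t, symmetric]
      by simp
    also have "\<dots> = integral {0..t} (\<lambda>s. ?gw s - ?gu s)"
      by (rule Henstock_Kurzweil_Integration.integral_diff[OF gi(2,1), symmetric])
    also have "\<dots> = integral {0..t} (\<lambda>s. (LINT x|lebesgue. lap \<rho> x *\<^sub>R v s x) + (LINT x|lebesgue. \<rho> x *\<^sub>R F s x))"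
    proof (rule Henstock_Kurzweil_Integration.integral_cong)
      fix s assume "s \<in> {0..t}"
      then have s: "s \<in> {0..T}" using t by auto
      show "?gw s - ?gu s = (LINT x|lebesgue. lap \<rho> x *\<^sub>R v s x) + (LINT x|lebesgue. \<rho> x *\<^sub>R F s x)"
        unfolding v_def F_def diff[OF L wC uC s] diff[OF \<rho>(2) pwC quC s] by simp
    qed
    finally show ?thesis .
  qed
  have Fle: "(L2_norm (F s))\<^sup>2 \<le> 2 * M\<^sup>2 * y s + 2 * e s" if s: "s \<in> {0..T}" for s
  proof -
    have "F s = (\<lambda>x. p x *\<^sub>R v s x + (p x - q x) *\<^sub>R u s x)"
      by (simp add: F_def v_def fun_eq_iff scaleR_diff_right scaleR_diff_left)
    then have "L2_norm (F s) \<le> L2_norm (\<lambda>x. p x *\<^sub>R v s x) + L2_norm (\<lambda>x. (p x - q x) *\<^sub>R u s x)"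
      using L2_norm_triangle[OF CL2_imp_L2[OF pvC s] CL2_imp_L2[OF eC s]] by simp
    also have "\<dots> \<le> M * L2_norm (v s) + L2_norm (\<lambda>x. (p x - q x) *\<^sub>R u s x)"
      using L2_mult_bounded(2)[OF CL2_imp_L2[OF vC s] p M] by simp
    finally have "(L2_norm (F s))\<^sup>2 \<le> (norm (M * L2_norm (v s) + L2_norm (\<lambda>x. (p x - q x) *\<^sub>R u s x)))\<^sup>2"
      by (intro power_mono L2_norm_nonneg) (auto intro: order_trans)
    also have "\<dots> \<le> 2 * (norm (M * L2_norm (v s)))\<^sup>2 + 2 * (norm (L2_norm (\<lambda>x. (p x - q x) *\<^sub>R u s x)))\<^sup>2"
      by (rule norm_add_power2_le)
    finally show ?thesis by (simp add: y_def e_def power_mult_distrib)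
  qed
  have "y t \<le> (y 0 + 2 * integral {0..T} e) * exp ((1 + 2 * M\<^sup>2) * T)"
  proof (rule Gronwall_integral[OF yc _ _ _ t])
    show "0 \<le> 1 + 2 * M\<^sup>2" by simp
    show "0 \<le> y 0 + 2 * integral {0..T} e"
      using e0 ec by (simp add: y_def Henstock_Kurzweil_Integration.integral_nonneg integrable_continuous_real)
    fix t assume t: "t \<in> {0..T}"
    then have sub: "{0..t} \<subseteq> {0..T}" by auto
    note cont = continuous_on_subset[OF yc sub] continuous_on_subset[OF ec sub]
      continuous_on_subset[OF CL2_continuous_norm[OF FC] sub]
    have yi: "y integrable_on {0..t}" and ei: "e integrable_on {0..t}" and eT: "e integrable_on {0..T}"
      using cont(1,2) ec by (auto intro: integrable_continuous_real)
    have "y t \<le> y 0 + integral {0..t} (\<lambda>s. y s + (L2_norm (F s))\<^sup>2)"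
      unfolding y_def by (rule energy_estimate[OF \<psi> vC FC weak t])
    also have "integral {0..t} (\<lambda>s. y s + (L2_norm (F s))\<^sup>2) \<le> integral {0..t} (\<lambda>s. (1 + 2 * M\<^sup>2) * y s + 2 * e s)"
    proof (rule integral_le)
      show "(\<lambda>s. y s + (L2_norm (F s))\<^sup>2) integrable_on {0..t}" "(\<lambda>s. (1 + 2 * M\<^sup>2) * y s + 2 * e s) integrable_on {0..t}"
        by (intro integrable_continuous_real continuous_intros cont)+
      show "y s + (L2_norm (F s))\<^sup>2 \<le> (1 + 2 * M\<^sup>2) * y s + 2 * e s" if "s \<in> {0..t}" for s
        using Fle[of s] that sub by (auto simp: algebra_simps)
    qed
    also have "integral {0..t} (\<lambda>s. (1 + 2 * M\<^sup>2) * y s + 2 * e s) = (1 + 2 * M\<^sup>2) * integral {0..t} y + 2 * integral {0..t} e"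
      using integrable_on_mult_right[OF yi, of "1 + 2 * M\<^sup>2"] integrable_on_mult_right[OF ei, of 2]
      by (simp only: Henstock_Kurzweil_Integration.integral_add integral_mult_right)
    \<comment> \<open>Extending the integral up to \<open>T\<close> makes it independent of
      \<open>t\<close>, as Gronwall's inequality asks of its constant \<open>a\<close>.\<close>
    also have "integral {0..t} e \<le> integral {0..T} e"
      using e0 by (intro integral_subset_le sub ei eT) auto
    finally show "y t \<le> y 0 + 2 * integral {0..T} e + (1 + 2 * M\<^sup>2) * integral {0..t} y" by simp
  qed
  then show ?thesis by (simp add: y_def e_def[abs_def] v_def[abs_def])
qed

theorem theorem3p5:
  fixes T :: real
    and q :: "'a::euclidean_space \<Rightarrow> real"
    and u0 :: "'a \<Rightarrow> complex"
    and u :: "real \<Rightarrow> 'a \<Rightarrow> complex"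
    and \<psi> :: "'a \<Rightarrow> real"
    and \<omega> :: "real \<Rightarrow> real"
    and q_net :: "real \<Rightarrow> 'a \<Rightarrow> real"
    and u0_net :: "real \<Rightarrow> 'a \<Rightarrow> complex"
    and u_net :: "real \<Rightarrow> real \<Rightarrow> 'a \<Rightarrow> complex"
  assumes "T > 0"
    and "u0 \<in> L2"
    and "q \<in> Linf"
    and "AE x in lebesgue. q x \<ge> 0"
    and "cauchy_solution T q u0 u"
    and "friedrichs_mollifier \<psi>"
    and "mollifier_scale \<omega>"
    and "very_weak_solution T \<psi> \<omega> q u0 q_net u0_net u_net"
  shows "\<forall>t\<in>{0..T}. ((\<lambda>\<epsilon>. L2_norm (\<lambda>x. u_net \<epsilon> t x - u t x)) \<longlongrightarrow> 0) (at_right 0)"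
proof
  fix t assume t: "t \<in> {0..T}"
  note T = assms(1) and u0 = assms(2) and u = assms(5) and \<psi> = assms(6)
  note \<psi>' = friedrichs_mollifierD[OF \<psi>]
  interpret nonneg_mollifier \<psi> by unfold_locales (use \<psi>' in auto)
  have qm: "q \<in> borel_measurable lebesgue" using assms(3) by (simp add: Linf_def)
  obtain M where M: "0 \<le> M" "AE x in lebesgue. \<bar>q x\<bar> \<le> M" using Linf_bound[OF assms(3)] by blast
  have uC: "u \<in> CL2 T" using u by (simp add: cauchy_solution_def)
  obtain B where B: "0 \<le> B" "\<And>s. s \<in> {0..T} \<Longrightarrow> L2_norm (u s) \<le> B" using CL2_norm_bound[OF uC] by blast
  have t0: "0 \<in> {0..T}" using T by simp
  \<comment> \<open>Sequences in \<open>{0..1}\<close> that avoid 0 lie in \<open>{0<..1}\<close>,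
    the range in which the nets are specified; along sequences dominated convergence can be
    used.\<close>
  have at: "at_right (0::real) = at 0 within {0..1}" by (simp add: at_within_Icc_at_right)
  show "((\<lambda>\<epsilon>. L2_norm (\<lambda>x. u_net \<epsilon> t x - u t x)) \<longlongrightarrow> 0) (at_right 0)"
    unfolding at tendsto_at_iff_sequentially comp_def
  proof (intro allI impI)
    fix X :: "nat \<Rightarrow> real" assume X: "\<forall>i. X i \<in> {0..1} - {0}" "X \<longlonglongrightarrow> 0"
    then have X1: "X n \<in> {0<..1}" for n by (metis Diff_iff atLeastAtMost_iff greaterThanAtMost_iff insertI1 order_le_less)
    define c where "c n = \<omega> (X n)" for n
    have c: "0 < c n" for n using assms(7) X1 by (simp add: c_def mollifier_scale_def)
    have "(\<omega> \<longlongrightarrow> 0) (at 0 within {0..1})" using assms(7) by (simp add: mollifier_scale_def at)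
    then have c0: "c \<longlonglongrightarrow> 0" using X unfolding tendsto_at_iff_sequentially comp_def c_def by blast
    define p where "p n = convolution q (dilate \<psi> (c n))" for n
    have p: "q_net (X n) = p n" "u0_net (X n) = convolution u0 (dilate \<psi> (c n))" "p n \<in> borel_measurable lebesgue"
      and w: "cauchy_solution T (p n) (convolution u0 (dilate \<psi> (c n))) (u_net (X n))" for n
    proof -
      show 1: "q_net (X n) = p n" "u0_net (X n) = convolution u0 (dilate \<psi> (c n))"
        using assms(8) X1[of n]
        by (simp_all add: very_weak_solution_def regularising_family_def mollifier_net_eq_dilate p_def c_def)
      \<comment> \<open>Measurability of the mollified coefficient is read off its membership in
        \<open>Linf\<close>, which is part of moderateness.\<close>
      show "p n \<in> borel_measurable lebesgue"
        using assms(8) X1[of n] by (auto simp: very_weak_solution_def moderate_def Linf_def simp flip: 1)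
      show "cauchy_solution T (p n) (convolution u0 (dilate \<psi> (c n))) (u_net (X n))"
        using assms(8) X1[of n] by (auto simp: very_weak_solution_def simp flip: 1)
    qed
    have pM: "\<bar>p n x\<bar> \<le> M" for n x unfolding p_def by (rule abs_mollify_le[OF qm M(2) c])
    define e where "e n s = L2_norm (\<lambda>x. (p n x - q x) *\<^sub>R u s x)" for n s
    have pb: "AE x in lebesgue. \<bar>p n x - q x\<bar> \<le> 2 * M" for n
      using M(2)
    proof eventually_elim
      case (elim x)
      then show ?case using pM[of n x] by linarith
    qed
    have M2: "0 \<le> 2 * M" using M by simp
    have dm: "(\<lambda>x. p n x - q x) \<in> borel_measurable lebesgue" for n using p(3) qm by simp
    have ec: "continuous_on {0..T} (e n)" for n
      unfolding e_def by (intro CL2_continuous_norm CL2_mult_bounded[OF uC dm pb M2])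
    have e_le: "e n s \<le> 2 * M * B" if "s \<in> {0..T}" for n s
    proof -
      have "e n s \<le> 2 * M * L2_norm (u s)"
        unfolding e_def by (rule L2_mult_bounded(2)[OF CL2_imp_L2[OF uC that] dm pb M2])
      also have "\<dots> \<le> 2 * M * B" using B(2)[OF that] M2 by (rule mult_left_mono)
      finally show ?thesis .
    qed
    have e_lim: "(\<lambda>n. e n s) \<longlonglongrightarrow> 0" if "s \<in> {0..T}" for s
      unfolding e_def p_def
      by (rule mollify_bounded_mult_tendsto[OF qm M(2,1) _ CL2_imp_L2[OF uC that] c c0]) (use p(3) in \<open>simp add: p_def\<close>)
    \<comment> \<open>Mollification gives the limit at each time \<open>s\<close> separately; the
      bound \<open>(2 * M * B)\<^sup>2\<close>, constant in time, carries it through the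
      integral.\<close>
    have "(\<lambda>n. integral {0..T} (\<lambda>s. (e n s)\<^sup>2)) \<longlonglongrightarrow> integral {0..T} (\<lambda>_. 0)"
    proof (rule dominated_convergence(2)[where h="\<lambda>_. (2 * M * B)\<^sup>2"])
      show "(\<lambda>s. (e n s)\<^sup>2) integrable_on {0..T}" for n
        by (intro integrable_continuous_real continuous_intros ec)
      show "norm ((e n s)\<^sup>2) \<le> (2 * M * B)\<^sup>2" if "s \<in> {0..T}" for n s
        using e_le[OF that, of n] by (simp add: power_mono e_def L2_norm_nonneg)
      show "(\<lambda>n. (e n s)\<^sup>2) \<longlonglongrightarrow> 0" if "s \<in> {0..T}" for s
        using tendsto_power[OF e_lim[OF that], of 2] by simp
    qed auto
    then have lim1: "(\<lambda>n. integral {0..T} (\<lambda>s. (e n s)\<^sup>2)) \<longlonglongrightarrow> 0" by simp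
    note lim2 = mollify_tendsto[OF u0 c c0]
    define K where "K = exp ((1 + 2 * M\<^sup>2) * T)"
    have "(\<lambda>n. sqrt (((L2_norm (\<lambda>x. convolution u0 (dilate \<psi> (c n)) x - u0 x))\<^sup>2 + 2 * integral {0..T} (\<lambda>s. (e n s)\<^sup>2)) * K))
        \<longlonglongrightarrow> sqrt ((0\<^sup>2 + 2 * 0) * K)"
      by (intro tendsto_intros lim1 lim2)
    then have lim: "(\<lambda>n. sqrt (((L2_norm (\<lambda>x. convolution u0 (dilate \<psi> (c n)) x - u0 x))\<^sup>2 + 2 * integral {0..T} (\<lambda>s. (e n s)\<^sup>2)) * K))
        \<longlonglongrightarrow> 0" by simp
    show "(\<lambda>n. L2_norm (\<lambda>x. u_net (X n) t x - u t x)) \<longlonglongrightarrow> 0"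
    proof (rule Lim_null_comparison[OF _ lim], intro always_eventually allI)
      fix n
      have wC: "u_net (X n) \<in> CL2 T" using w[of n] by (simp add: cauchy_solution_def)
      have ae: "AE x in lebesgue. u_net (X n) 0 x - u 0 x = convolution u0 (dilate \<psi> (c n)) x - u0 x"
      proof -
        have "AE x in lebesgue. u_net (X n) 0 x = convolution u0 (dilate \<psi> (c n)) x" "AE x in lebesgue. u 0 x = u0 x"
          using w[of n] u by (auto simp: cauchy_solution_def)
        then show ?thesis by eventually_elim simp
      qed
      have init: "L2_norm (\<lambda>x. u_net (X n) 0 x - u 0 x) = L2_norm (\<lambda>x. convolution u0 (dilate \<psi> (c n)) x - u0 x)"
        by (rule L2_norm_cong_AE[OF ae]) (intro L2_diff CL2_imp_L2[OF wC t0] CL2_imp_L2[OF uC t0] convolution_Young(1) u0 dilate_Cc Cc c)+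
      have "(L2_norm (\<lambda>x. u_net (X n) t x - u t x))\<^sup>2 \<le> ((L2_norm (\<lambda>x. u_net (X n) 0 x - u 0 x))\<^sup>2 +
          2 * integral {0..T} (\<lambda>s. (e n s)\<^sup>2)) * K"
        unfolding e_def K_def
        by (rule perturbation_estimate[OF T \<psi> u w qm M(2) p(3) _ M(1) t]) (simp add: pM)
      then show "norm (L2_norm (\<lambda>x. u_net (X n) t x - u t x))
          \<le> sqrt (((L2_norm (\<lambda>x. convolution u0 (dilate \<psi> (c n)) x - u0 x))\<^sup>2 + 2 * integral {0..T} (\<lambda>s. (e n s)\<^sup>2)) * K)"
        unfolding init by (simp add: L2_norm_nonneg real_le_rsqrt)
    qed
  qed
qed

end
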